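(* Let $S_0$ be a set of constrained Horn clauses in the setting described in the context (definite clauses $P$ defining program predicates and catamorphisms, together with queries), and let $S_0 \Rightarrow S_1 \Rightarrow \cdots \Rightarrow S_n$ be a transformation sequence in which each step $S_i\Rightarrow S_{i+1}$ is an application of one of the rules R1 (definition), R2 (unfolding), R3 (catamorphism addition), R4 (folding) or R5 (erasure addition) described in the context. Then $S_0$ is satisfiable if and only if $S_n$ is satisfiable.
   Context: Clauses. We work in a many-sorted first-order language with equality whose basic sorts are the integers and the booleans and whose other sorts are algebraic data types (ADTs, e.g. lists and binary trees). A constraint is a quantifier-free formula of linear integer arithmetic combined with boolean connectives and if-then-else (theory $LIA\cup Bool$). An atom is $p(t_1,\dots,t_m)$ with $p$ a predicate symbol not in $LIA\cup Bool$. A constrained Horn clause (CHC) is $H\leftarrow c, G$ with $H$ an atom or $\mathit{false}$, $c$ a constraint and $G$ a conjunction of atoms; it is a query if $H=\mathit{false}$ and a definite clause otherwise. By convention every atom in the body of a clause has distinct variables as arguments. A $\mathbb D$-interpretation interprets $LIA\cup Bool$ symbols in the standard way; a set of CHCs is satisfiable if some $\mathbb D$-interpretation makes all its clauses true. For a set $P$ of definite clauses, $M(P)$ denotes its least $\mathbb D$-model. $\mathit{vars}(e)$ is the set of variables of $e$, and $\mathit{adt\text{-}vars}(e)$ the set of its variables of ADT sort. Catamorphisms. A predicate $f$ defined by $P$ with arguments split into input tuple $X$ and output tuple $Y$ is a total function if $M(P)\models\forall X,Y,Z.\,f(X,Y)\wedge f(X,Z)\to Y=Z$ and $M(P)\models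 \forall X\exists Y.\,f(X,Y)$. A list catamorphism $\ell$ is a total function from $\alpha\times list(\beta)$ to $\gamma$ ($\alpha,\beta,\gamma,\delta$ products of basic sorts) defined by clauses $\ell(X,[\,],Y)\leftarrow \ell\_basis(X,Y)$ and $\ell(X,[H|T],Y)\leftarrow f(X,T,Rf),\ \ell(X,T,R),\ \ell\_combine(X,H,R,Rf,Y)$ with $\ell\_basis,\ell\_combine$ total functions and $f$ itself a list catamorphism; binary tree catamorphisms are defined analogously on $leaf$ and $node(L,N,R)$ (some components, e.g. the parameter $X$ or $f$, may be absent). A catamorphism atom has the form $cata(X,T,Y)$ with $X,Y$ tuples of basic-sort variables and $T$ the ADT argument. The initial set is $S_0=P\cup\mathcal Q$ where $P$ is a set of definite clauses and $\mathcal Q$ a set of queries; the predicates of $P$ are the catamorphism predicates and the remaining program predicates, and no clause of $P$ contains both program atoms and catamorphism atoms. A catamorphic abstraction specification assigns to program predicates $p$ (having ADT arguments) expressions $p(Z)\Longrightarrow cata_1(X,T_1,Y_1),\dots,cata_n(X,T_n,Y_n)$ where $Z$ is a tuple of distinct variables, $T_1,\dots,T_n$ are ADT variables of $Z$, the $Y_j$ are pairwise disjoint tuples of distinct basic-sort variables not in $\mathit{vars}(\{X,Z\})$, and $\mathit{vars}(X)\cap\mathit{vars}(Z)=\emptyset$. One-step unfolding. For a clause $D: H\leftarrow c,L,A,R$ and a set $P$ of definite clauses renamed apart from $D$, $\mathit{Unf}(D,A,P)=\{(H\leftarrow c,c_j,L,B_j,R)\vartheta_j\}$ where $K_j\leftarrow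 c_j,B_j$ ranges over the clauses of $P$ such that $A$ and $K_j$ have a most general unifier $\vartheta_j$ and $(c,c_j)\vartheta_j$ is satisfiable. Rules ($\mathit{Defs}_i$ denotes the clauses introduced by R1 in $S_0\Rightarrow\cdots\Rightarrow S_i$; a subconjunction of $G_2$ is a conjunction all of whose atoms are atoms of $G_2$). (R1) Add to $S_i$ a clause $newp(X_1,\dots,X_k)\leftarrow Catas, A$ where $newp$ is a predicate symbol not occurring in $S_0,\dots,S_i$, $\{X_1,\dots,X_k\}=\mathit{vars}(\{Catas,A\})$, $Catas$ is a conjunction of catamorphism atoms with $\mathit{adt\text{-}vars}(Catas)\subseteq\mathit{adt\text{-}vars}(A)$, and $A$ is a program atom. (R2) For $D: newp(U)\leftarrow Catas, A$ in $S_i\cap\mathit{Defs}_i$ with $A$ a program atom and $P$ the set of definite clauses in $S_i$: set $UnfD:=\mathit{Unf}(D,A,P)$; then, while some clause $E$ of $UnfD$ has a catamorphism atom $C$ whose ADT argument is not a variable, replace $E$ by $\mathit{Unf}(E,C,P)$; then, while some clause of $UnfD$ has the form $H\leftarrow d,L,cata(X,T,Y1),cata(X,T,Y2),R$, replace it by $H\leftarrow d, Y1=Y2, L, cata(X,T,Y1), R$. Then $S_{i+1}=(S_i\setminus\{D\})\cup UnfD$. (R3) For $C: H\leftarrow c, Catas, A_1,\dots,A_m$ in $S_i$ ($H$ false or a program atom, $A_k$ program atoms), for $k=1,\dots,m$: let $Catas_k$ be the conjunction of the atoms $F$ of $Catas$ with $\mathit{adt\text{-}vars}(A_k)\cap\mathit{adt\text{-}vars}(F)\neq\emptyset$;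 take a specification $A_k\Longrightarrow cata_1(X,T_1,Y_1),\dots,cata_n(X,T_n,Y_n)$ for the predicate of $A_k$ whose variables $Y_j$ do not occur in $C$, split its right-hand side into subconjunctions $B_1,B_2$ such that a variant $B_1\vartheta$ ($\vartheta$ acting on $\mathit{vars}(B_1)$) is a subconjunction of $Catas_k$ and for each atom $cata_j(X,T_j,Y_j)$ of $B_2\vartheta$ no atom of $Catas_k$ has the form $cata_j(V,T_j,W)$; add $B_2\vartheta$ to the body. The resulting clause replaces $C$. (R4) For $C: H\leftarrow c, Catas^C, A_1,\dots,A_m$ in $S_i$ where $H=\mathit{false}$ or $C$ was obtained by R2 possibly followed by R3: for each $k$ let $Catas^C_k$ be as in R3, and let $D_k: H_k\leftarrow Catas^D_k, A_k$ be a clause of $\mathit{Defs}_i$ (modulo variable renaming) with $Catas^C_k$ a subconjunction of $Catas^D_k$. Replace $C$ by $H\leftarrow c, H_1,\dots,H_m$. (R5) For an atom $A=p(t_1,\dots,t_k,u_1,\dots,u_m)$ with $t_i$ of basic sort and $u_j$ of ADT sort let $\chi_{wo}(A)=p\_woADTs(t_1,\dots,t_k)$ with $p\_woADTs$ a new predicate symbol ($\chi_{wo}(\mathit{false})=\mathit{false}$). For $C: H\leftarrow c, A_1,\dots,A_n$ let $\chi_{wo}(C)$ be $\chi_{wo}(H)\leftarrow c,\chi_{wo}(A_1),\dots,\chi_{wo}(A_n)$ and $\chi_{w\&wo}(C)$ be $H\leftarrow c, A_1,\chi_{wo}(A_1),\dots,A_n,\chi_{wo}(A_n)$. Then $S_{i+1}=\{\chi_{w\&wo}(C)\mid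 C\in S_i\}\cup\{\chi_{wo}(C)\mid C\in S_i,\ \text{head of } C \text{ is not } \mathit{false}\}$.
   Formalization: Added: in R4 each atom of Catas^C shares an ADT variable with some A_k, variables of D_k not in Catas^C_k, A_k are fresh, extra atoms of Catas^D_k have distinct fresh outputs; in R3 the Y_j avoid atoms already added; clauses also obtained otherwise do not count as obtained by R2. *)

theory Defs
  imports "HOL-Library.Multiset"
begin

section \<open>Many-sorted terms over integers, booleans and algebraic data types\<close>

datatype 'a sort = IntS | BoolS | Adt 'a

definition basic :: "'a sort \<Rightarrow> bool" where
  "basic s \<longleftrightarrow> s = IntS \<or> s = BoolS"

text \<open>All elements of the type \<open>'k\<close> are constructors.  The ADT named \<open>a\<close> is generated by the
  constructors \<open>k\<close> with \<open>con_res sg k = a\<close>.\<close>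

record ('a, 'k) adt_sig =
  con_args :: "'k \<Rightarrow> 'a sort list"
  con_res :: "'k \<Rightarrow> 'a"

text \<open>Variables and predicate symbols carry their sorts.\<close>

type_synonym 'a var = "nat \<times> 'a sort"
type_synonym 'a pred = "string \<times> 'a sort list"

text \<open>The symbols of linear integer arithmetic and the booleans, plus the ADT constructors.
  \<open>Scale n\<close> is multiplication by the constant \<open>n\<close>.\<close>

datatype 'k fsym =
    Num int | Add | Sub | Scale int | Less | LessEq | EqI | IteI
  | BoolC bool | Neg | Conj | Disj | Impl | EqB | IteB
  | Con 'k

datatype ('a, 'k) trm = Var "'a var" | Fn "'k fsym" "('a, 'k) trm list"

fun fsym_args :: "('a, 'k) adt_sig \<Rightarrow> 'k fsym \<Rightarrow> 'a sort list" where
  "fsym_args sg (Num n) = []"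
| "fsym_args sg Add = [IntS, IntS]"
| "fsym_args sg Sub = [IntS, IntS]"
| "fsym_args sg (Scale n) = [IntS]"
| "fsym_args sg Less = [IntS, IntS]"
| "fsym_args sg LessEq = [IntS, IntS]"
| "fsym_args sg EqI = [IntS, IntS]"
| "fsym_args sg IteI = [BoolS, IntS, IntS]"
| "fsym_args sg (BoolC b) = []"
| "fsym_args sg Neg = [BoolS]"
| "fsym_args sg Conj = [BoolS, BoolS]"
| "fsym_args sg Disj = [BoolS, BoolS]"
| "fsym_args sg Impl = [BoolS, BoolS]"
| "fsym_args sg EqB = [BoolS, BoolS]"
| "fsym_args sg IteB = [BoolS, BoolS, BoolS]"
| "fsym_args sg (Con k) = con_args sg k"

fun fsym_res :: "('a, 'k) adt_sig \<Rightarrow> 'k fsym \<Rightarrow> 'a sort" where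
  "fsym_res sg (Num n) = IntS"
| "fsym_res sg Add = IntS"
| "fsym_res sg Sub = IntS"
| "fsym_res sg (Scale n) = IntS"
| "fsym_res sg IteI = IntS"
| "fsym_res sg (Con k) = Adt (con_res sg k)"
| "fsym_res sg _ = BoolS"

text \<open>\<open>None\<close> means that the term is ill-sorted.\<close>

primrec trm_sort :: "('a, 'k) adt_sig \<Rightarrow> ('a, 'k) trm \<Rightarrow> 'a sort option" where
  "trm_sort sg (Var x) = Some (snd x)"
| "trm_sort sg (Fn f ts) =
     (if map (trm_sort sg) ts = map Some (fsym_args sg f) then Some (fsym_res sg f) else None)"

primrec trm_vars :: "('a, 'k) trm \<Rightarrow> 'a var set" where
  "trm_vars (Var x) = {x}"
| "trm_vars (Fn f ts) = \<Union> (set (map trm_vars ts))"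

primrec subst :: "('a var \<Rightarrow> ('a, 'k) trm) \<Rightarrow> ('a, 'k) trm \<Rightarrow> ('a, 'k) trm" where
  "subst \<theta> (Var x) = \<theta> x"
| "subst \<theta> (Fn f ts) = Fn f (map (subst \<theta>) ts)"


section \<open>Atoms and constrained Horn clauses\<close>

type_synonym ('a, 'k) atom = "'a pred \<times> ('a, 'k) trm list"

text \<open>The clause \<open>H \<leftarrow> c, G\<close>; the head \<open>None\<close> is \<open>false\<close>.\<close>

datatype ('a, 'k) clause =
  Clause (head: "('a, 'k) atom option") (cstr: "('a, 'k) trm") (body: "('a, 'k) atom list")

abbreviation TrueC :: "('a, 'k) trm" where
  "TrueC \<equiv> Fn (BoolC True) []"

abbreviation AndC :: "('a, 'k) trm \<Rightarrow> ('a, 'k) trm \<Rightarrow> ('a, 'k) trm" where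
  "AndC c d \<equiv> Fn Conj [c, d]"

definition is_query :: "('a, 'k) clause \<Rightarrow> bool" where
  "is_query C \<longleftrightarrow> head C = None"

definition definite :: "('a, 'k) clause set \<Rightarrow> ('a, 'k) clause set" where
  "definite S = {C \<in> S. head C \<noteq> None}"

definition clause_atoms :: "('a, 'k) clause \<Rightarrow> ('a, 'k) atom set" where
  "clause_atoms C = set_option (head C) \<union> set (body C)"

definition clause_preds :: "('a, 'k) clause \<Rightarrow> 'a pred set" where
  "clause_preds C = fst ` clause_atoms C"

definition preds :: "('a, 'k) clause set \<Rightarrow> 'a pred set" where
  "preds S = \<Union> (clause_preds ` S)"

definition atom_vars :: "('a, 'k) atom \<Rightarrow> 'a var set" where
  "atom_vars F = \<Union> (trm_vars ` set (snd F))"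

definition adt_vars :: "('a, 'k) atom \<Rightarrow> 'a var set" where
  "adt_vars F = {x \<in> atom_vars F. \<not> basic (snd x)}"

definition clause_vars :: "('a, 'k) clause \<Rightarrow> 'a var set" where
  "clause_vars C = \<Union> (atom_vars ` clause_atoms C) \<union> trm_vars (cstr C)"

definition subst_atom :: "('a var \<Rightarrow> ('a, 'k) trm) \<Rightarrow> ('a, 'k) atom \<Rightarrow> ('a, 'k) atom" where
  "subst_atom \<theta> F = (fst F, map (subst \<theta>) (snd F))"

definition subst_clause :: "('a var \<Rightarrow> ('a, 'k) trm) \<Rightarrow> ('a, 'k) clause \<Rightarrow> ('a, 'k) clause" where
  "subst_clause \<theta> C =
     Clause (map_option (subst_atom \<theta>) (head C)) (subst \<theta> (cstr C)) (map (subst_atom \<theta>) (body C))"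

definition wf_atom :: "('a, 'k) adt_sig \<Rightarrow> ('a, 'k) atom \<Rightarrow> bool" where
  "wf_atom sg F \<longleftrightarrow> map (trm_sort sg) (snd F) = map Some (snd (fst F))"

text \<open>A well-sorted boolean term contains no ADT subterm, as no symbol leads from an ADT sort
  to a basic sort; so it is a constraint of LIA and the booleans.\<close>

definition wf_clause :: "('a, 'k) adt_sig \<Rightarrow> ('a, 'k) clause \<Rightarrow> bool" where
  "wf_clause sg C \<longleftrightarrow> trm_sort sg (cstr C) = Some BoolS \<and> (\<forall>F\<in>clause_atoms C. wf_atom sg F)"

definition distinct_var_body :: "('a, 'k) clause \<Rightarrow> bool" where
  "distinct_var_body C \<longleftrightarrow> (\<forall>F\<in>set (body C). \<exists>xs. snd F = map Var xs \<and> distinct xs)"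


section \<open>D-interpretations\<close>

text \<open>ADT sorts are interpreted by the ground constructor terms over integers and booleans.\<close>

datatype 'k val = IntV (int_of: int) | BoolV (bool_of: bool) | ConV 'k "'k val list"

primrec val_sort :: "('a, 'k) adt_sig \<Rightarrow> 'k val \<Rightarrow> 'a sort option" where
  "val_sort sg (IntV n) = Some IntS"
| "val_sort sg (BoolV b) = Some BoolS"
| "val_sort sg (ConV k vs) =
     (if map (val_sort sg) vs = map Some (con_args sg k) then Some (Adt (con_res sg k)) else None)"

definition vals_of :: "('a, 'k) adt_sig \<Rightarrow> 'a sort list \<Rightarrow> 'k val list set" where
  "vals_of sg ss = {vs. map (val_sort sg) vs = map Some ss}"

definition wf_sig :: "('a, 'k) adt_sig \<Rightarrow> bool" where
  "wf_sig sg \<longleftrightarrow> (\<forall>a. finite {k. con_res sg k = a} \<and> (\<exists>v. val_sort sg v = Some (Adt a)))"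

primrec fsym_val :: "'k fsym \<Rightarrow> 'k val list \<Rightarrow> 'k val" where
  "fsym_val (Num n) vs = IntV n"
| "fsym_val Add vs = IntV (int_of (vs ! 0) + int_of (vs ! 1))"
| "fsym_val Sub vs = IntV (int_of (vs ! 0) - int_of (vs ! 1))"
| "fsym_val (Scale n) vs = IntV (n * int_of (vs ! 0))"
| "fsym_val Less vs = BoolV (int_of (vs ! 0) < int_of (vs ! 1))"
| "fsym_val LessEq vs = BoolV (int_of (vs ! 0) \<le> int_of (vs ! 1))"
| "fsym_val EqI vs = BoolV (int_of (vs ! 0) = int_of (vs ! 1))"
| "fsym_val IteI vs = (if bool_of (vs ! 0) then vs ! 1 else vs ! 2)"
| "fsym_val (BoolC b) vs = BoolV b"
| "fsym_val Neg vs = BoolV (\<not> bool_of (vs ! 0))"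
| "fsym_val Conj vs = BoolV (bool_of (vs ! 0) \<and> bool_of (vs ! 1))"
| "fsym_val Disj vs = BoolV (bool_of (vs ! 0) \<or> bool_of (vs ! 1))"
| "fsym_val Impl vs = BoolV (bool_of (vs ! 0) \<longrightarrow> bool_of (vs ! 1))"
| "fsym_val EqB vs = BoolV (bool_of (vs ! 0) = bool_of (vs ! 1))"
| "fsym_val IteB vs = (if bool_of (vs ! 0) then vs ! 1 else vs ! 2)"
| "fsym_val (Con k) vs = ConV k vs"

primrec eval :: "('a var \<Rightarrow> 'k val) \<Rightarrow> ('a, 'k) trm \<Rightarrow> 'k val" where
  "eval \<sigma> (Var x) = \<sigma> x"
| "eval \<sigma> (Fn f ts) = fsym_val f (map (eval \<sigma>) ts)"

definition valuation :: "('a, 'k) adt_sig \<Rightarrow> ('a var \<Rightarrow> 'k val) \<Rightarrow> bool" where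
  "valuation sg \<sigma> \<longleftrightarrow> (\<forall>x. val_sort sg (\<sigma> x) = Some (snd x))"

text \<open>A D-interpretation is given by the set of ground atoms that it makes true.\<close>

type_synonym ('a, 'k) interp = "('a pred \<times> 'k val list) set"

definition eval_atom :: "('a var \<Rightarrow> 'k val) \<Rightarrow> ('a, 'k) atom \<Rightarrow> 'a pred \<times> 'k val list" where
  "eval_atom \<sigma> F = (fst F, map (eval \<sigma>) (snd F))"

definition holds :: "('a, 'k) adt_sig \<Rightarrow> ('a, 'k) interp \<Rightarrow> ('a, 'k) clause \<Rightarrow> bool" where
  "holds sg I C \<longleftrightarrow>
     (\<forall>\<sigma>. valuation sg \<sigma> \<and> eval \<sigma> (cstr C) = BoolV True \<and> (\<forall>F\<in>set (body C). eval_atom \<sigma> F \<in> I)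
        \<longrightarrow> (\<exists>H. head C = Some H \<and> eval_atom \<sigma> H \<in> I))"

definition satisfiable :: "('a, 'k) adt_sig \<Rightarrow> ('a, 'k) clause set \<Rightarrow> bool" where
  "satisfiable sg S \<longleftrightarrow> (\<exists>I. \<forall>C\<in>S. holds sg I C)"

definition least_model :: "('a, 'k) adt_sig \<Rightarrow> ('a, 'k) clause set \<Rightarrow> ('a, 'k) interp" where
  "least_model sg P = \<Inter> {I. \<forall>C\<in>P. holds sg I C}"

definition sat_constraint :: "('a, 'k) adt_sig \<Rightarrow> ('a, 'k) trm \<Rightarrow> bool" where
  "sat_constraint sg c \<longleftrightarrow> (\<exists>\<sigma>. valuation sg \<sigma> \<and> eval \<sigma> c = BoolV True)"


section \<open>Total functions and catamorphisms\<close>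

text \<open>The first \<open>n\<close> arguments of \<open>f\<close> are the input.\<close>

definition total_function ::
  "('a, 'k) adt_sig \<Rightarrow> ('a, 'k) clause set \<Rightarrow> nat \<Rightarrow> 'a pred \<Rightarrow> bool" where
  "total_function sg P n f \<longleftrightarrow>
     (\<forall>xs \<in> vals_of sg (take n (snd f)). \<forall>ys \<in> vals_of sg (drop n (snd f)).
        \<forall>zs \<in> vals_of sg (drop n (snd f)).
        (f, xs @ ys) \<in> least_model sg P \<and> (f, xs @ zs) \<in> least_model sg P \<longrightarrow> ys = zs) \<and>
     (\<forall>xs \<in> vals_of sg (take n (snd f)). \<exists>ys \<in> vals_of sg (drop n (snd f)).
        (f, xs @ ys) \<in> least_model sg P)"

definition total_function_constraint ::
  "('a, 'k) adt_sig \<Rightarrow> 'a var set \<Rightarrow> 'a var list \<Rightarrow> ('a, 'k) trm \<Rightarrow> bool" where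
  "total_function_constraint sg X Y c \<longleftrightarrow>
     trm_vars c \<subseteq> X \<union> set Y \<and>
     (\<forall>\<sigma> \<tau>. valuation sg \<sigma> \<and> valuation sg \<tau> \<and> (\<forall>x\<in>X. \<sigma> x = \<tau> x) \<and>
        eval \<sigma> c = BoolV True \<and> eval \<tau> c = BoolV True \<longrightarrow> map \<sigma> Y = map \<tau> Y) \<and>
     (\<forall>\<sigma>. valuation sg \<sigma> \<longrightarrow>
        (\<exists>\<tau>. valuation sg \<tau> \<and> (\<forall>x\<in>X. \<sigma> x = \<tau> x) \<and> eval \<tau> c = BoolV True))"

text \<open>The basis and combination parts of a catamorphism: total functions from variables in \<open>X\<close>
  to \<open>Y\<close>, given either by an atom of an auxiliary predicate (a member of \<open>Ax\<close>) or by a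
  constraint.\<close>

definition function_goal ::
  "('a, 'k) adt_sig \<Rightarrow> 'a pred set \<Rightarrow> ('a, 'k) clause set \<Rightarrow> 'a var set \<Rightarrow> 'a var list \<Rightarrow>
   ('a, 'k) trm \<Rightarrow> ('a, 'k) atom list \<Rightarrow> bool" where
  "function_goal sg Ax P X Y c B \<longleftrightarrow>
     (\<exists>f\<in>Ax. \<exists>Z. distinct Z \<and> set Z \<subseteq> X \<and> total_function sg P (length Z) f \<and>
        c = TrueC \<and> B = [(f, map Var (Z @ Y))]) \<or>
     (B = [] \<and> total_function_constraint sg X Y c)"

text \<open>\<open>(q, X, T, Y)\<close> stands for the catamorphism atom \<open>q(X,T,Y)\<close>.\<close>

type_synonym 'a catom = "'a pred \<times> 'a var list \<times> 'a var \<times> 'a var list"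

fun cata_atom :: "'a catom \<Rightarrow> ('a, 'k) atom" where
  "cata_atom (q, X, T, Y) = (q, map Var (X @ T # Y))"

fun cata_pred :: "'a catom \<Rightarrow> 'a pred" where "cata_pred (q, X, T, Y) = q"
fun cata_ins :: "'a catom \<Rightarrow> 'a var list" where "cata_ins (q, X, T, Y) = X"
fun cata_adt :: "'a catom \<Rightarrow> 'a var" where "cata_adt (q, X, T, Y) = T"
fun cata_outs :: "'a catom \<Rightarrow> 'a var list" where "cata_outs (q, X, T, Y) = Y"

fun wf_catom :: "'a pred set \<Rightarrow> 'a catom \<Rightarrow> bool" where
  "wf_catom K (q, X, T, Y) \<longleftrightarrow>
     q \<in> K \<and> snd q = map snd (X @ T # Y) \<and> distinct (X @ T # Y) \<and>
     (\<forall>x\<in>set (X @ Y). basic (snd x)) \<and> \<not> basic (snd T)"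

text \<open>\<open>e\<close> is the constructor \<open>[]\<close> or \<open>leaf\<close>, and \<open>k\<close> the constructor \<open>[H|T]\<close> or
  \<open>node(L,N,R)\<close>, where \<open>H\<close> and \<open>N\<close> are tuples of basic sort.\<close>

definition list_sort :: "('a, 'k) adt_sig \<Rightarrow> 'a \<Rightarrow> 'k \<Rightarrow> 'k \<Rightarrow> bool" where
  "list_sort sg a e k \<longleftrightarrow>
     e \<noteq> k \<and> {c. con_res sg c = a} = {e, k} \<and> con_args sg e = [] \<and>
     (\<exists>\<beta>. (\<forall>s\<in>set \<beta>. basic s) \<and> con_args sg k = \<beta> @ [Adt a])"

definition tree_sort :: "('a, 'k) adt_sig \<Rightarrow> 'a \<Rightarrow> 'k \<Rightarrow> 'k \<Rightarrow> bool" where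
  "tree_sort sg a e k \<longleftrightarrow>
     e \<noteq> k \<and> {c. con_res sg c = a} = {e, k} \<and> con_args sg e = [] \<and>
     (\<exists>\<beta>. (\<forall>s\<in>set \<beta>. basic s) \<and> con_args sg k = Adt a # \<beta> @ [Adt a])"

definition cata_basis_clause ::
  "('a, 'k) adt_sig \<Rightarrow> 'a pred set \<Rightarrow> ('a, 'k) clause set \<Rightarrow> 'a pred \<Rightarrow> 'k \<Rightarrow> nat \<Rightarrow>
   ('a, 'k) clause \<Rightarrow> bool" where
  "cata_basis_clause sg Ax P p e n C \<longleftrightarrow>
     (\<exists>X Y. length X = n \<and> distinct (X @ Y) \<and>
        head C = Some (p, map Var X @ [Fn (Con e) []] @ map Var Y) \<and>
        function_goal sg Ax P (set X) Y (cstr C) (body C))"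

text \<open>\<open>Zs\<close> are the arguments of the constructor \<open>k\<close>.  For each ADT variable \<open>T\<close> among them
  there are an optional call \<open>f(X,T,Rf)\<close> of another catamorphism (a member of \<open>fs\<close>) and an
  optional recursive call \<open>p(X,T,R)\<close>; the calls of other catamorphisms may omit components
  of \<open>X\<close>.\<close>

definition cata_step_clause ::
  "('a, 'k) adt_sig \<Rightarrow> 'a pred set \<Rightarrow> ('a, 'k) clause set \<Rightarrow> 'a pred \<Rightarrow> 'k \<Rightarrow> nat \<Rightarrow>
   'a pred set \<Rightarrow> ('a, 'k) clause \<Rightarrow> bool" where
  "cata_step_clause sg Ax P p k n fs C \<longleftrightarrow>
     (\<exists>X Zs Y others selfs B.
        length X = n \<and>
        distinct (X @ Zs @ Y @ concat (map cata_outs (others @ selfs))) \<and>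
        head C = Some (p, map Var X @ [Fn (Con k) (map Var Zs)] @ map Var Y) \<and>
        body C = map cata_atom (others @ selfs) @ B \<and>
        (\<forall>F\<in>set (others @ selfs). cata_adt F \<in> set Zs \<and> \<not> basic (snd (cata_adt F))) \<and>
        cata_pred ` set others = fs \<and> distinct (map cata_adt others) \<and>
        (\<forall>F\<in>set others. distinct (cata_ins F) \<and> set (cata_ins F) \<subseteq> set X) \<and>
        cata_pred ` set selfs \<subseteq> {p} \<and> distinct (map cata_adt selfs) \<and>
        (\<forall>F\<in>set selfs. cata_ins F = X) \<and>
        function_goal sg Ax P
          (set X \<union> {z \<in> set Zs. basic (snd z)} \<union> (\<Union>F\<in>set (others @ selfs). set (cata_outs F)))
          Y (cstr C) B)"

text \<open>The premise on \<open>fs\<close> makes the auxiliary catamorphisms catamorphisms on the same ADT.\<close>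

inductive catamorphism ::
  "('a, 'k) adt_sig \<Rightarrow> 'a pred set \<Rightarrow> 'a pred set \<Rightarrow> ('a, 'k) clause set \<Rightarrow> 'a pred \<Rightarrow> bool"
  for sg K Ax P where
  "\<lbrakk> p \<in> K; snd p = \<alpha> @ [Adt a] @ \<gamma>; \<forall>s\<in>set (\<alpha> @ \<gamma>). basic s;
     list_sort sg a e k \<or> tree_sort sg a e k;
     total_function sg P (Suc (length \<alpha>)) p;
     {C \<in> P. \<exists>ts. head C = Some (p, ts)} = {C0, C1};
     cata_basis_clause sg Ax P p e (length \<alpha>) C0;
     cata_step_clause sg Ax P p k (length \<alpha>) fs C1;
     \<forall>f\<in>fs. catamorphism sg K Ax P f \<rbrakk>
   \<Longrightarrow> catamorphism sg K Ax P p"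

text \<open>\<open>K\<close> is the set of catamorphism predicates and \<open>Ax\<close> the set of auxiliary predicates on which
  their clauses depend; all the other predicates are program predicates.\<close>

definition initial_set ::
  "('a, 'k) adt_sig \<Rightarrow> 'a pred set \<Rightarrow> 'a pred set \<Rightarrow>
   ('a, 'k) clause set \<Rightarrow> ('a, 'k) clause set \<Rightarrow> bool" where
  "initial_set sg K Ax P Q \<longleftrightarrow>
     (\<forall>C\<in>P \<union> Q. wf_clause sg C \<and> distinct_var_body C) \<and>
     (\<forall>C\<in>P. \<not> is_query C) \<and> (\<forall>C\<in>Q. is_query C) \<and>
     K \<union> Ax \<subseteq> preds P \<and> K \<inter> Ax = {} \<and>
     (\<forall>p\<in>K. catamorphism sg K Ax P p) \<and>
     (\<forall>C\<in>P. clause_preds C \<subseteq> K \<union> Ax \<or> clause_preds C \<inter> (K \<union> Ax) = {})"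

text \<open>\<open>(p, Z, cs)\<close> stands for the expression \<open>p(Z) \<Longrightarrow> cs\<close>.\<close>

type_synonym 'a cata_spec = "'a pred \<times> 'a var list \<times> 'a catom list"

fun wf_spec :: "'a pred set \<Rightarrow> 'a pred set \<Rightarrow> 'a cata_spec \<Rightarrow> bool" where
  "wf_spec K Ax (p, Z, cs) \<longleftrightarrow>
     p \<notin> K \<union> Ax \<and> (\<exists>s\<in>set (snd p). \<not> basic s) \<and> snd p = map snd Z \<and> distinct Z \<and>
     (\<forall>F\<in>set cs. wf_catom K F \<and> cata_adt F \<in> set Z \<and> set (cata_ins F) \<inter> set Z = {}) \<and>
     distinct (concat (map cata_outs cs)) \<and>
     set (concat (map cata_outs cs)) \<inter> (set Z \<union> (\<Union>F\<in>set cs. set (cata_ins F))) = {}"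


section \<open>Unification and one-step unfolding\<close>

definition renaming :: "('a var \<Rightarrow> 'a var) \<Rightarrow> bool" where
  "renaming \<rho> \<longleftrightarrow> bij \<rho> \<and> (\<forall>x. snd (\<rho> x) = snd x)"

definition rename_clause :: "('a var \<Rightarrow> 'a var) \<Rightarrow> ('a, 'k) clause \<Rightarrow> ('a, 'k) clause" where
  "rename_clause \<rho> = subst_clause (\<lambda>x. Var (\<rho> x))"

fun rename_catom :: "('a var \<Rightarrow> 'a var) \<Rightarrow> 'a catom \<Rightarrow> 'a catom" where
  "rename_catom \<rho> (q, X, T, Y) = (q, map \<rho> X, \<rho> T, map \<rho> Y)"

definition catom_vars :: "'a catom list \<Rightarrow> 'a var set" where
  "catom_vars cs = (\<Union>F\<in>set cs. insert (cata_adt F) (set (cata_ins F) \<union> set (cata_outs F)))"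

definition substitution :: "('a, 'k) adt_sig \<Rightarrow> ('a var \<Rightarrow> ('a, 'k) trm) \<Rightarrow> bool" where
  "substitution sg \<theta> \<longleftrightarrow> (\<forall>x. trm_sort sg (\<theta> x) = Some (snd x))"

definition unifier ::
  "('a, 'k) adt_sig \<Rightarrow> ('a var \<Rightarrow> ('a, 'k) trm) \<Rightarrow> ('a, 'k) atom \<Rightarrow> ('a, 'k) atom \<Rightarrow> bool" where
  "unifier sg \<theta> F G \<longleftrightarrow> substitution sg \<theta> \<and> subst_atom \<theta> F = subst_atom \<theta> G"

definition mgu ::
  "('a, 'k) adt_sig \<Rightarrow> ('a var \<Rightarrow> ('a, 'k) trm) \<Rightarrow> ('a, 'k) atom \<Rightarrow> ('a, 'k) atom \<Rightarrow> bool" where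
  "mgu sg \<theta> F G \<longleftrightarrow> unifier sg \<theta> F G \<and>
     (\<forall>\<tau>. unifier sg \<tau> F G \<longrightarrow> (\<exists>\<delta>. substitution sg \<delta> \<and> (\<forall>x. \<tau> x = subst \<delta> (\<theta> x))))"

text \<open>\<open>unf sg P E L A R U\<close>: the body of \<open>E\<close> is \<open>L, A, R\<close>, and \<open>U\<close> is \<open>Unf(E,A,P)\<close>.  This is a
  relation because \<open>U\<close> depends on the choice of the variants \<open>\<rho>\<close> of the clauses of \<open>P\<close> and of
  the most general unifiers \<open>\<theta>\<close>.\<close>

definition unf ::
  "('a, 'k) adt_sig \<Rightarrow> ('a, 'k) clause set \<Rightarrow> ('a, 'k) clause \<Rightarrow>
   ('a, 'k) atom list \<Rightarrow> ('a, 'k) atom \<Rightarrow> ('a, 'k) atom list \<Rightarrow> ('a, 'k) clause set \<Rightarrow> bool" where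
  "unf sg P E L A R U \<longleftrightarrow> body E = L @ A # R \<and>
     (\<exists>\<rho> \<theta>.
        (\<forall>C\<in>P. renaming (\<rho> C) \<and> clause_vars (rename_clause (\<rho> C) C) \<inter> clause_vars E = {} \<and>
           ((\<exists>\<tau>. unifier sg \<tau> A (the (head (rename_clause (\<rho> C) C)))) \<longrightarrow>
            mgu sg (\<theta> C) A (the (head (rename_clause (\<rho> C) C))))) \<and>
        U = {subst_clause (\<theta> C) (Clause (head E) (AndC (cstr E) (cstr C')) (L @ body C' @ R)) | C C'.
               C \<in> P \<and> C' = rename_clause (\<rho> C) C \<and> mgu sg (\<theta> C) A (the (head C')) \<and>
               sat_constraint sg (subst (\<theta> C) (AndC (cstr E) (cstr C')))})"


section \<open>The transformation rules\<close>

text \<open>A state consists of the current set of clauses, the set \<open>Defs\<^sub>i\<close> of the clauses introduced so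
  far by the definition rule, and the clauses obtained by unfolding, possibly followed by
  catamorphism addition.  A clause that is in the current set for another reason as well (because
  two derivations happen to yield identical clauses) is not counted among the latter.  The argument \<open>used\<close> of the rules is the set of the predicate symbols
  occurring in \<open>S\<^sub>0, \<dots>, S\<^sub>i\<close>.\<close>

type_synonym ('a, 'k) state =
  "('a, 'k) clause set \<times> ('a, 'k) clause set \<times> ('a, 'k) clause set"

definition adt_pos :: "'a pred \<Rightarrow> nat" where
  "adt_pos q = length (takeWhile basic (snd q))"

definition adt_arg :: "('a, 'k) atom \<Rightarrow> ('a, 'k) trm" where
  "adt_arg F = snd F ! adt_pos (fst F)"

text \<open>The parts \<open>Catas\<close> and \<open>A\<^sub>1, \<dots>, A\<^sub>m\<close> of the body of a clause.\<close>

definition catas :: "'a pred set \<Rightarrow> ('a, 'k) clause \<Rightarrow> ('a, 'k) atom list" where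
  "catas K C = filter (\<lambda>F. fst F \<in> K) (body C)"

definition prog_atoms ::
  "'a pred set \<Rightarrow> 'a pred set \<Rightarrow> ('a, 'k) clause \<Rightarrow> ('a, 'k) atom list" where
  "prog_atoms K Ax C = filter (\<lambda>F. fst F \<notin> K \<union> Ax) (body C)"

definition catas_for :: "('a, 'k) atom list \<Rightarrow> ('a, 'k) atom \<Rightarrow> ('a, 'k) atom list" where
  "catas_for Cs A = filter (\<lambda>F. adt_vars A \<inter> adt_vars F \<noteq> {}) Cs"

subsection \<open>R1: definition\<close>

definition R1 ::
  "'a pred set \<Rightarrow> 'a pred set \<Rightarrow> 'a pred set \<Rightarrow> ('a, 'k) state \<Rightarrow> ('a, 'k) state \<Rightarrow> bool" where
  "R1 K Ax used = (\<lambda>(S, Defs, Fld) (S', Defs', Fld').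
     \<exists>newp Xs cs p zs.
       newp \<notin> used \<and> snd newp = map snd Xs \<and> distinct Xs \<and>
       p \<in> used - (K \<union> Ax) \<and> snd p = map snd zs \<and> distinct zs \<and>
       (\<forall>F\<in>set cs. wf_catom K F \<and> cata_adt F \<in> set zs) \<and>
       set Xs = catom_vars cs \<union> set zs \<and>
       (let D = Clause (Some (newp, map Var Xs)) TrueC (map cata_atom cs @ [(p, map Var zs)])
        in S' = insert D S \<and> Defs' = insert D Defs \<and> Fld' = Fld))"

subsection \<open>R2: unfolding\<close>

definition cata_unfold_step ::
  "('a, 'k) adt_sig \<Rightarrow> 'a pred set \<Rightarrow> ('a, 'k) clause set \<Rightarrow>
   ('a, 'k) clause set \<Rightarrow> ('a, 'k) clause set \<Rightarrow> bool" where
  "cata_unfold_step sg K P U U' \<longleftrightarrow>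
     (\<exists>E\<in>U. \<exists>L F R V. fst F \<in> K \<and> adt_arg F \<notin> range Var \<and> unf sg P E L F R V \<and>
        U' = (U - {E}) \<union> V)"

definition cata_unfolded :: "'a pred set \<Rightarrow> ('a, 'k) clause set \<Rightarrow> bool" where
  "cata_unfolded K U \<longleftrightarrow> (\<forall>E\<in>U. \<forall>F\<in>set (body E). fst F \<in> K \<longrightarrow> adt_arg F \<in> range Var)"

text \<open>The constraint \<open>t = u\<close> for tuples of terms of basic sorts.\<close>

fun tuple_eq :: "'a sort list \<Rightarrow> ('a, 'k) trm list \<Rightarrow> ('a, 'k) trm list \<Rightarrow> ('a, 'k) trm" where
  "tuple_eq (s # ss) (t # ts) (u # us) =
     AndC (Fn (if s = IntS then EqI else EqB) [t, u]) (tuple_eq ss ts us)"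
| "tuple_eq _ _ _ = TrueC"

text \<open>The two atoms with the same catamorphism predicate, input and ADT argument need not be adjacent
  in the body.\<close>

definition cata_merge ::
  "'a pred set \<Rightarrow> ('a, 'k) clause \<Rightarrow> ('a, 'k) clause \<Rightarrow> bool" where
  "cata_merge K E E' \<longleftrightarrow>
     (\<exists>L M R q X T Y1 Y2. q \<in> K \<and> length X = adt_pos q \<and>
        body E = L @ (q, X @ T # Y1) # M @ (q, X @ T # Y2) # R \<and>
        E' = Clause (head E) (AndC (cstr E) (tuple_eq (drop (Suc (adt_pos q)) (snd q)) Y1 Y2))
               (L @ (q, X @ T # Y1) # M @ R))"

definition cata_merge_step ::
  "'a pred set \<Rightarrow> ('a, 'k) clause set \<Rightarrow> ('a, 'k) clause set \<Rightarrow> bool" where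
  "cata_merge_step K U U' \<longleftrightarrow> (\<exists>E\<in>U. \<exists>E'. cata_merge K E E' \<and> U' = insert E' (U - {E}))"

definition R2 ::
  "('a, 'k) adt_sig \<Rightarrow> 'a pred set \<Rightarrow> ('a, 'k) state \<Rightarrow> ('a, 'k) state \<Rightarrow> bool" where
  "R2 sg K = (\<lambda>(S, Defs, Fld) (S', Defs', Fld').
     \<exists>D Cs A U1 U2 UnfD.
       D \<in> S \<inter> Defs \<and> body D = Cs @ [A] \<and>
       unf sg (definite S) D Cs A [] U1 \<and>
       (cata_unfold_step sg K (definite S))\<^sup>*\<^sup>* U1 U2 \<and> cata_unfolded K U2 \<and>
       (cata_merge_step K)\<^sup>*\<^sup>* U2 UnfD \<and> (\<forall>E\<in>UnfD. \<nexists>E'. cata_merge K E E') \<and>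
       S' = (S - {D}) \<union> UnfD \<and> Defs' = Defs \<and>
       Fld' = (Fld - {D}) \<union> (UnfD - (S - {D})))"

subsection \<open>R3: catamorphism addition\<close>

text \<open>\<open>cata_add K Spec Cs E As E'\<close>: \<open>E'\<close> is obtained from \<open>E\<close> by processing the program atoms
  \<open>As\<close> from left to right, where \<open>Cs\<close> are the catamorphism atoms of the original clause.  The
  specification is instantiated to the program atom by a renaming \<open>\<rho>\<close>.  A program atom whose
  predicate has no specification contributes nothing.\<close>

inductive cata_add ::
  "'a cata_spec set \<Rightarrow> ('a, 'k) atom list \<Rightarrow>
   ('a, 'k) clause \<Rightarrow> ('a, 'k) atom list \<Rightarrow> ('a, 'k) clause \<Rightarrow> bool"
  for Spec Cs where
  Nil: "cata_add Spec Cs E [] E"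
| Skip: "\<lbrakk> \<forall>Z cs. (fst A, Z, cs) \<notin> Spec; cata_add Spec Cs E As E' \<rbrakk> \<Longrightarrow> cata_add Spec Cs E (A # As) E'"
| Add: "\<lbrakk> (p, Z, cs) \<in> Spec; renaming \<rho>; A = (p, map Var (map \<rho> Z)); cs' = map (rename_catom \<rho>) cs;
     set (concat (map cata_outs cs')) \<inter> clause_vars E = {};
     mset cs' = mset B1 + mset B2;
     inj_on \<theta> (catom_vars B1); \<forall>x. snd (\<theta> x) = snd x; \<forall>x. x \<notin> catom_vars B1 \<longrightarrow> \<theta> x = x;
     set (map (\<lambda>F. cata_atom (rename_catom \<theta> F)) B1) \<subseteq> set (catas_for Cs A);
     N = map (\<lambda>F. cata_atom (rename_catom \<theta> F)) B2;
     \<forall>F\<in>set N. \<forall>G\<in>set (catas_for Cs A). \<not> (fst G = fst F \<and> adt_arg G = adt_arg F);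
     cata_add Spec Cs (Clause (head E) (cstr E) (body E @ N)) As E' \<rbrakk>
   \<Longrightarrow> cata_add Spec Cs E (A # As) E'"

definition R3 ::
  "'a pred set \<Rightarrow> 'a pred set \<Rightarrow> 'a cata_spec set \<Rightarrow>
   ('a, 'k) state \<Rightarrow> ('a, 'k) state \<Rightarrow> bool" where
  "R3 K Ax Spec = (\<lambda>(S, Defs, Fld) (S', Defs', Fld').
     \<exists>C E. C \<in> S \<and> (\<forall>H. head C = Some H \<longrightarrow> fst H \<notin> K \<union> Ax) \<and>
       (\<forall>F\<in>set (body C). fst F \<notin> Ax) \<and>
       cata_add Spec (catas K C) C (prog_atoms K Ax C) E \<and>
       S' = insert E (S - {C}) \<and> Defs' = Defs \<and>
       Fld' = (if C \<in> Fld then (Fld - {C}) \<union> ({E} - (S - {C})) else Fld - {E}))"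

subsection \<open>R4: folding\<close>

text \<open>The atoms can be ordered so that the outputs of each atom are distinct fresh variables:
  they are not in \<open>V\<close>, not inputs of the atom, and not in the atoms before it.\<close>

fun fresh_outputs :: "'a var set \<Rightarrow> 'a catom list \<Rightarrow> bool" where
  "fresh_outputs V [] \<longleftrightarrow> True"
| "fresh_outputs V ((q, X, T, Y) # cs) \<longleftrightarrow>
     distinct Y \<and> set Y \<inter> (V \<union> set X) = {} \<and> fresh_outputs (V \<union> set X \<union> set Y) cs"

text \<open>\<open>fold_def K Defs V G A D\<close>: \<open>D\<close> is a variant \<open>H \<leftarrow> Catas, A\<close> of a clause of \<open>Defs\<close> such that
  the atoms \<open>G\<close> are atoms of \<open>Catas\<close>.  The variant is renamed apart from the variables \<open>V\<close> of the
  clause to be folded (up to those in \<open>G\<close> and \<open>A\<close>).  The further atoms of \<open>Catas\<close> have fresh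
  outputs, so that by totality they only add existentially quantified values: without this
  condition folding would add constraints, e.g. when replacing \<open>len(T,Y), p(T)\<close> by a predicate
  defined as \<open>len(T,Y), sum(T,Y), p(T)\<close>.\<close>

definition fold_def ::
  "'a pred set \<Rightarrow> ('a, 'k) clause set \<Rightarrow> 'a var set \<Rightarrow> ('a, 'k) atom list \<Rightarrow>
   ('a, 'k) atom \<Rightarrow> ('a, 'k) clause \<Rightarrow> bool" where
  "fold_def K Defs V G A D \<longleftrightarrow>
     (\<exists>D0\<in>Defs. \<exists>\<rho> CsD ex. renaming \<rho> \<and> D = rename_clause \<rho> D0 \<and>
        body D = CsD @ [A] \<and> set G \<subseteq> set CsD \<and>
        (clause_vars D - \<Union> (atom_vars ` set (A # G))) \<inter> V = {} \<and>
        set CsD - set G = set (map cata_atom ex) \<and> (\<forall>F\<in>set ex. wf_catom K F) \<and>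
        fresh_outputs (\<Union> (atom_vars ` set (A # G))) ex)"

text \<open>Every catamorphism atom of \<open>C\<close> must share an ADT variable with some program atom: the other
  catamorphism atoms would be lost, and e.g. \<open>false \<leftarrow> Y < 0, len(T,Y)\<close> would become
  \<open>false \<leftarrow> Y < 0\<close>.\<close>

definition R4 ::
  "'a pred set \<Rightarrow> 'a pred set \<Rightarrow> ('a, 'k) state \<Rightarrow> ('a, 'k) state \<Rightarrow> bool" where
  "R4 K Ax = (\<lambda>(S, Defs, Fld) (S', Defs', Fld').
     \<exists>C Ds E. C \<in> S \<and> (is_query C \<or> C \<in> Fld) \<and>
       (\<forall>F\<in>set (body C). fst F \<notin> Ax) \<and>
       (\<forall>F\<in>set (catas K C). \<exists>A\<in>set (prog_atoms K Ax C). F \<in> set (catas_for (catas K C) A)) \<and>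
       list_all2 (\<lambda>A D. fold_def K Defs (clause_vars C) (catas_for (catas K C) A) A D)
         (prog_atoms K Ax C) Ds \<and>
       (\<forall>i<length Ds. \<forall>j<length Ds. i \<noteq> j \<longrightarrow>
          clause_vars (Ds ! i) \<inter> clause_vars (Ds ! j) \<subseteq> clause_vars C) \<and>
       E = Clause (head C) (cstr C) (map (\<lambda>D. the (head D)) Ds) \<and>
       S' = insert E (S - {C}) \<and> Defs' = Defs \<and> Fld' = Fld - {C, E})"

subsection \<open>R5: erasure addition\<close>

text \<open>\<open>wo p\<close> is the new predicate symbol \<open>p_woADTs\<close>.\<close>

definition erase_atom :: "('a pred \<Rightarrow> 'a pred) \<Rightarrow> ('a, 'k) atom \<Rightarrow> ('a, 'k) atom" where
  "erase_atom wo F =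
     (wo (fst F), map fst (filter (\<lambda>(t, s). basic s) (zip (snd F) (snd (fst F)))))"

definition erase_clause :: "('a pred \<Rightarrow> 'a pred) \<Rightarrow> ('a, 'k) clause \<Rightarrow> ('a, 'k) clause" where
  "erase_clause wo C =
     Clause (map_option (erase_atom wo) (head C)) (cstr C) (map (erase_atom wo) (body C))"

definition with_erasure :: "('a pred \<Rightarrow> 'a pred) \<Rightarrow> ('a, 'k) clause \<Rightarrow> ('a, 'k) clause" where
  "with_erasure wo C =
     Clause (head C) (cstr C) (concat (map (\<lambda>F. [F, erase_atom wo F]) (body C)))"

definition R5 :: "'a pred set \<Rightarrow> ('a, 'k) state \<Rightarrow> ('a, 'k) state \<Rightarrow> bool" where
  "R5 used = (\<lambda>(S, Defs, Fld) (S', Defs', Fld').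
     \<exists>wo. inj_on wo (preds S) \<and> wo ` preds S \<inter> used = {} \<and>
       (\<forall>p\<in>preds S. snd (wo p) = filter basic (snd p)) \<and>
       S' = with_erasure wo ` S \<union> erase_clause wo ` {C \<in> S. \<not> is_query C} \<and>
       Defs' = Defs \<and> Fld' = {})"

subsection \<open>Transformation sequences\<close>

definition step ::
  "('a, 'k) adt_sig \<Rightarrow> 'a pred set \<Rightarrow> 'a pred set \<Rightarrow> 'a cata_spec set \<Rightarrow> 'a pred set \<Rightarrow>
   ('a, 'k) state \<Rightarrow> ('a, 'k) state \<Rightarrow> bool" where
  "step sg K Ax Spec used s s' \<longleftrightarrow>
     R1 K Ax used s s' \<or> R2 sg K s s' \<or> R3 K Ax Spec s s' \<or> R4 K Ax s s' \<or> R5 used s s'"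

definition transformation_sequence ::
  "('a, 'k) adt_sig \<Rightarrow> 'a pred set \<Rightarrow> 'a pred set \<Rightarrow> 'a cata_spec set \<Rightarrow> nat \<Rightarrow>
   (nat \<Rightarrow> ('a, 'k) clause set) \<Rightarrow> bool" where
  "transformation_sequence sg K Ax Spec n S \<longleftrightarrow>
     (\<exists>Defs Fld. Defs 0 = {} \<and> Fld 0 = {} \<and>
        (\<forall>i<n. step sg K Ax Spec (\<Union>j\<le>i. preds (S j))
                 (S i, Defs i, Fld i) (S (Suc i), Defs (Suc i), Fld (Suc i))))"

end

(* A state is satisfiable iff its queries hold in the least model of its definite clauses, so it is
   enough to follow that model.  Each rule changes it only by adding atoms of new predicates, and
   turns the queries into equivalent ones: catamorphism addition and folding because catamorphisms
   are total functions and definitions are equivalences in the model, unfolding because resolution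
   is sound and complete for it.  The danger is that folding makes definitions circular and loses
   atoms of the least model.  Every true atom is therefore given a weight and a clause instance
   deriving it from lighter atoms.  The head of a definition outweighs its program atom by at most
   one; an unfolded clause has a slack of one between head and body, which folding uses up. *)

theory Submission
  imports Defs
begin

text \<open>The slack of one is the sum of two strict inequalities: the head of a definition is
  heavier than its program atom, which is heavier than the body it is resolved with. Catamorphism
  and auxiliary atoms carry no weight condition, because a head is bounded by its program atom
  alone, while definitions and catamorphism addition bring in catamorphism atoms of any depth; they
  are recovered from a fixed set of clauses instead. Erasure disturbs this split by putting erased
  atoms into the clauses of the catamorphisms. The erased copies of their predicates therefore form
  a level of their own, and weights are compared only inside a level. An erased atom is weighed by
  the least rank of its derivations; erasing a derivation leaves a derivation, so clauses extended
  by erased atoms stay supported. Completeness of unfolding needs a most general unifier for atoms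
  with a common instance. The rule supplies one as soon as some unifier exists, and matching one
  atom against the other yields that unifier.\<close>

declare split_paired_All [simp del] split_paired_Ex [simp del]

section \<open>Terms, substitutions and valuations\<close>

lemma eval_subst: "eval \<sigma> (subst \<theta> t) = eval (\<lambda>x. eval \<sigma> (\<theta> x)) t"
  by (induction t) (simp_all add: comp_def cong: map_cong)

lemma eval_cong: "(\<And>x. x \<in> trm_vars t \<Longrightarrow> \<sigma> x = \<tau> x) \<Longrightarrow> eval \<sigma> t = eval \<tau> t"
proof (induction t)
  case (Fn f ts)
  then have "map (eval \<sigma>) ts = map (eval \<tau>) ts"
    by (intro map_cong) auto
  then show ?case by (simp del: map_eq_conv)
qed simp

lemma subst_cong: "(\<And>x. x \<in> trm_vars t \<Longrightarrow> \<theta> x = \<delta> x) \<Longrightarrow> subst \<theta> t = subst \<delta> t"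
  by (induction t) auto

lemma subst_Var [simp]: "subst Var t = t"
  by (induction t) (simp_all add: map_idI)

lemma trm_sort_subst: "substitution sg \<theta> \<Longrightarrow> trm_sort sg (subst \<theta> t) = trm_sort sg t"
proof (induction t)
  case (Fn f ts)
  then have "map (trm_sort sg \<circ> subst \<theta>) ts = map (trm_sort sg) ts"
    by (intro map_cong) auto
  then show ?case by (simp del: map_eq_conv)
qed (simp add: substitution_def)

lemma val_sort_IntS: "val_sort sg v = Some IntS \<longleftrightarrow> (\<exists>n. v = IntV n)"
  by (cases v) auto

lemma val_sort_BoolS: "val_sort sg v = Some BoolS \<longleftrightarrow> (\<exists>b. v = BoolV b)"
  by (cases v) auto

lemma val_sort_fsym_val:
  assumes "map (val_sort sg) vs = map Some (fsym_args sg f)"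
  shows "val_sort sg (fsym_val f vs) = Some (fsym_res sg f)"
  using assms by (cases f) (auto simp: map_eq_Cons_conv)

lemma val_sort_eval:
  "valuation sg \<sigma> \<Longrightarrow> trm_sort sg t = Some s \<Longrightarrow> val_sort sg (eval \<sigma> t) = Some s"
proof (induction t arbitrary: s)
  case (Fn f ts)
  then have ts: "map (trm_sort sg) ts = map Some (fsym_args sg f)" and s: "s = fsym_res sg f"
    by (auto split: if_splits)
  have "val_sort sg (eval \<sigma> t) = trm_sort sg t" if "t \<in> set ts" for t
  proof -
    have "trm_sort sg t \<in> set (map Some (fsym_args sg f))"
      using that ts by (metis imageI set_map)
    then show ?thesis using Fn.IH[OF that Fn.prems(1)] by auto
  qed
  then have "map (val_sort sg) (map (eval \<sigma>) ts) = map (trm_sort sg) ts"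
    by simp
  then show ?case using ts s val_sort_fsym_val[of sg "map (eval \<sigma>) ts" f] by simp
qed (auto simp: valuation_def)

lemma valuation_subst:
  "valuation sg \<sigma> \<Longrightarrow> substitution sg \<theta> \<Longrightarrow> valuation sg (\<lambda>x. eval \<sigma> (\<theta> x))"
  by (simp add: valuation_def substitution_def val_sort_eval)

lemma eval_AndC:
  assumes "valuation sg \<sigma>" "trm_sort sg c = Some BoolS" "trm_sort sg d = Some BoolS"
  shows "eval \<sigma> (AndC c d) = BoolV True \<longleftrightarrow> eval \<sigma> c = BoolV True \<and> eval \<sigma> d = BoolV True"
  using val_sort_eval[OF assms(1,2)] val_sort_eval[OF assms(1,3)]
  by (auto simp: val_sort_BoolS)

lemma override_map:
  assumes "distinct xs" "length xs = length ys"
  obtains g where "map g xs = ys" "\<And>x. x \<notin> set xs \<Longrightarrow> g x = f x"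
proof
  let ?g = "\<lambda>x. if x \<in> set xs then the (map_of (zip xs ys) x) else f x"
  show "map ?g xs = ys"
    using assms by (intro nth_equalityI) (auto simp: map_of_zip_nth)
qed simp

lemma valuation_override:
  assumes "valuation sg \<sigma>" "distinct Y" "map (val_sort sg) ys = map (\<lambda>y. Some (snd y)) Y"
  obtains \<tau> where "valuation sg \<tau>" "map \<tau> Y = ys" "\<And>x. x \<notin> set Y \<Longrightarrow> \<tau> x = \<sigma> x"
proof -
  have "length Y = length ys" using assms(3) by (metis length_map)
  then obtain \<tau> where \<tau>: "map \<tau> Y = ys" "\<And>x. x \<notin> set Y \<Longrightarrow> \<tau> x = \<sigma> x"
    using override_map[OF assms(2)] by metis
  have "val_sort sg (\<tau> x) = Some (snd x)" for x
    using \<tau> assms(1,3) by (cases "x \<in> set Y") (auto simp: valuation_def)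
  then show ?thesis using that \<tau> unfolding valuation_def by blast
qed

lemma eval_atom_subst: "eval_atom \<sigma> (subst_atom \<theta> F) = eval_atom (\<lambda>x. eval \<sigma> (\<theta> x)) F"
  by (simp add: eval_atom_def subst_atom_def eval_subst)

lemma eval_atom_cong:
  "(\<And>x. x \<in> atom_vars F \<Longrightarrow> \<sigma> x = \<tau> x) \<Longrightarrow> eval_atom \<sigma> F = eval_atom \<tau> F"
  unfolding eval_atom_def atom_vars_def by (auto intro!: eval_cong)

lemma fst_eval_atom [simp]: "fst (eval_atom \<sigma> F) = fst F"
  by (simp add: eval_atom_def)

lemma fst_subst_atom [simp]: "fst (subst_atom \<theta> F) = fst F"
  by (simp add: subst_atom_def)

lemma wf_atom_subst: "substitution sg \<theta> \<Longrightarrow> wf_atom sg (subst_atom \<theta> F) = wf_atom sg F"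
  by (simp add: wf_atom_def subst_atom_def trm_sort_subst comp_def)

lemma eval_atom_sorts:
  assumes "valuation sg \<sigma>" "wf_atom sg F"
  shows "map (val_sort sg) (snd (eval_atom \<sigma> F)) = map Some (snd (fst F))"
proof -
  have "map (val_sort sg \<circ> eval \<sigma>) (snd F) = map (trm_sort sg) (snd F)"
  proof (intro map_cong refl)
    fix t assume "t \<in> set (snd F)"
    then have "trm_sort sg t \<in> set (map Some (snd (fst F)))"
      using assms(2) by (metis imageI set_map wf_atom_def)
    then show "(val_sort sg \<circ> eval \<sigma>) t = trm_sort sg t"
      using val_sort_eval[OF assms(1)] by auto
  qed
  then show ?thesis using assms(2) by (simp add: eval_atom_def wf_atom_def del: map_eq_conv)
qed


section \<open>Clause instances and least models\<close>

text \<open>Truth of constraint and body without regard to the head, so that definite clauses and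
  queries can both be compared by their firing instances.\<close>

definition fires ::
  "('a, 'k) adt_sig \<Rightarrow> ('a, 'k) interp \<Rightarrow> ('a, 'k) clause \<Rightarrow> ('a var \<Rightarrow> 'k val) \<Rightarrow> bool" where
  "fires sg I C \<sigma> \<longleftrightarrow>
     valuation sg \<sigma> \<and> eval \<sigma> (cstr C) = BoolV True \<and> (\<forall>F\<in>set (body C). eval_atom \<sigma> F \<in> I)"

definition derives ::
  "('a, 'k) adt_sig \<Rightarrow> ('a, 'k) interp \<Rightarrow> ('a, 'k) clause \<Rightarrow> ('a var \<Rightarrow> 'k val) \<Rightarrow>
   'a pred \<times> 'k val list \<Rightarrow> bool" where
  "derives sg I C \<sigma> H \<longleftrightarrow> fires sg I C \<sigma> \<and> (\<exists>G. head C = Some G \<and> H = eval_atom \<sigma> G)"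

lemma holds_fires:
  "holds sg I C \<longleftrightarrow> (\<forall>\<sigma>. fires sg I C \<sigma> \<longrightarrow> (\<exists>H. head C = Some H \<and> eval_atom \<sigma> H \<in> I))"
  unfolding holds_def fires_def ..

lemma holds_definite:
  "head C \<noteq> None \<Longrightarrow> holds sg I C \<longleftrightarrow> (\<forall>\<sigma> H. derives sg I C \<sigma> H \<longrightarrow> H \<in> I)"
  unfolding holds_fires derives_def by auto

lemma fires_mono: "fires sg I C \<sigma> \<Longrightarrow> I \<subseteq> J \<Longrightarrow> fires sg J C \<sigma>"
  unfolding fires_def by auto

lemma fires_subst:
  "substitution sg \<theta> \<Longrightarrow> fires sg I (subst_clause \<theta> C) \<sigma> \<longleftrightarrow>
     valuation sg \<sigma> \<and> fires sg I C (\<lambda>x. eval \<sigma> (\<theta> x))"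
  unfolding fires_def subst_clause_def
  by (auto simp: valuation_subst eval_subst eval_atom_subst)

lemma fires_cong:
  assumes "fires sg I C \<sigma>" "valuation sg \<tau>" "\<And>x. x \<in> clause_vars C \<Longrightarrow> \<tau> x = \<sigma> x"
  shows "fires sg I C \<tau>"
proof -
  have "eval \<tau> (cstr C) = eval \<sigma> (cstr C)"
    using assms(3) by (intro eval_cong) (auto simp: clause_vars_def)
  moreover have "eval_atom \<tau> F = eval_atom \<sigma> F" if "F \<in> set (body C)" for F
    using assms(3) that by (intro eval_atom_cong) (auto simp: clause_vars_def clause_atoms_def)
  ultimately show ?thesis using assms(1,2) by (simp add: fires_def)
qed

section \<open>Models of definite clauses, supported atoms and ranks\<close>

lemma least_model_subset: "(\<And>C. C \<in> \<Pi> \<Longrightarrow> holds sg I C) \<Longrightarrow> least_model sg \<Pi> \<subseteq> I"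
  unfolding least_model_def by auto

text \<open>Bodies are positive, so an instance that fires in the intersection fires in every model,
  and its head lies in all of them.\<close>

lemma holds_least_model:
  assumes "C \<in> \<Pi>" "head C \<noteq> None"
  shows "holds sg (least_model sg \<Pi>) C"
  unfolding holds_fires
proof (intro allI impI)
  fix \<sigma> assume f: "fires sg (least_model sg \<Pi>) C \<sigma>"
  obtain H where H: "head C = Some H" using assms(2) by auto
  have "eval_atom \<sigma> H \<in> I" if "\<forall>C\<in>\<Pi>. holds sg I C" for I
  proof -
    have "fires sg I C \<sigma>" using that by (intro fires_mono[OF f] least_model_subset) auto
    with that assms(1) obtain G where "head C = Some G" "eval_atom \<sigma> G \<in> I"
      unfolding holds_fires by blast
    then show ?thesis using H by simp
  qed
  then show "\<exists>H. head C = Some H \<and> eval_atom \<sigma> H \<in> least_model sg \<Pi>"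
    using H by (auto simp: least_model_def)
qed

text \<open>If no instance derived \<open>H\<close>, removing \<open>H\<close> from \<open>M\<close>
  would leave a model, against minimality. \<open>M\<close> is kept abstract because the model of a
  later state is known only by its properties.\<close>

lemma minimal_model_supported:
  assumes "\<And>J. (\<And>C. C \<in> \<Pi> \<Longrightarrow> holds sg J C) \<Longrightarrow> M \<subseteq> J"
    and "\<And>C. C \<in> \<Pi> \<Longrightarrow> holds sg M C" and "H \<in> M"
  obtains C \<sigma> where "C \<in> \<Pi>" "derives sg M C \<sigma> H"
proof (rule ccontr)
  assume neg: "\<not> thesis"
  note derived = that
  have "holds sg (M - {H}) C" if "C \<in> \<Pi>" for C
    unfolding holds_fires
  proof (intro allI impI)
    fix \<sigma> assume "fires sg (M - {H}) C \<sigma>"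
    then have f: "fires sg M C \<sigma>" by (rule fires_mono) auto
    then obtain G where G: "head C = Some G" "eval_atom \<sigma> G \<in> M"
      using assms(2)[OF \<open>C \<in> \<Pi>\<close>] by (auto simp: holds_fires)
    moreover have "eval_atom \<sigma> G \<noteq> H"
      using neg derived[OF \<open>C \<in> \<Pi>\<close>, of \<sigma>] f G(1) by (auto simp: derives_def)
    ultimately show "\<exists>G. head C = Some G \<and> eval_atom \<sigma> G \<in> M - {H}" by auto
  qed
  then show False using assms(1)[of "M - {H}"] assms(3) by auto
qed

text \<open>Only body atoms that \<open>same\<close> relates to the head count for the rank.\<close>

inductive rank ::
  "('a, 'k) adt_sig \<Rightarrow> ('a, 'k) clause set \<Rightarrow> ('a, 'k) interp \<Rightarrow>
   ('a pred \<Rightarrow> 'a pred \<Rightarrow> bool) \<Rightarrow> 'a pred \<times> 'k val list \<Rightarrow> nat \<Rightarrow> bool"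
  for sg \<Pi> M same where
  rankI: "\<lbrakk> C \<in> \<Pi>; derives sg M C \<sigma> H;
    \<And>F. F \<in> set (body C) \<Longrightarrow> same (fst F) (fst H) \<Longrightarrow>
       \<exists>m<n. rank sg \<Pi> M same (eval_atom \<sigma> F) m \<rbrakk> \<Longrightarrow> rank sg \<Pi> M same H n"

text \<open>The atoms of the least model that have a rank form a model again, so by minimality they
  are all of it. This works for any \<open>same\<close>, as ignoring body atoms only weakens what a
  rank demands.\<close>

lemma least_model_ranked:
  assumes "\<And>C. C \<in> \<Pi> \<Longrightarrow> head C \<noteq> None" "H \<in> least_model sg \<Pi>"
  shows "\<exists>n. rank sg \<Pi> (least_model sg \<Pi>) same H n"
proof -
  let ?M = "least_model sg \<Pi>"
  let ?R = "{H \<in> ?M. \<exists>n. rank sg \<Pi> ?M same H n}"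
  have "holds sg ?R C" if C: "C \<in> \<Pi>" for C
    unfolding holds_definite[OF assms(1)[OF C]]
  proof (intro allI impI)
    fix \<sigma> H assume d: "derives sg ?R C \<sigma> H"
    then have dM: "derives sg ?M C \<sigma> H"
      unfolding derives_def by (auto intro: fires_mono)
    then have "H \<in> ?M"
      using holds_least_model[OF C assms(1)[OF C]] holds_definite[OF assms(1)[OF C]] by blast
    moreover have "\<forall>F\<in>set (body C). \<exists>n. rank sg \<Pi> ?M same (eval_atom \<sigma> F) n"
      using d by (auto simp: derives_def fires_def)
    then obtain r where r: "\<And>F. F \<in> set (body C) \<Longrightarrow> rank sg \<Pi> ?M same (eval_atom \<sigma> F) (r F)"
      by metis
    \<comment> \<open>\<open>insert 0\<close> covers facts, whose set of body ranks is
      empty.\<close>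
    have "rank sg \<Pi> ?M same H (Suc (Max (insert 0 (r ` set (body C)))))"
    proof (rule rankI[OF C dM])
      fix F assume F: "F \<in> set (body C)"
      then have "r F < Suc (Max (insert 0 (r ` set (body C))))"
        by (simp add: less_Suc_eq_le)
      then show "\<exists>m<Suc (Max (insert 0 (r ` set (body C)))). rank sg \<Pi> ?M same (eval_atom \<sigma> F) m"
        using r[OF F] by blast
    qed
    ultimately show "H \<in> ?R" by auto
  qed
  then show ?thesis using assms(2) least_model_subset[of \<Pi> sg ?R] by auto
qed

text \<open>Taking the least rank turns the relation into a weight function. The instance that
  attains the minimum is decreasing in all counted body atoms at once.\<close>

lemma rank_Least:
  assumes "rank sg \<Pi> M same H n"
  obtains C \<sigma> where "C \<in> \<Pi>" "derives sg M C \<sigma> H"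
    "\<And>F. F \<in> set (body C) \<Longrightarrow> same (fst F) (fst H) \<Longrightarrow>
       (LEAST m. rank sg \<Pi> M same (eval_atom \<sigma> F) m) < (LEAST m. rank sg \<Pi> M same H m)"
proof -
  have "rank sg \<Pi> M same H (LEAST m. rank sg \<Pi> M same H m)"
    using assms by (rule LeastI)
  then show ?thesis
  proof cases
    case (rankI C \<sigma>)
    show ?thesis
    proof (rule that[OF rankI(1,2)])
      fix F assume "F \<in> set (body C)" "same (fst F) (fst H)"
      then show "(LEAST m. rank sg \<Pi> M same (eval_atom \<sigma> F) m) < (LEAST m. rank sg \<Pi> M same H m)"
        using rankI(3) by (meson Least_le le_less_trans)
    qed
  qed
qed


section \<open>One-step unfolding\<close>

lemma renaming_substitution: "renaming \<rho> \<Longrightarrow> substitution sg (\<lambda>x. Var (\<rho> x))"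
  by (simp add: renaming_def substitution_def)

lemma clause_atoms_subst: "clause_atoms (subst_clause \<theta> C) = subst_atom \<theta> ` clause_atoms C"
  by (simp add: clause_atoms_def subst_clause_def option.set_map image_Un)

lemma wf_clause_subst: "substitution sg \<theta> \<Longrightarrow> wf_clause sg C \<Longrightarrow> wf_clause sg (subst_clause \<theta> C)"
  by (simp add: wf_clause_def clause_atoms_subst wf_atom_subst)
    (simp add: subst_clause_def trm_sort_subst)

lemma wf_clause_rename: "renaming \<rho> \<Longrightarrow> wf_clause sg C \<Longrightarrow> wf_clause sg (rename_clause \<rho> C)"
  unfolding rename_clause_def by (intro wf_clause_subst renaming_substitution)

lemma holds_subst: "substitution sg \<theta> \<Longrightarrow> holds sg I C \<Longrightarrow> holds sg I (subst_clause \<theta> C)"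
  unfolding holds_fires fires_subst
  by (fastforce simp: subst_clause_def eval_atom_subst)

lemma holds_rename: "renaming \<rho> \<Longrightarrow> holds sg I C \<Longrightarrow> holds sg I (rename_clause \<rho> C)"
  unfolding rename_clause_def by (intro holds_subst renaming_substitution)

lemma head_rename: "head C = Some H \<Longrightarrow>
    head (rename_clause \<rho> C) = Some (subst_atom (\<lambda>x. Var (\<rho> x)) H)"
  by (simp add: rename_clause_def subst_clause_def)

lemma body_rename: "body (rename_clause \<rho> C) = map (subst_atom (\<lambda>x. Var (\<rho> x))) (body C)"
  by (simp add: rename_clause_def subst_clause_def)

lemma derives_rename:
  assumes "renaming \<rho>" "derives sg I C \<tau> H"
  obtains \<tau>' where "derives sg I (rename_clause \<rho> C) \<tau>' H"
    "eval_atom \<tau>' ` set (body (rename_clause \<rho> C)) = eval_atom \<tau> ` set (body C)"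
proof
  let ?\<tau>' = "\<lambda>x. \<tau> (inv \<rho> x)"
  have \<rho>: "bij \<rho>" "\<And>x. snd (\<rho> x) = snd x" using assms(1) by (auto simp: renaming_def)
  have inv: "inv \<rho> (\<rho> x) = x" for x using \<rho>(1) by (simp add: bij_is_inj)
  have "\<rho> (inv \<rho> x) = x" for x using \<rho>(1) by (simp add: bij_is_surj surj_f_inv_f)
  then have "snd (inv \<rho> x) = snd x" for x using \<rho>(2) by metis
  then have val: "valuation sg ?\<tau>'" using assms(2)
    by (simp add: derives_def fires_def valuation_def)
  have "fires sg I (rename_clause \<rho> C) ?\<tau>'"
    unfolding rename_clause_def fires_subst[OF renaming_substitution[OF assms(1)]]
    using assms(2) val by (simp add: inv derives_def)
  then show "derives sg I (rename_clause \<rho> C) ?\<tau>' H"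
    using assms(2) head_rename[of C _ \<rho>] by (auto simp: derives_def eval_atom_subst inv)
  show "eval_atom ?\<tau>' ` set (body (rename_clause \<rho> C)) = eval_atom \<tau> ` set (body C)"
    unfolding body_rename set_map image_image eval_atom_subst by (simp add: inv)
qed

definition resolvent ::
  "('a, 'k) clause \<Rightarrow> ('a, 'k) atom list \<Rightarrow> ('a, 'k) atom list \<Rightarrow> ('a, 'k) clause \<Rightarrow>
   ('a, 'k) clause" where
  "resolvent E L R C = Clause (head E) (AndC (cstr E) (cstr C)) (L @ body C @ R)"

lemma wf_clause_resolvent:
  assumes "wf_clause sg E" "wf_clause sg C" "set L \<union> set R \<subseteq> set (body E)"
  shows "wf_clause sg (resolvent E L R C)"
  using assms by (auto simp: wf_clause_def resolvent_def clause_atoms_def)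

text \<open>The unifier makes the unfolded atom and the head of the resolved clause one atom, so a
  firing resolvent fires first that clause and then \<open>E\<close>. The form of \<open>E'\<close>
  is exposed as well, since the level conditions are read off from it.\<close>

lemma unf_sound:
  assumes "unf sg \<Pi> E L A R U" "\<And>C. C \<in> \<Pi> \<Longrightarrow> wf_clause sg C \<and> holds sg I C"
    and "wf_clause sg E" "holds sg I E" "E' \<in> U" "\<And>C. C \<in> \<Pi> \<Longrightarrow> head C \<noteq> None"
  obtains C \<theta> \<rho> where "C \<in> \<Pi>" "renaming \<rho>" "substitution sg \<theta>"
    "E' = subst_clause \<theta> (resolvent E L R (rename_clause \<rho> C))" "fst (the (head C)) = fst A"
    "wf_clause sg E'" "holds sg I E'"
proof -
  obtain C \<rho> \<theta> where C: "C \<in> \<Pi>" "renaming \<rho>" "mgu sg \<theta> A (the (head (rename_clause \<rho> C)))"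
    and E': "E' = subst_clause \<theta> (resolvent E L R (rename_clause \<rho> C))"
    and E: "body E = L @ A # R"
    using assms(1,5) unfolding unf_def resolvent_def by blast
  define C' where "C' = rename_clause \<rho> C"
  have \<theta>: "substitution sg \<theta>" using C(3) by (simp add: mgu_def unifier_def)
  obtain H where H: "head C = Some H" using assms(6)[OF C(1)] by blast
  let ?H = "subst_atom (\<lambda>x. Var (\<rho> x)) H"
  have H': "head C' = Some ?H" unfolding C'_def by (rule head_rename[OF H])
  have uni: "subst_atom \<theta> A = subst_atom \<theta> ?H"
    using C(3) H' by (simp add: mgu_def unifier_def C'_def)
  have wfC': "wf_clause sg C'" unfolding C'_def using assms(2) C by (intro wf_clause_rename) auto
  have hC': "holds sg I C'" unfolding C'_def using assms(2) C by (intro holds_rename) auto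
  have wfE': "wf_clause sg E'"
    unfolding E' using \<theta> wfC' assms(3) E
    by (intro wf_clause_subst wf_clause_resolvent) (auto simp: C'_def)
  have "holds sg I (subst_clause \<theta> (resolvent E L R C'))"
    unfolding holds_fires
  proof (intro allI impI)
    fix \<sigma> assume "fires sg I (subst_clause \<theta> (resolvent E L R C')) \<sigma>"
    then have f: "fires sg I (resolvent E L R C') (\<lambda>x. eval \<sigma> (\<theta> x))" (is "fires _ _ _ ?\<sigma>")
      unfolding fires_subst[OF \<theta>] by auto
    have c: "eval ?\<sigma> (cstr E) = BoolV True" "eval ?\<sigma> (cstr C') = BoolV True"
      using f eval_AndC[of sg ?\<sigma> "cstr E" "cstr C'"] assms(3) wfC'
      by (auto simp: fires_def resolvent_def wf_clause_def)
    have "fires sg I C' ?\<sigma>" using f c by (auto simp: fires_def resolvent_def)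
    then have "eval_atom ?\<sigma> ?H \<in> I" using hC' H' by (auto simp: holds_fires)
    moreover have "eval_atom ?\<sigma> A = eval_atom ?\<sigma> ?H"
      using uni by (simp flip: eval_atom_subst)
    ultimately have "fires sg I E ?\<sigma>"
      using f c E by (auto simp: fires_def resolvent_def)
    then obtain G where "head E = Some G" "eval_atom ?\<sigma> G \<in> I"
      using assms(4) by (auto simp: holds_fires)
    then show "\<exists>G. head (subst_clause \<theta> (resolvent E L R C')) = Some G \<and> eval_atom \<sigma> G \<in> I"
      by (simp add: subst_clause_def resolvent_def eval_atom_subst)
  qed
  moreover have "fst (the (head C)) = fst A"
    using arg_cong[OF uni, of fst] H by simp
  ultimately show ?thesis
    using that C \<theta> E' wfE' by (simp add: C'_def)
qed

text \<open>A unifier that evaluates to the given valuation lets every most general unifier represent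
  that valuation.\<close>

definition unifier_at ::
  "('a, 'k) adt_sig \<Rightarrow> ('a var \<Rightarrow> 'k val) \<Rightarrow> ('a, 'k) atom \<Rightarrow> ('a, 'k) atom \<Rightarrow> bool" where
  "unifier_at sg \<mu> F G \<longleftrightarrow> (\<exists>\<tau>. unifier sg \<tau> F G \<and> (\<forall>x. eval \<mu> (\<tau> x) = \<mu> x))"

text \<open>\<open>unf\<close> promises a most general unifier only where a unifier exists, hence
  the premise \<open>unifiable\<close>. A unifier that reproduces the common valuation factors
  through the most general one, and evaluating the second factor gives the valuation of the
  resolvent.\<close>

lemma unf_complete:
  assumes unf: "unf sg \<Pi> E L A R U" and C: "C \<in> \<Pi>"
    and wf: "wf_clause sg C" "wf_clause sg E"
    and \<sigma>: "fires sg I E \<sigma>" and \<tau>: "derives sg I C \<tau> (eval_atom \<sigma> A)"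
    and unifiable: "\<And>\<rho> \<mu> H. \<lbrakk> renaming \<rho>; valuation sg \<mu>; head (rename_clause \<rho> C) = Some H;
      clause_vars (rename_clause \<rho> C) \<inter> clause_vars E = {};
      eval_atom \<mu> A = eval_atom \<mu> H \<rbrakk> \<Longrightarrow> unifier_at sg \<mu> A H"
  obtains E' \<delta> where "E' \<in> U" "fires sg I E' \<delta>"
    "map_option (eval_atom \<delta>) (head E') = map_option (eval_atom \<sigma>) (head E)"
    "eval_atom \<delta> ` set (body E') =
       eval_atom \<sigma> ` (set L \<union> set R) \<union> eval_atom \<tau> ` set (body C)"
proof -
  have E: "body E = L @ A # R" using unf unfolding unf_def by (rule conjunct1)
  obtain \<rho>f \<theta>f where all: "\<forall>C\<in>\<Pi>. renaming (\<rho>f C) \<and>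
        clause_vars (rename_clause (\<rho>f C) C) \<inter> clause_vars E = {} \<and>
        ((\<exists>\<tau>. unifier sg \<tau> A (the (head (rename_clause (\<rho>f C) C)))) \<longrightarrow>
          mgu sg (\<theta>f C) A (the (head (rename_clause (\<rho>f C) C))))"
    and U: "U = {subst_clause (\<theta>f C) (Clause (head E) (AndC (cstr E) (cstr C')) (L @ body C' @ R)) | C C'.
               C \<in> \<Pi> \<and> C' = rename_clause (\<rho>f C) C \<and> mgu sg (\<theta>f C) A (the (head C')) \<and>
               sat_constraint sg (subst (\<theta>f C) (AndC (cstr E) (cstr C')))}"
    proof -
    from conjunct2[OF unf[unfolded unf_def]] show thesis
      by (elim exE conjE) (rule that)
  qed
  note ren = bspec[OF all C, THEN conjunct1] bspec[OF all C, THEN conjunct2, THEN conjunct1]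
  note mgu = bspec[OF all C, THEN conjunct2, THEN conjunct2]
  define C' where "C' = rename_clause (\<rho>f C) C"
  define \<theta> where "\<theta> = \<theta>f C"
  obtain \<tau>' where \<tau>': "derives sg I C' \<tau>' (eval_atom \<sigma> A)"
    "eval_atom \<tau>' ` set (body C') = eval_atom \<tau> ` set (body C)"
    unfolding C'_def using derives_rename[OF ren(1) \<tau>] by blast
  obtain H where H: "head C' = Some H" "eval_atom \<sigma> A = eval_atom \<tau>' H"
    using \<tau>'(1) by (auto simp: derives_def)
  \<comment> \<open>Renaming apart lets a single valuation act as \<open>\<tau>'\<close> on the
    clause and as \<open>\<sigma>\<close> on \<open>E\<close>.\<close>
  define \<mu> where "\<mu> x = (if x \<in> clause_vars C' then \<tau>' x else \<sigma> x)" for x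
  have val: "valuation sg \<mu>"
    using \<sigma> \<tau>'(1) by (simp add: \<mu>_def valuation_def fires_def derives_def)
  have \<mu>C: "\<mu> x = \<tau>' x" if "x \<in> clause_vars C'" for x using that by (simp add: \<mu>_def)
  have \<mu>E: "\<mu> x = \<sigma> x" if "x \<in> clause_vars E" for x
    using that ren(2) by (auto simp: \<mu>_def C'_def)
  have atC: "eval_atom \<mu> F = eval_atom \<tau>' F" if "F \<in> clause_atoms C'" for F
    by (rule eval_atom_cong, rule \<mu>C) (use that in \<open>auto simp: clause_vars_def\<close>)
  have atE: "eval_atom \<mu> F = eval_atom \<sigma> F" if "F \<in> clause_atoms E" for F
    by (rule eval_atom_cong, rule \<mu>E) (use that in \<open>auto simp: clause_vars_def\<close>)
  have fC: "fires sg I C' \<mu>"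
    using \<tau>'(1) by (intro fires_cong[OF _ val \<mu>C]) (auto simp: derives_def)
  have fE: "fires sg I E \<mu>"
    by (rule fires_cong[OF \<sigma> val \<mu>E])
  have "eval_atom \<mu> A = eval_atom \<mu> H"
    using H atC[of H] atE[of A] E by (simp add: clause_atoms_def)
  then have "unifier_at sg \<mu> A H"
    using unifiable[OF ren(1) val _ ren(2)] H(1) by (simp add: C'_def)
  then obtain \<tau>0 where \<tau>0: "unifier sg \<tau>0 A H" "\<And>x. eval \<mu> (\<tau>0 x) = \<mu> x"
    by (auto simp: unifier_at_def)
  have "the (head (rename_clause (\<rho>f C) C)) = H" using H(1) by (simp add: C'_def)
  then have m: "mgu sg \<theta> A H" using mgu \<tau>0(1) unfolding \<theta>_def by blast
  then obtain \<delta>0 where \<delta>0: "substitution sg \<delta>0" "\<And>x. \<tau>0 x = subst \<delta>0 (\<theta> x)"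
    using \<tau>0(1) unfolding mgu_def by blast
  have \<theta>: "substitution sg \<theta>" using m by (simp add: mgu_def unifier_def)
  \<comment> \<open>\<open>\<tau>0\<close> is \<open>\<theta>\<close> followed by
    \<open>\<delta>0\<close> and evaluates to \<open>\<mu>\<close>, so evaluating
    \<open>\<theta>\<close> under \<open>\<delta>\<close> gives back \<open>\<mu>\<close>. The same
    \<open>\<delta>\<close> witnesses the satisfiability test in \<open>unf\<close>.\<close>
  define \<delta> where "\<delta> = (\<lambda>x. eval \<mu> (\<delta>0 x))"
  have val\<delta>: "valuation sg \<delta>" unfolding \<delta>_def by (rule valuation_subst[OF val \<delta>0(1)])
  have \<delta>: "(\<lambda>x. eval \<delta> (\<theta> x)) = \<mu>"
    using \<tau>0(2) unfolding \<delta>0(2) eval_subst \<delta>_def by blast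
  have wfC': "wf_clause sg C'" unfolding C'_def by (rule wf_clause_rename[OF ren(1) wf(1)])
  let ?E' = "subst_clause \<theta> (resolvent E L R C')"
  have c: "eval \<mu> (AndC (cstr E) (cstr C')) = BoolV True"
    using eval_AndC[OF val, of "cstr E" "cstr C'"] wf(2) wfC' fE fC
    by (simp add: wf_clause_def fires_def)
  have "sat_constraint sg (subst \<theta> (AndC (cstr E) (cstr C')))"
    unfolding sat_constraint_def eval_subst using val\<delta> c \<delta> by (intro exI[of _ \<delta>]) simp
  then have "?E' \<in> U"
    unfolding U resolvent_def using C m H(1)
    by (intro CollectI exI[of _ C] exI[of _ C']) (simp add: C'_def \<theta>_def)
  moreover have "fires sg I ?E' \<delta>"
    unfolding fires_subst[OF \<theta>] \<delta> using val\<delta> val c fE fC E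
    by (auto simp: fires_def resolvent_def)
  moreover have "map_option (eval_atom \<delta>) (head ?E') = map_option (eval_atom \<sigma>) (head E)"
    using atE by (cases "head E")
      (auto simp: subst_clause_def resolvent_def eval_atom_subst \<delta> clause_atoms_def)
  moreover have "eval_atom \<delta> ` set (body ?E') =
      eval_atom \<sigma> ` (set L \<union> set R) \<union> eval_atom \<tau> ` set (body C)"
  proof -
    have "eval_atom \<delta> ` set (body ?E') = eval_atom \<mu> ` (set L \<union> set (body C') \<union> set R)"
      by (simp add: subst_clause_def resolvent_def image_image image_Un eval_atom_subst \<delta> Un_assoc)
    also have "\<dots> = eval_atom \<mu> ` (set L \<union> set R) \<union> eval_atom \<mu> ` set (body C')"
      by auto
    also have "eval_atom \<mu> ` (set L \<union> set R) = eval_atom \<sigma> ` (set L \<union> set R)"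
      using atE E by (intro image_cong) (auto simp: clause_atoms_def)
    also have "eval_atom \<mu> ` set (body C') = eval_atom \<tau>' ` set (body C')"
      using atC by (intro image_cong) (auto simp: clause_atoms_def)
    finally show ?thesis using \<tau>'(2) by simp
  qed
  ultimately show ?thesis by (rule that)
qed

text \<open>Binding a variable to a term with the value of that variable changes no value under
  \<open>\<mu>\<close>; this ties the syntactic match to the given ground instance.\<close>

lemma matching_substitution:
  assumes "distinct xs" "map (trm_sort sg) ts = map (\<lambda>x. Some (snd x)) xs"
    and "map (eval \<mu>) ts = map \<mu> xs"
  obtains \<tau> where "substitution sg \<tau>" "map \<tau> xs = ts" "\<And>x. eval \<mu> (\<tau> x) = \<mu> x"
    "\<And>x. x \<notin> set xs \<Longrightarrow> \<tau> x = Var x"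
proof -
  have "length xs = length ts" using assms(2) by (metis length_map)
  then obtain \<tau> where \<tau>: "map \<tau> xs = ts" "\<And>x. x \<notin> set xs \<Longrightarrow> \<tau> x = Var x"
    using override_map[OF assms(1)] by metis
  have "trm_sort sg (\<tau> x) = Some (snd x) \<and> eval \<mu> (\<tau> x) = \<mu> x" for x
    using \<tau> assms(2,3) by (cases "x \<in> set xs") auto
  then show ?thesis using that \<tau> unfolding substitution_def by blast
qed

lemma map_subst_disjoint:
  assumes "\<And>x. x \<notin> X \<Longrightarrow> \<tau> x = Var x" "\<Union> (trm_vars ` set ts) \<inter> X = {}"
  shows "map (subst \<tau>) ts = ts"
proof (rule map_idI)
  fix t assume "t \<in> set ts"
  then have "subst \<tau> t = subst Var t" using assms by (intro subst_cong) blast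
  then show "subst \<tau> t = t" by simp
qed

text \<open>The program atom of a definition has distinct variables as arguments, so these are bound
  to the arguments of the head, which stays fixed because it shares no variable with them.\<close>

lemma unifier_at_var_atom:
  assumes "distinct zs" "snd p = map snd zs" "wf_atom sg H"
    and "set zs \<inter> atom_vars H = {}" "eval_atom \<mu> (p, map Var zs) = eval_atom \<mu> H"
  shows "unifier_at sg \<mu> (p, map Var zs) H"
proof -
  obtain ts where H: "H = (p, ts)" using assms(5) by (cases H) (auto simp: eval_atom_def)
  have "map (eval \<mu>) ts = map \<mu> zs"
    using assms(5) by (simp add: eval_atom_def H comp_def)
  moreover have "map (trm_sort sg) ts = map (\<lambda>x. Some (snd x)) zs"
    using assms(2,3) by (simp add: wf_atom_def H)
  ultimately obtain \<tau> where \<tau>: "substitution sg \<tau>" "map \<tau> zs = ts" "\<And>x. eval \<mu> (\<tau> x) = \<mu> x"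
    "\<And>x. x \<notin> set zs \<Longrightarrow> \<tau> x = Var x"
    using matching_substitution[OF assms(1)] by metis
  have "map (subst \<tau>) ts = ts"
    using \<tau>(4) assms(4) by (intro map_subst_disjoint[of "set zs"]) (auto simp: H atom_vars_def)
  then show ?thesis
    unfolding unifier_at_def unifier_def using \<tau>
    by (intro exI[of _ \<tau>]) (auto simp: H subst_atom_def)
qed

text \<open>The form common to the heads of the basis clause (with \<open>Zs\<close> empty) and of
  the step clause of a catamorphism: a linear pattern with a single constructor.\<close>

definition cata_head :: "'a pred \<Rightarrow> ('a, 'k) trm list \<Rightarrow> bool" where
  "cata_head q ts \<longleftrightarrow> (\<exists>X k Zs Y. ts = map Var X @ [Fn (Con k) (map Var Zs)] @ map Var Y \<and>
     distinct (X @ Zs @ Y) \<and> length X = adt_pos q)"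

text \<open>Here the roles are reversed: the variables of the head are bound and \<open>F\<close>
  stays fixed. The ADT argument of \<open>F\<close> already shows the constructor of the head,
  because it is not a variable and its value is built with that constructor.\<close>

lemma unifier_at_cata:
  assumes "cata_head q hs" "wf_atom sg (q, hs)" "wf_atom sg F" "adt_arg F \<notin> range Var"
    and "atom_vars F \<inter> atom_vars (q, hs) = {}" "eval_atom \<mu> F = eval_atom \<mu> (q, hs)"
  shows "unifier_at sg \<mu> F (q, hs)"
proof -
  obtain X k Zs Y where hs: "hs = map Var X @ [Fn (Con k) (map Var Zs)] @ map Var Y"
    and dist: "distinct (X @ Zs @ Y)" and len: "length X = adt_pos q"
    using assms(1) unfolding cata_head_def by blast
  obtain ts where F: "F = (q, ts)" using assms(6) by (cases F) (auto simp: eval_atom_def)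
  have ev: "map (eval \<mu>) ts = map (eval \<mu>) hs" using assms(6) by (simp add: F eval_atom_def)
  have "length ts = length hs" using ev by (metis length_map)
  then have lt: "adt_pos q < length ts" using len hs by simp
  define t1 t t2 where "t1 = take (adt_pos q) ts" and "t = ts ! adt_pos q"
    and "t2 = drop (Suc (adt_pos q)) ts"
  have ts: "ts = t1 @ t # t2" "length t1 = length X"
    using lt len unfolding t1_def t_def t2_def by (simp_all add: id_take_nth_drop)
  have srt: "map (trm_sort sg) ts = map (trm_sort sg) hs"
    using assms(2,3) by (simp add: wf_atom_def F)
  have srt1: "map (trm_sort sg) t1 = map (\<lambda>x. Some (snd x)) X"
    and srtt: "trm_sort sg t = trm_sort sg (Fn (Con k) (map Var Zs))"
    and srt2: "map (trm_sort sg) t2 = map (\<lambda>x. Some (snd x)) Y"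
    using srt ts by (auto simp: hs comp_def)
  have ev1: "map (eval \<mu>) t1 = map \<mu> X" and evt: "eval \<mu> t = ConV k (map \<mu> Zs)"
    and ev2: "map (eval \<mu>) t2 = map \<mu> Y"
    using ev ts by (auto simp: hs comp_def)
  have "map (trm_sort sg) hs = map Some (snd q)" using assms(2) by (simp add: wf_atom_def)
  then have "trm_sort sg (Fn (Con k) (map Var Zs)) \<noteq> None" unfolding hs
    by (metis (no_types, lifting) append_Cons append_eq_map_conv list.simps(9) map_eq_Cons_conv option.distinct(1))
  then have kz: "trm_sort sg (Fn (Con k) (map Var Zs)) = Some (Adt (con_res sg k))"
    "map (\<lambda>x. Some (snd x)) Zs = map Some (con_args sg k)"
    by (auto simp: comp_def split: if_splits)
  have "t \<notin> range Var" using assms(4) by (simp add: adt_arg_def F t_def)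
  then obtain f us where t0: "t = Fn f us" by (cases t) auto
  have "fsym_res sg f = Adt (con_res sg k)" using srtt kz t0 by (auto split: if_splits)
  \<comment> \<open>Constructors are the only symbols with an ADT result, as if-then-else exists at
    basic sorts only.\<close>
  then have "\<exists>k'. f = Con k'" by (cases f) auto
  then obtain k' where "f = Con k'" by blast
  then have t: "t = Fn (Con k) us" using evt t0 by simp
  have evu: "map (eval \<mu>) us = map \<mu> Zs" using evt t by simp
  have srtu: "map (trm_sort sg) us = map (\<lambda>x. Some (snd x)) Zs"
    using srtt kz t by (auto split: if_splits)
  obtain \<tau> where \<tau>: "substitution sg \<tau>" "map \<tau> (X @ Zs @ Y) = t1 @ us @ t2"
    "\<And>x. eval \<mu> (\<tau> x) = \<mu> x" "\<And>x. x \<notin> set (X @ Zs @ Y) \<Longrightarrow> \<tau> x = Var x"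
    using matching_substitution[OF dist, of sg "t1 @ us @ t2" \<mu>]
      srt1 srtu srt2 ev1 evu ev2 by auto
  have lu: "length us = length Zs" using evu by (metis length_map)
  then have \<tau>s: "map \<tau> X = t1" "map \<tau> Zs = us" "map \<tau> Y = t2"
    using \<tau>(2) ts(2) by (auto simp: append_eq_append_conv)
  have "map (subst \<tau>) ts = ts"
  proof (rule map_subst_disjoint[OF \<tau>(4)])
    show "\<Union> (trm_vars ` set ts) \<inter> set (X @ Zs @ Y) = {}"
      using assms(5) by (auto simp: atom_vars_def F hs)
  qed
  then show ?thesis
    unfolding unifier_at_def unifier_def using \<tau>(1,3) \<tau>s
    by (intro exI[of _ \<tau>]) (auto simp: F subst_atom_def hs ts t comp_def)
qed


section \<open>The invariant of a transformation sequence\<close>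

text \<open>\<open>wf_catom\<close> without distinctness of the variables, which the instantiation
  of a specification in catamorphism addition may destroy.\<close>

fun sorted_catom :: "'a pred set \<Rightarrow> 'a catom \<Rightarrow> bool" where
  "sorted_catom K (q, X, T, Y) \<longleftrightarrow> q \<in> K \<and> snd q = map snd (X @ T # Y) \<and>
     (\<forall>x\<in>set (X @ Y). basic (snd x)) \<and> \<not> basic (snd T)"

lemma wf_catom_sorted: "wf_catom K F \<Longrightarrow> sorted_catom K F"
  by (cases F) auto

lemma cata_pred_sorted: "sorted_catom K F \<Longrightarrow> fst (cata_atom F) \<in> K"
  by (cases F) auto

lemma wf_cata_atom: "sorted_catom K F \<Longrightarrow> wf_atom sg (cata_atom F)"
  by (cases F) (simp add: wf_atom_def)

lemma atom_vars_cata_atom: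
  "atom_vars (cata_atom F) = insert (cata_adt F) (set (cata_ins F) \<union> set (cata_outs F))"
  by (cases F) (auto simp: atom_vars_def)

lemma adt_pos_sorted: "sorted_catom K (q, X, T, Y) \<Longrightarrow> adt_pos q = length X"
  by (simp add: adt_pos_def takeWhile_append takeWhile_map comp_def)

text \<open>Levels order the predicates: those in \<open>L\<close> are below the other program predicates, and \<open>H\<close>
  only has to be heavier than the body atoms of its own level.\<close>

definition lighter ::
  "'a pred set \<Rightarrow> 'a pred set \<Rightarrow> ('a pred \<times> 'k val list \<Rightarrow> nat) \<Rightarrow> nat \<Rightarrow>
   'a pred \<times> 'k val list \<Rightarrow> 'a pred \<times> 'k val list \<Rightarrow> bool" where
  "lighter KA L w d H F \<longleftrightarrow>
     (fst F \<notin> KA \<and> (fst F \<in> L \<longleftrightarrow> fst H \<in> L) \<longrightarrow> w F + d < w H)"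

text \<open>\<open>d\<close> is the slack: the invariant asks for 1 at the clauses in
  \<open>Fld\<close> and for 0 at all others.\<close>

definition backed ::
  "('a, 'k) adt_sig \<Rightarrow> 'a pred set \<Rightarrow> ('a, 'k) interp \<Rightarrow> 'a pred set \<Rightarrow>
   ('a pred \<times> 'k val list \<Rightarrow> nat) \<Rightarrow> nat \<Rightarrow> ('a, 'k) clause \<Rightarrow> 'a pred \<times> 'k val list \<Rightarrow> bool" where
  "backed sg KA M L w d C H \<longleftrightarrow>
     (\<exists>\<sigma>. derives sg M C \<sigma> H \<and> (\<forall>F\<in>set (body C). lighter KA L w d H (eval_atom \<sigma> F)))"

lemma backed_weaken: "backed sg KA M L w d C H \<Longrightarrow> d' \<le> d \<Longrightarrow> backed sg KA M L w d' C H"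
  unfolding backed_def lighter_def by fastforce

text \<open>Head and program atom share a level, so that comparing their weights is never vacuous.
  In the lower level there are no catamorphism atoms, as its predicates have no ADT arguments for
  them to consume.\<close>

definition is_definition :: "'a pred set \<Rightarrow> 'a pred set \<Rightarrow> 'a pred set \<Rightarrow> ('a, 'k) clause \<Rightarrow> bool" where
  "is_definition K Ax L D \<longleftrightarrow>
     (\<exists>newp Xs cs p zs. D = Clause (Some (newp, map Var Xs)) TrueC (map cata_atom cs @ [(p, map Var zs)]) \<and>
        newp \<notin> K \<union> Ax \<and> snd newp = map snd Xs \<and> p \<notin> K \<union> Ax \<and> distinct zs \<and> snd p = map snd zs \<and>
        (\<forall>F\<in>set cs. wf_catom K F) \<and> (newp \<in> L \<longleftrightarrow> p \<in> L) \<and> (p \<in> L \<longrightarrow> cs = []))"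

locale initial_clauses =
  fixes sg :: "('a, 'k) adt_sig" and K Ax :: "'a pred set"
    and P Q :: "('a, 'k) clause set" and Spec :: "'a cata_spec set"
  assumes initial: "initial_set sg K Ax P Q"
    and specs: "\<And>sp. sp \<in> Spec \<Longrightarrow> wf_spec K Ax sp"
begin

abbreviation KA :: "'a pred set" where "KA \<equiv> K \<union> Ax"

lemma catamorphismE:
  assumes "q \<in> K"
  obtains \<alpha> a \<gamma> where "snd q = \<alpha> @ Adt a # \<gamma>" "\<forall>s\<in>set (\<alpha> @ \<gamma>). basic s"
    "total_function sg P (Suc (length \<alpha>)) q" "adt_pos q = length \<alpha>"
    "\<And>C ts. C \<in> P \<Longrightarrow> head C = Some (q, ts) \<Longrightarrow> cata_head q ts"
proof -
  have "catamorphism sg K Ax P q" using initial assms by (simp add: initial_set_def)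
  then show ?thesis
  proof cases
    case (1 \<alpha> a \<gamma> e k C0 C1 fs)
    have pos: "adt_pos q = length \<alpha>"
      using 1(2,3) by (simp add: adt_pos_def takeWhile_append basic_def)
    have "cata_head q ts" if C: "C \<in> P" "head C = Some (q, ts)" for C ts
    proof -
      have "C \<in> {C0, C1}" using 1(6) C by blast
      then show ?thesis
      proof (elim insertE emptyE)
        assume "C = C0"
        then obtain X Y where "length X = length \<alpha>" "distinct (X @ Y)"
          "ts = map Var X @ [Fn (Con e) []] @ map Var Y"
          using 1(7) C(2) by (auto simp: cata_basis_clause_def)
        then show ?thesis unfolding cata_head_def pos
          by (intro exI[of _ X] exI[of _ e] exI[of _ "[]"] exI[of _ Y]) simp
      next
        assume "C = C1"
        then obtain X Zs Y others selfs where "length X = length \<alpha>"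
          "distinct (X @ Zs @ Y @ concat (map cata_outs (others @ selfs)))"
          "ts = map Var X @ [Fn (Con k) (map Var Zs)] @ map Var Y"
          using 1(8) C(2) unfolding cata_step_clause_def by auto
        then show ?thesis unfolding cata_head_def pos
          by (intro exI[of _ X] exI[of _ k] exI[of _ Zs] exI[of _ Y]) auto
      qed
    qed
    then show ?thesis using that 1(2,3,5) pos by simp
  qed
qed

lemma cata_total_function: "q \<in> K \<Longrightarrow> total_function sg P (Suc (adt_pos q)) q"
  by (erule catamorphismE) simp

lemma cata_output_sorts: "q \<in> K \<Longrightarrow> s \<in> set (drop (Suc (adt_pos q)) (snd q)) \<Longrightarrow> basic s"
  by (erule catamorphismE) simp

lemma initial_cata_head: "q \<in> K \<Longrightarrow> C \<in> P \<Longrightarrow> head C = Some (q, ts) \<Longrightarrow> cata_head q ts"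
  by (erule catamorphismE) blast

end

text \<open>\<open>M\<close> is the least model of the definite clauses of \<open>S\<close>, with weights \<open>w\<close>.  Erasure makes the
  clauses of the catamorphisms depend on new predicates \<open>p_woADTs\<close>, whose weights are unrelated to
  those of the other program atoms.  The set \<open>L\<close> collects these predicates and the ones defined
  from them; all their arguments are of basic sort, so that no rule mixes them with catamorphism
  atoms.  \<open>B\<close> is a set of clauses, never changed except by erasure, that determines the
  catamorphisms.\<close>

locale state = initial_clauses sg K Ax P Q Spec
  for sg :: "('a, 'k) adt_sig" and K Ax :: "'a pred set"
    and P Q :: "('a, 'k) clause set" and Spec :: "'a cata_spec set" +
  fixes used :: "'a pred set" and S Defs Fld :: "('a, 'k) clause set"
    and M :: "('a, 'k) interp" and L :: "'a pred set"
    and w :: "'a pred \<times> 'k val list \<Rightarrow> nat" and B :: "('a, 'k) clause set"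
  assumes used: "K \<union> Ax \<subseteq> used" "L \<subseteq> used" "preds S \<subseteq> used" "preds Defs \<subseteq> used"
    and L_KA: "L \<inter> (K \<union> Ax) = {}"
    and L_basic: "\<And>p s. p \<in> L \<Longrightarrow> s \<in> set (snd p) \<Longrightarrow> basic s"
    and wf: "\<And>C. C \<in> S \<Longrightarrow> wf_clause sg C"
    and cata_heads: "\<And>C q ts. C \<in> S \<Longrightarrow> head C = Some (q, ts) \<Longrightarrow> q \<in> K \<Longrightarrow> cata_head q ts"
    and KA_body: "\<And>C H F. C \<in> S \<Longrightarrow> head C = Some H \<Longrightarrow> fst H \<in> K \<union> Ax \<Longrightarrow> F \<in> set (body C) \<Longrightarrow>
      fst F \<in> K \<union> Ax \<union> L"
    and L_body: "\<And>C H F. C \<in> S \<Longrightarrow> head C = Some H \<Longrightarrow> fst H \<in> L \<Longrightarrow> F \<in> set (body C) \<Longrightarrow> fst F \<in> L"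
    and model: "\<And>C. C \<in> S \<Longrightarrow> head C \<noteq> None \<Longrightarrow> holds sg M C"
    and KA_least: "\<And>F. fst F \<in> K \<union> Ax \<Longrightarrow> F \<in> M \<longleftrightarrow> F \<in> least_model sg P"
    and base: "B \<subseteq> S" "B \<inter> Defs = {}" "B \<inter> Fld = {}"
    and base_head: "\<And>C. C \<in> B \<Longrightarrow> \<exists>H. head C = Some H \<and> fst H \<in> K \<union> Ax \<union> L"
    and base_least: "\<And>J F. (\<And>C. C \<in> B \<Longrightarrow> holds sg J C) \<Longrightarrow> F \<in> M \<Longrightarrow> fst F \<in> K \<union> Ax \<Longrightarrow> F \<in> J"
    and support: "\<And>H. H \<in> M \<Longrightarrow> fst H \<notin> K \<union> Ax \<Longrightarrow>
      \<exists>C\<in>S. backed sg (K \<union> Ax) M L w (if C \<in> Fld then 1 else 0) C H"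
    and Fld_sub: "Fld \<subseteq> S"
    and Fld_head: "\<And>C. C \<in> Fld \<Longrightarrow> \<exists>H. head C = Some H \<and> fst H \<notin> K \<union> Ax"
    and defs: "\<And>D. D \<in> Defs \<Longrightarrow> is_definition K Ax L D"
    and defs_iff: "\<And>D \<sigma>. D \<in> Defs \<Longrightarrow> valuation sg \<sigma> \<Longrightarrow>
      eval_atom \<sigma> (the (head D)) \<in> M \<longleftrightarrow> (\<forall>F\<in>set (body D). eval_atom \<sigma> F \<in> M)"
    and defs_weight: "\<And>D \<sigma>. D \<in> Defs \<Longrightarrow> valuation sg \<sigma> \<Longrightarrow>
      w (eval_atom \<sigma> (the (head D))) \<le> Suc (w (eval_atom \<sigma> (last (body D))))"
begin

section \<open>Consequences of the invariant: minimality of the model, totality of the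
  catamorphisms\<close>

lemma supportE:
  assumes "H \<in> M" "fst H \<notin> K \<union> Ax"
  obtains C \<sigma> where "C \<in> S" "derives sg M C \<sigma> H"
    "\<And>F. F \<in> set (body C) \<Longrightarrow> lighter (K \<union> Ax) L w 0 H (eval_atom \<sigma> F)"
proof -
  obtain C where C: "C \<in> S" "backed sg KA M L w (if C \<in> Fld then 1 else 0) C H"
    using support[OF assms] by blast
  have "backed sg KA M L w 0 C H" by (rule backed_weaken[OF C(2)]) simp
  then show ?thesis using that C(1) unfolding backed_def by blast
qed

text \<open>Support along decreasing weights is well-founded even when folding has made definitions
  recursive. Catamorphism and auxiliary atoms come from \<open>B\<close>; atoms of the lower level
  follow by induction on the weight, since their bodies stay in that level; a second induction,
  which may use both, gives the rest.\<close>

lemma least: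
  assumes J: "\<And>C. C \<in> definite S \<Longrightarrow> holds sg J C"
  shows "M \<subseteq> J"
proof -
  have KA: "F \<in> J" if "F \<in> M" "fst F \<in> KA" for F
  proof (rule base_least[OF _ that])
    fix C assume "C \<in> B"
    then have "C \<in> definite S" using base(1) base_head by (auto simp: definite_def)
    then show "holds sg J C" by (rule J)
  qed
  have step: "H \<in> J"
    if C: "C \<in> S" "derives sg M C \<sigma> H" and body: "\<And>F. F \<in> set (body C) \<Longrightarrow> eval_atom \<sigma> F \<in> J" for C \<sigma> H
  proof -
    have d: "C \<in> definite S" using C by (auto simp: definite_def derives_def)
    have "derives sg J C \<sigma> H" using C(2) body by (auto simp: derives_def fires_def)
    then show ?thesis using J[OF d] d holds_definite[of C sg J] by (simp add: definite_def)
  qed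
  have low: "H \<in> J" if "H \<in> M" "fst H \<in> L" for H
    using that
  proof (induction "w H" arbitrary: H rule: less_induct)
    case less
    then have "fst H \<notin> KA" using L_KA by auto
    then obtain C \<sigma> where C: "C \<in> S" "derives sg M C \<sigma> H"
      and light: "\<And>F. F \<in> set (body C) \<Longrightarrow> lighter KA L w 0 H (eval_atom \<sigma> F)"
      using supportE[OF less.prems(1)] by metis
    show ?case
    proof (rule step[OF C])
      fix F assume F: "F \<in> set (body C)"
      then have "fst F \<in> L"
        using L_body[OF C(1) _ _ F] C(2) less.prems(2) unfolding derives_def by fastforce
      moreover have "eval_atom \<sigma> F \<in> M" using F C(2) by (simp add: derives_def fires_def)
      moreover have "w (eval_atom \<sigma> F) < w H"
        using light[OF F] \<open>fst F \<in> L\<close> less.prems(2) L_KA by (auto simp: lighter_def)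
      ultimately show "eval_atom \<sigma> F \<in> J" using less.hyps by simp
    qed
  qed
  have "H \<in> J" if "H \<in> M" "fst H \<notin> KA" "fst H \<notin> L" for H
    using that
  proof (induction "w H" arbitrary: H rule: less_induct)
    case less
    obtain C \<sigma> where C: "C \<in> S" "derives sg M C \<sigma> H"
      and light: "\<And>F. F \<in> set (body C) \<Longrightarrow> lighter KA L w 0 H (eval_atom \<sigma> F)"
      using supportE[OF less.prems(1,2)] by metis
    show ?case
    proof (rule step[OF C])
      fix F assume F: "F \<in> set (body C)"
      have M: "eval_atom \<sigma> F \<in> M" using F C(2) by (simp add: derives_def fires_def)
      show "eval_atom \<sigma> F \<in> J"
      proof (cases "fst F \<in> KA \<union> L")
        case True
        then show ?thesis using KA[OF M] low[OF M] by auto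
      next
        case False
        then have "w (eval_atom \<sigma> F) < w H"
          using light[OF F] less.prems(3) by (auto simp: lighter_def)
        then show ?thesis using less.hyps M False by simp
      qed
    qed
  qed
  then have "H \<in> J" if "H \<in> M" "fst H \<notin> KA" for H using that low by blast
  then show ?thesis using KA by blast
qed

text \<open>Queries are inherited by smaller interpretations, so any model of \<open>S\<close> may
  be shrunk to \<open>M\<close>.\<close>

lemma satisfiable_iff: "satisfiable sg S \<longleftrightarrow> (\<forall>C\<in>S. holds sg M C)"
proof
  assume "satisfiable sg S"
  then obtain I where I: "\<And>C. C \<in> S \<Longrightarrow> holds sg I C" by (auto simp: satisfiable_def)
  have "M \<subseteq> I" by (rule least) (simp add: I definite_def)
  have "holds sg M C" if C: "C \<in> S" for C
  proof (cases "head C = None")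
    case True
    then show ?thesis
      using I[OF C] fires_mono[OF _ \<open>M \<subseteq> I\<close>, of sg C] by (simp add: holds_fires) blast
  qed (rule model[OF C])
  then show "\<forall>C\<in>S. holds sg M C" by blast
qed (auto simp: satisfiable_def)

text \<open>\<open>support\<close> is silent on catamorphism and auxiliary atoms. Minimality of
  \<open>M\<close> gives them a deriving instance too, though without a weight bound.\<close>

lemma derivedE:
  assumes "H \<in> M"
  obtains C G \<sigma> where "C \<in> S" "head C = Some G" "H = eval_atom \<sigma> G" "fires sg M C \<sigma>"
proof -
  have 1: "M \<subseteq> J" if "\<And>C. C \<in> definite S \<Longrightarrow> holds sg J C" for J
    using that by (rule least)
  have 2: "holds sg M C" if "C \<in> definite S" for C
    using that model by (simp add: definite_def)
  obtain C \<sigma> where C: "C \<in> definite S" "derives sg M C \<sigma> H"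
    by (rule minimal_model_supported[OF 1 2 assms])
  show thesis
    using C that[of C _ \<sigma>] by (auto simp: definite_def derives_def)
qed

text \<open>Totality speaks of well-sorted tuples only, so membership in \<open>M\<close> has to
  supply the sorts.\<close>

lemma M_sorts:
  assumes "F \<in> M"
  shows "map (val_sort sg) (snd F) = map Some (snd (fst F))"
proof -
  obtain C G \<sigma> where G: "C \<in> S" "head C = Some G" "F = eval_atom \<sigma> G" "fires sg M C \<sigma>"
    using derivedE[OF assms] .
  have "wf_atom sg G" using wf[OF G(1)] G(2) by (simp add: wf_clause_def clause_atoms_def)
  then have "map (val_sort sg) (snd (eval_atom \<sigma> G)) = map Some (snd (fst G))"
    using G(4) by (intro eval_atom_sorts) (simp add: fires_def)
  then show ?thesis unfolding G(3) fst_eval_atom .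
qed

lemma M_preds:
  assumes "F \<in> M"
  shows "fst F \<in> preds S"
proof -
  obtain C G \<sigma> where G: "C \<in> S" "head C = Some G" "F = eval_atom \<sigma> G" "fires sg M C \<sigma>"
    using derivedE[OF assms] .
  then have "fst G \<in> clause_preds C" by (simp add: clause_preds_def clause_atoms_def)
  then show ?thesis using G(1,3) by (auto simp: preds_def)
qed

lemma cata_functional:
  assumes "q \<in> K" "(q, xs @ ys) \<in> M" "(q, xs @ zs) \<in> M" "length xs = Suc (adt_pos q)"
  shows "ys = zs"
proof -
  let ?n = "Suc (adt_pos q)"
  have n: "length xs = ?n" by (rule assms(4))
  have split: "vs \<in> vals_of sg (take ?n (snd q))" "us \<in> vals_of sg (drop ?n (snd q))"
    if "(q, vs @ us) \<in> M" "length vs = ?n" for vs us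
  proof -
    have "map (val_sort sg) (vs @ us) = map Some (snd q)" using M_sorts[OF that(1)] by simp
    then have "take ?n (map (val_sort sg) (vs @ us)) = take ?n (map Some (snd q))"
      "drop ?n (map (val_sort sg) (vs @ us)) = drop ?n (map Some (snd q))" by simp_all
    then show "vs \<in> vals_of sg (take ?n (snd q))" "us \<in> vals_of sg (drop ?n (snd q))"
      using that(2) by (simp_all only: vals_of_def mem_Collect_eq map_append take_append
          drop_append length_map take_map drop_map) simp_all
  qed
  note 1 = split[OF assms(2) n] and 2 = split(2)[OF assms(3) n]
  show ?thesis
    using cata_total_function[OF assms(1)] 1 2 assms(1-3) KA_least[of "(q, xs @ ys)"] KA_least[of "(q, xs @ zs)"]
    unfolding total_function_def by auto
qed

text \<open>Totality is known relative to the initial clauses \<open>P\<close>;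
  \<open>KA_least\<close> carries it over to the current model, whatever happened to the other
  predicates.\<close>

lemma cata_value:
  assumes "sorted_catom K (q, X, T, Y)" "valuation sg \<sigma>"
  obtains ys where "map (val_sort sg) ys = map (\<lambda>y. Some (snd y)) Y" "(q, map \<sigma> X @ \<sigma> T # ys) \<in> M"
proof -
  have qK: "q \<in> K" and qs: "snd q = map snd X @ snd T # map snd Y" using assms(1) by auto
  have len: "adt_pos q = length X" by (rule adt_pos_sorted[OF assms(1)])
  have "map \<sigma> X @ [\<sigma> T] \<in> vals_of sg (take (Suc (adt_pos q)) (snd q))"
    using assms(2) by (simp add: vals_of_def qs len valuation_def)
  then obtain ys where "ys \<in> vals_of sg (drop (Suc (adt_pos q)) (snd q))"
    "(q, (map \<sigma> X @ [\<sigma> T]) @ ys) \<in> least_model sg P"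
    using cata_total_function[OF qK] unfolding total_function_def by blast
  then show ?thesis
    using that[of ys] KA_least[of "(q, (map \<sigma> X @ [\<sigma> T]) @ ys)"] qK
    by (simp add: vals_of_def qs len comp_def)
qed

text \<open>The common frame of unfolding, catamorphism addition and folding, which all keep
  \<open>M\<close>, \<open>L\<close>, \<open>w\<close> and \<open>B\<close>. The substance is in
  \<open>hold\<close> and \<open>backs\<close>: the new clauses are equivalent to \<open>C\<close>
  in \<open>M\<close> and take over the atoms that \<open>C\<close> backed. \<open>F1\<close> stops
  a remaining clause from entering \<open>Fld'\<close>, where it would need a slack that it may not
  have.\<close>

lemma replace_clause:
  assumes C: "C \<in> S" and S': "S' = (S - {C}) \<union> N" and B: "B \<subseteq> S'"
    and headN: "\<And>E H. E \<in> N \<Longrightarrow> head E = Some H \<Longrightarrow> \<exists>G. head C = Some G \<and> fst G = fst H"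
    and headC: "\<And>G. head C = Some G \<Longrightarrow> fst G \<notin> K \<union> Ax"
    and wfN: "\<And>E. E \<in> N \<Longrightarrow> wf_clause sg E"
    and LN: "\<And>E H F. E \<in> N \<Longrightarrow> head E = Some H \<Longrightarrow> fst H \<in> L \<Longrightarrow> F \<in> set (body E) \<Longrightarrow> fst F \<in> L"
    and hold: "holds sg M C \<longleftrightarrow> (\<forall>E\<in>N. holds sg M E)"
    and F0: "Fld' \<subseteq> S'"
    and F1: "\<And>E. E \<in> Fld' \<Longrightarrow> E \<in> S - {C} \<Longrightarrow> E \<in> Fld"
    and F2: "Fld' \<inter> B = {}"
    and F3: "\<And>E. E \<in> Fld' \<Longrightarrow> \<exists>H. head E = Some H \<and> fst H \<notin> K \<union> Ax"
    and backs: "\<And>H. backed sg (K \<union> Ax) M L w (if C \<in> Fld then 1 else 0) C H \<Longrightarrow>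
      \<exists>E\<in>N. backed sg (K \<union> Ax) M L w (if E \<in> Fld' then 1 else 0) E H"
  shows "state sg K Ax P Q Spec (used \<union> preds S') S' Defs Fld' M L w B \<and>
    (satisfiable sg S \<longleftrightarrow> satisfiable sg S')"
proof
  have model': "holds sg M E" if "E \<in> S'" "head E \<noteq> None" for E
  proof (cases "E \<in> N")
    case True
    then have "head C \<noteq> None" using headN[of E] that(2) by auto
    then have "holds sg M C" using C model by auto
    then show ?thesis using hold True by blast
  next
    case False
    then show ?thesis using that model S' by blast
  qed
  show st: "state sg K Ax P Q Spec (used \<union> preds S') S' Defs Fld' M L w B"
  proof unfold_locales
    show "\<exists>E\<in>S'. backed sg (K \<union> Ax) M L w (if E \<in> Fld' then 1 else 0) E H"
      if H: "H \<in> M" "fst H \<notin> K \<union> Ax" for H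
    proof -
      obtain E where E: "E \<in> S" "backed sg (K \<union> Ax) M L w (if E \<in> Fld then 1 else 0) E H"
        using support[OF H] by blast
      show ?thesis
      proof (cases "E = C")
        case True
        then show ?thesis using backs[of H] E(2) S' by blast
      next
        case False
        then have "E \<in> S - {C}" using E(1) by blast
        moreover have "backed sg (K \<union> Ax) M L w (if E \<in> Fld' then 1 else 0) E H"
          using E(2) F1[of E] \<open>E \<in> S - {C}\<close> by (intro backed_weaken[OF E(2)]) auto
        ultimately show ?thesis using S' by blast
      qed
    qed
    show "cata_head q ts" if "E \<in> S'" "head E = Some (q, ts)" "q \<in> K" for E q ts
    proof (cases "E \<in> N")
      case True
      then show ?thesis using headN[OF True that(2)] headC that(3) by auto
    next
      case False
      then show ?thesis using that cata_heads[of E q ts] S' by blast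
    qed
    show "fst F \<in> K \<union> Ax \<union> L" if "E \<in> S'" "head E = Some H" "fst H \<in> K \<union> Ax" "F \<in> set (body E)" for E H F
    proof (cases "E \<in> N")
      case True
      from headN[OF True that(2)] obtain G where "head C = Some G" "fst G = fst H" by blast
      then show ?thesis using headC[of G] that(3) by simp
    next
      case False
      then show ?thesis using that KA_body[of E H F] S' by blast
    qed
    show "fst F \<in> L" if "E \<in> S'" "head E = Some H" "fst H \<in> L" "F \<in> set (body E)" for E H F
    proof (cases "E \<in> N")
      case True
      then show ?thesis using LN that(2-4) by blast
    next
      case False
      then show ?thesis using that L_body[of E H F] S' by blast
    qed
    show "wf_clause sg E" if "E \<in> S'" for E using that wf wfN S' by blast
    show "F \<in> J" if "\<And>C. C \<in> B \<Longrightarrow> holds sg J C" "F \<in> M" "fst F \<in> K \<union> Ax" for J F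
      using base_least that by blast
    show "L \<inter> (K \<union> Ax) = {}" by (rule L_KA)
    show "basic s" if "p \<in> L" "s \<in> set (snd p)" for p s using L_basic that by blast
    show "holds sg M E" if "E \<in> S'" "head E \<noteq> None" for E using model' that by blast
    show "F \<in> M \<longleftrightarrow> F \<in> least_model sg P" if "fst F \<in> K \<union> Ax" for F by (rule KA_least[OF that])
    show "\<exists>H. head E = Some H \<and> fst H \<in> K \<union> Ax \<union> L" if "E \<in> B" for E by (rule base_head[OF that])
    show "\<exists>H. head E = Some H \<and> fst H \<notin> K \<union> Ax" if "E \<in> Fld'" for E by (rule F3[OF that])
    show "is_definition K Ax L D" if "D \<in> Defs" for D by (rule defs[OF that])
  qed (use used base(2) F0 F2 B defs_iff defs_weight in blast)+
  show "satisfiable sg S \<longleftrightarrow> satisfiable sg S'"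
  proof -
    have "(\<forall>E\<in>S. holds sg M E) \<longleftrightarrow> (\<forall>E\<in>S'. holds sg M E)"
      unfolding S' using C hold by blast
    then show ?thesis unfolding satisfiable_iff state.satisfiable_iff[OF st] .
  qed
qed

end


section \<open>Unfolding\<close>

lemma trm_sort_tuple_eq:
  assumes "\<forall>s\<in>set ss. basic s"
    and "map (trm_sort sg) ts = map Some ss" "map (trm_sort sg) us = map Some ss"
  shows "trm_sort sg (tuple_eq ss ts us) = Some BoolS"
  using assms by (induction ss ts us rule: tuple_eq.induct) (auto simp: basic_def)

lemma eval_tuple_eq:
  assumes "valuation sg \<sigma>" "\<forall>s\<in>set ss. basic s"
    and "map (trm_sort sg) ts = map Some ss" "map (trm_sort sg) us = map Some ss"
  shows "eval \<sigma> (tuple_eq ss ts us) = BoolV True \<longleftrightarrow> map (eval \<sigma>) ts = map (eval \<sigma>) us"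
  using assms(2-4)
proof (induction ss ts us rule: tuple_eq.induct)
  case (1 s ss t ts u us)
  let ?e = "Fn (if s = IntS then EqI else EqB) [t, u]"
  have s: "basic s" "trm_sort sg t = Some s" "trm_sort sg u = Some s" using 1(2-4) by auto
  have IH: "eval \<sigma> (tuple_eq ss ts us) = BoolV True \<longleftrightarrow> map (eval \<sigma>) ts = map (eval \<sigma>) us"
    and srt: "trm_sort sg (tuple_eq ss ts us) = Some BoolS"
    using 1 by (simp_all add: trm_sort_tuple_eq del: map_eq_conv)
  have e: "trm_sort sg ?e = Some BoolS" using s by (auto simp: basic_def)
  have "eval \<sigma> ?e = BoolV True \<longleftrightarrow> eval \<sigma> t = eval \<sigma> u"
    using s val_sort_eval[OF assms(1) s(2)] val_sort_eval[OF assms(1) s(3)]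
    by (auto simp: basic_def val_sort_IntS val_sort_BoolS)
  then show ?case
    using eval_AndC[OF assms(1) e srt] IH by (simp del: eval.simps(2) map_eq_conv)
qed auto

lemma cata_head_rename:
  assumes "renaming \<rho>" "cata_head q ts"
  shows "cata_head q (map (subst (\<lambda>x. Var (\<rho> x))) ts)"
proof -
  obtain X k Zs Y where "ts = map Var X @ [Fn (Con k) (map Var Zs)] @ map Var Y"
    "distinct (X @ Zs @ Y)" "length X = adt_pos q"
    using assms(2) unfolding cata_head_def by blast
  moreover have "inj_on \<rho> A" for A
    using assms(1) by (metis bij_is_inj inj_on_subset renaming_def subset_UNIV)
  then have "distinct (map \<rho> (X @ Zs @ Y))"
    using \<open>distinct (X @ Zs @ Y)\<close> unfolding distinct_map by blast
  ultimately show ?thesis unfolding cata_head_def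
    by (intro exI[of _ "map \<rho> X"] exI[of _ k] exI[of _ "map \<rho> Zs"] exI[of _ "map \<rho> Y"])
      (simp add: comp_def)
qed

context state
begin

text \<open>The invariant of the intermediate clause sets of the unfolding rule. \<open>X\<close>
  collects the atoms backed by the definition being unfolded; the slack 1 is gained in the first
  resolution step and kept by all later ones.\<close>

definition unfolded :: "'a pred \<Rightarrow> ('a pred \<times> 'k val list) set \<Rightarrow> ('a, 'k) clause set \<Rightarrow> bool" where
  "unfolded p X U \<longleftrightarrow>
     (\<forall>E\<in>U. wf_clause sg E \<and> holds sg M E \<and> (\<exists>H. head E = Some H \<and> fst H = p) \<and>
        (p \<in> L \<longrightarrow> (\<forall>F\<in>set (body E). fst F \<in> L))) \<and>
     (\<forall>H\<in>X. \<exists>E\<in>U. backed sg KA M L w 1 E H)"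

lemma unfoldedD:
  assumes "unfolded p X U" "E \<in> U"
  shows "wf_clause sg E" "holds sg M E" "\<exists>H. head E = Some H \<and> fst H = p"
    "p \<in> L \<Longrightarrow> F \<in> set (body E) \<Longrightarrow> fst F \<in> L"
  using assms unfolding unfolded_def by simp_all

lemma unf_clause:
  assumes unf: "unf sg (definite S) E L0 A R U" and E': "E' \<in> U"
    and E: "wf_clause sg E" "holds sg M E" "head E = Some H" "fst H = p"
      "\<And>F. p \<in> L \<Longrightarrow> F \<in> set (body E) \<Longrightarrow> fst F \<in> L"
  shows "wf_clause sg E' \<and> holds sg M E' \<and> (\<exists>H. head E' = Some H \<and> fst H = p) \<and>
    (p \<in> L \<longrightarrow> (\<forall>F\<in>set (body E'). fst F \<in> L))"
proof -
  have body: "body E = L0 @ A # R" using unf unfolding unf_def by (rule conjunct1)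
  have S: "wf_clause sg C \<and> holds sg M C" "head C \<noteq> None" if "C \<in> definite S" for C
    using that wf model by (auto simp: definite_def)
  obtain C \<theta> \<rho> where C: "C \<in> definite S"
    and eq: "E' = subst_clause \<theta> (resolvent E L0 R (rename_clause \<rho> C))"
    and A: "fst (the (head C)) = fst A" and wf': "wf_clause sg E'" and hold': "holds sg M E'"
    by (rule unf_sound[OF unf S(1) E(1,2) E' S(2)])
  have "fst F \<in> L" if "p \<in> L" "F \<in> set (body E')" for F
  proof -
    obtain G where G: "head C = Some G" "C \<in> S" using C by (auto simp: definite_def)
    have "fst G \<in> L" using E(5)[OF that(1), of A] A G(1) body by simp
    then have "fst F' \<in> L" if "F' \<in> set (body C)" for F'
      using L_body[OF G(2,1)] that by blast
    moreover have "fst ` set (body E') = fst ` (set L0 \<union> set (body C) \<union> set R)"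
      by (simp add: eq subst_clause_def resolvent_def body_rename image_Un image_image Un_assoc)
    then have "fst F \<in> fst ` (set (body E) \<union> set (body C))"
      using that(2) body by auto
    ultimately show ?thesis using E(5)[OF that(1)] by auto
  qed
  moreover have "head E' = Some (subst_atom \<theta> H)"
    using E(3) by (simp add: eq subst_clause_def resolvent_def)
  ultimately show ?thesis using wf' hold' E(4) by simp
qed

text \<open>The resolvent found by \<open>unf_complete\<close> has as ground body the union of two
  ground bodies, so lightness can be checked on the two parts separately.\<close>

lemma unf_backed:
  assumes unf: "unf sg (definite S) E L0 A R U" and E: "wf_clause sg E"
    and \<sigma>: "derives sg M E \<sigma> H" and C: "C \<in> S" and \<tau>: "derives sg M C \<tau> (eval_atom \<sigma> A)"
    and unifiable: "\<And>\<rho> \<mu> H. \<lbrakk> renaming \<rho>; valuation sg \<mu>; head (rename_clause \<rho> C) = Some H;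
      clause_vars (rename_clause \<rho> C) \<inter> clause_vars E = {};
      eval_atom \<mu> A = eval_atom \<mu> H \<rbrakk> \<Longrightarrow> unifier_at sg \<mu> A H"
    and lightE: "\<And>F. F \<in> set L0 \<union> set R \<Longrightarrow> lighter KA L w 1 H (eval_atom \<sigma> F)"
    and lightC: "\<And>F. F \<in> set (body C) \<Longrightarrow> lighter KA L w 1 H (eval_atom \<tau> F)"
  shows "\<exists>E'\<in>U. backed sg KA M L w 1 E' H"
proof -
  have Cd: "C \<in> definite S" using C \<tau> by (auto simp: definite_def derives_def)
  have f: "fires sg M E \<sigma>" using \<sigma> by (simp add: derives_def)
  obtain E' \<delta> where E': "E' \<in> U" "fires sg M E' \<delta>"
    "map_option (eval_atom \<delta>) (head E') = map_option (eval_atom \<sigma>) (head E)"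
    "eval_atom \<delta> ` set (body E') =
       eval_atom \<sigma> ` (set L0 \<union> set R) \<union> eval_atom \<tau> ` set (body C)"
    by (rule unf_complete[OF unf Cd wf[OF C] E f \<tau> unifiable])
  have "derives sg M E' \<delta> H"
    using \<sigma> E'(2,3) by (auto simp: derives_def)
  moreover have "lighter KA L w 1 H (eval_atom \<delta> F)" if "F \<in> set (body E')" for F
  proof -
    have "eval_atom \<delta> F \<in> eval_atom \<sigma> ` (set L0 \<union> set R) \<union> eval_atom \<tau> ` set (body C)"
      using that E'(4) by blast
    then show ?thesis by (elim UnE imageE) (simp_all add: lightE lightC del: One_nat_def)
  qed
  ultimately show ?thesis using E'(1) unfolding backed_def by blast
qed

lemma wf_head_rename:
  assumes "C \<in> S" "renaming \<rho>" "head (rename_clause \<rho> C) = Some H"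
  shows "wf_atom sg H" "atom_vars H \<subseteq> clause_vars (rename_clause \<rho> C)"
  using wf_clause_rename[OF assms(2) wf[OF assms(1)]] assms(3)
  by (auto simp: wf_clause_def clause_vars_def clause_atoms_def)

text \<open>A catamorphism atom is replaced by atoms of \<open>KA\<close> and \<open>L\<close>, and
  neither kind is compared with a head outside \<open>L\<close>. Hence no slack is lost, however
  often catamorphisms are unfolded.\<close>

lemma unfolded_cata_step:
  assumes U: "unfolded p X U" and step: "cata_unfold_step sg K (definite S) U U'"
  shows "unfolded p X U'"
proof -
  obtain E L0 A R V where E: "E \<in> U" "fst A \<in> K" "adt_arg A \<notin> range Var"
    and unf: "unf sg (definite S) E L0 A R V" and U': "U' = (U - {E}) \<union> V"
    using step unfolding cata_unfold_step_def by blast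
  have body: "body E = L0 @ A # R" using unf unfolding unf_def by (rule conjunct1)
  note UE = unfoldedD[OF U E(1)]
  obtain H0 where H0: "head E = Some H0" "fst H0 = p" using UE(3) by blast
  \<comment> \<open>A clause with head in \<open>L\<close> has only atoms of \<open>L\<close> in its
    body, hence no catamorphism atom to unfold.\<close>
  have pL: "p \<notin> L" using UE(4)[of A] body E(2) L_KA by auto
  have "\<exists>E'\<in>U'. backed sg KA M L w 1 E' H" if H: "H \<in> X" for H
  proof -
    obtain E1 where E1: "E1 \<in> U" "backed sg KA M L w 1 E1 H"
      using U H unfolding unfolded_def by blast
    show ?thesis
    proof (cases "E1 = E")
      case False
      then show ?thesis using E1 U' by blast
    next
      case True
      then obtain \<sigma> where \<sigma>: "derives sg M E \<sigma> H"
        and light: "\<And>F. F \<in> set (body E) \<Longrightarrow> lighter KA L w 1 H (eval_atom \<sigma> F)"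
        using E1(2) unfolding backed_def by blast
      have "eval_atom \<sigma> A \<in> M" using \<sigma> body by (simp add: derives_def fires_def)
      \<comment> \<open>The atom is not covered by \<open>support\<close>, but an instance without
        weight bound suffices here.\<close>
      then obtain C G \<tau> where C: "C \<in> S" "head C = Some G" "eval_atom \<sigma> A = eval_atom \<tau> G" "fires sg M C \<tau>"
        by (rule derivedE)
      have G: "fst G = fst A" using arg_cong[OF C(3), of fst] by simp
      have "\<exists>E'\<in>V. backed sg KA M L w 1 E' H"
      proof (rule unf_backed[OF unf UE(1) \<sigma> C(1)])
        show "derives sg M C \<tau> (eval_atom \<sigma> A)" using C by (simp add: derives_def)
        show "lighter KA L w 1 H (eval_atom \<sigma> F)" if "F \<in> set L0 \<union> set R" for F
          using light that body by auto
        show "lighter KA L w 1 H (eval_atom \<tau> F)" if "F \<in> set (body C)" for F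
        proof -
          have "fst F \<in> KA \<union> L" using KA_body[OF C(1,2) _ that] G E(2) by simp
          moreover have "fst H \<notin> L" using \<sigma> H0 pL by (auto simp: derives_def)
          ultimately show ?thesis by (auto simp: lighter_def)
        qed
        show "unifier_at sg \<mu> A H'"
          if "renaming \<rho>" "valuation sg \<mu>" and H': "head (rename_clause \<rho> C) = Some H'"
            and disj: "clause_vars (rename_clause \<rho> C) \<inter> clause_vars E = {}"
            and ev: "eval_atom \<mu> A = eval_atom \<mu> H'" for \<rho> \<mu> H'
        proof -
          let ?\<rho> = "\<lambda>x. Var (\<rho> x) :: ('a, 'k) trm"
          have eq: "H' = (fst A, map (subst ?\<rho>) (snd G))"
            using H' head_rename[OF C(2), of \<rho>] G by (simp add: subst_atom_def)
          have "cata_head (fst A) (snd G)"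
            using cata_heads[OF C(1), of "fst A" "snd G"] C(2) G E(2) by (cases G) simp
          then have ch: "cata_head (fst A) (map (subst ?\<rho>) (snd G))"
            by (rule cata_head_rename[OF \<open>renaming \<rho>\<close>])
          have wfA: "wf_atom sg A" using UE(1) body by (simp add: wf_clause_def clause_atoms_def)
          have varsA: "atom_vars A \<subseteq> clause_vars E"
            using body by (auto simp: clause_vars_def clause_atoms_def)
          note wfH = wf_head_rename[OF C(1) \<open>renaming \<rho>\<close> H']
          have "atom_vars A \<inter> atom_vars H' = {}" using varsA wfH(2) disj by blast
          then show ?thesis
            using unifier_at_cata[OF ch _ wfA E(3)] wfH(1) ev unfolding eq by blast
        qed
      qed
      then show ?thesis using U' by blast
    qed
  qed
  moreover have "wf_clause sg E' \<and> holds sg M E' \<and> (\<exists>H. head E' = Some H \<and> fst H = p) \<and>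
    (p \<in> L \<longrightarrow> (\<forall>F\<in>set (body E'). fst F \<in> L))" if "E' \<in> U'" for E'
  proof (cases "E' \<in> V")
    case True
    show ?thesis by (rule unf_clause[OF unf True UE(1,2) H0 UE(4)])
  next
    case False
    then have "E' \<in> U" using that U' by blast
    then show ?thesis using U unfolding unfolded_def by blast
  qed
  ultimately show ?thesis unfolding unfolded_def by blast
qed

text \<open>Given the first atom, the second is true exactly when the outputs agree, because
  catamorphisms are functional. As the same instances fire, neither truth nor weights are
  affected.\<close>

lemma cata_merge_fires:
  assumes merge: "cata_merge K E E'" and E: "wf_clause sg E"
  shows "wf_clause sg E'" "head E' = head E" "set (body E') \<subseteq> set (body E)"
    and "fires sg M E' \<sigma> \<longleftrightarrow> fires sg M E \<sigma>"
proof -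
  obtain L0 M0 R q X T Y1 Y2 where q: "q \<in> K" "length X = adt_pos q"
    and body: "body E = L0 @ (q, X @ T # Y1) # M0 @ (q, X @ T # Y2) # R"
    and E': "E' = Clause (head E) (AndC (cstr E) (tuple_eq (drop (Suc (adt_pos q)) (snd q)) Y1 Y2))
               (L0 @ (q, X @ T # Y1) # M0 @ R)"
    using merge unfolding cata_merge_def by blast
  let ?ss = "drop (Suc (adt_pos q)) (snd q)"
  have srt: "map (trm_sort sg) Y = map Some ?ss" if "(q, X @ T # Y) \<in> set (body E)" for Y
  proof -
    have "wf_atom sg (q, X @ T # Y)" using E that by (simp add: wf_clause_def clause_atoms_def)
    then have "map (trm_sort sg) (X @ T # Y) = map Some (snd q)" by (simp add: wf_atom_def)
    then have "drop (Suc (adt_pos q)) (map (trm_sort sg) (X @ T # Y)) = map Some ?ss"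
      by (simp only: drop_map)
    then show ?thesis using q(2) by simp
  qed
  have Y: "map (trm_sort sg) Y1 = map Some ?ss" "map (trm_sort sg) Y2 = map Some ?ss"
    using srt[of Y1] srt[of Y2] body by simp_all
  have basic: "\<forall>s\<in>set ?ss. basic s" using cata_output_sorts[OF q(1)] by blast
  have c: "trm_sort sg (cstr E) = Some BoolS" using E by (simp add: wf_clause_def)
  have srt_eq: "trm_sort sg (tuple_eq ?ss Y1 Y2) = Some BoolS"
    by (rule trm_sort_tuple_eq[OF basic Y])
  show "wf_clause sg E'"
    using E c srt_eq body unfolding E' wf_clause_def clause_atoms_def by auto
  show "head E' = head E" "set (body E') \<subseteq> set (body E)" unfolding E' body by auto
  show "fires sg M E' \<sigma> \<longleftrightarrow> fires sg M E \<sigma>"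
  proof (cases "valuation sg \<sigma>")
    case True
    let ?F = "\<lambda>Y. (q, map (eval \<sigma>) X @ eval \<sigma> T # map (eval \<sigma>) Y)"
    have "map (eval \<sigma>) Y1 = map (eval \<sigma>) Y2" if "?F Y1 \<in> M" "?F Y2 \<in> M"
      using cata_functional[OF q(1), of "map (eval \<sigma>) X @ [eval \<sigma> T]"] that q(2) by simp
    moreover have "?F Y1 = ?F Y2" if "map (eval \<sigma>) Y1 = map (eval \<sigma>) Y2" using that by simp
    ultimately have "?F Y1 \<in> M \<and> ?F Y2 \<in> M \<longleftrightarrow> ?F Y1 \<in> M \<and> map (eval \<sigma>) Y1 = map (eval \<sigma>) Y2"
      by metis
    moreover have "eval_atom \<sigma> (q, X @ T # Y) = ?F Y" for Y by (simp add: eval_atom_def)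
    ultimately show ?thesis
      using True eval_AndC[OF True c srt_eq] eval_tuple_eq[OF True basic Y]
      unfolding fires_def E' body by (simp del: eval.simps(2) map_eq_conv) blast
  qed (simp add: fires_def)
qed

lemma unfolded_merge_step:
  assumes U: "unfolded p X U" and step: "cata_merge_step K U U'"
  shows "unfolded p X U'"
proof -
  obtain E E' where E: "E \<in> U" "cata_merge K E E'" and U': "U' = insert E' (U - {E})"
    using step unfolding cata_merge_step_def by blast
  note UE = unfoldedD[OF U E(1)]
  note m = cata_merge_fires[OF E(2) UE(1)]
  have backs: "backed sg KA M L w 1 E' H" if "backed sg KA M L w 1 E H" for H
  proof -
    have "derives sg M E' = derives sg M E"
      unfolding derives_def m(2,4) ..
    then show ?thesis using that m(3) unfolding backed_def by auto
  qed
  have "\<exists>E\<in>U'. backed sg KA M L w 1 E H" if "H \<in> X" for H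
  proof -
    have "\<exists>E\<in>U. backed sg KA M L w 1 E H" using U that unfolding unfolded_def by simp
    then show ?thesis using backs[of H] unfolding U' by auto
  qed
  moreover have "holds sg M E'" using UE(2) m(2,4) unfolding holds_fires by simp
  then have E': "wf_clause sg E' \<and> holds sg M E' \<and> (\<exists>H. head E' = Some H \<and> fst H = p) \<and>
    (p \<in> L \<longrightarrow> (\<forall>F\<in>set (body E'). fst F \<in> L))"
    using UE(3,4) m(1-3) by auto
  moreover have "wf_clause sg G \<and> holds sg M G \<and> (\<exists>H. head G = Some H \<and> fst H = p) \<and>
    (p \<in> L \<longrightarrow> (\<forall>F\<in>set (body G). fst F \<in> L))" if "G \<in> U'" for G
  proof (cases "G = E'")
    case False
    then have "G \<in> U" using that unfolding U' by simp
    from unfoldedD[OF U this] show ?thesis by blast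
  qed (use E' in simp)
  ultimately show ?thesis unfolding unfolded_def by simp
qed

text \<open>The slack originates here: the head is heavier than its program atom, which is heavier
  than the body it is resolved with, and two strict steps make \<open>w F + 1 < w H\<close>. The
  clause supporting the program atom needs no slack of its own, so it may be a folded one.\<close>

lemma unfolded_definition:
  assumes D: "D \<in> S" "D \<in> Defs" and body: "body D = Cs @ [A]" and H0: "head D = Some H0"
    and unf: "unf sg (definite S) D Cs A [] U"
  shows "unfolded (fst H0) {H. backed sg KA M L w d D H} U"
proof -
  obtain newp Xs cs p zs where
    eq: "D = Clause (Some (newp, map Var Xs)) TrueC (map cata_atom cs @ [(p, map Var zs)])"
    and p: "p \<notin> KA" "distinct zs" "snd p = map snd zs"
    and cs: "\<And>F. F \<in> set cs \<Longrightarrow> wf_catom K F" and lev: "newp \<in> L \<longleftrightarrow> p \<in> L"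
    using defs[OF D(2)] unfolding is_definition_def by blast
  have A: "A = (p, map Var zs)" "Cs = map cata_atom cs" using body eq by simp_all
  have H0': "H0 = (newp, map Var Xs)" using H0 eq by simp
  have "\<exists>E'\<in>U. backed sg KA M L w 1 E' H" if H: "backed sg KA M L w d D H" for H
  proof -
    obtain \<sigma> where \<sigma>: "derives sg M D \<sigma> H"
      and light: "\<And>F. F \<in> set (body D) \<Longrightarrow> lighter KA L w 0 H (eval_atom \<sigma> F)"
      using backed_weaken[OF H, of 0] unfolding backed_def by blast
    have fH: "fst H = newp" using \<sigma> H0 H0' by (auto simp: derives_def)
    \<comment> \<open>Head and program atom are in the same level, so \<open>lighter\<close> really
      compares them.\<close>
    have wA: "w (eval_atom \<sigma> A) < w H"
      using light[of A] body p(1) lev fH by (auto simp: lighter_def A(1))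
    have "eval_atom \<sigma> A \<in> M" using \<sigma> body by (simp add: derives_def fires_def)
    then obtain C \<tau> where C: "C \<in> S" "derives sg M C \<tau> (eval_atom \<sigma> A)"
      and lightC: "\<And>F. F \<in> set (body C) \<Longrightarrow> lighter KA L w 0 (eval_atom \<sigma> A) (eval_atom \<tau> F)"
      using p(1) A(1) by (elim supportE) auto
    show ?thesis
    proof (rule unf_backed[OF unf wf[OF D(1)] \<sigma> C])
      show "lighter KA L w 1 H (eval_atom \<sigma> F)" if F: "F \<in> set Cs \<union> set []" for F
      proof -
        have "F \<in> cata_atom ` set cs" using F by (simp add: A(2))
        then obtain G where "F = cata_atom G" "G \<in> set cs" by (rule imageE)
        then have "fst F \<in> K" using cs by (simp add: cata_pred_sorted wf_catom_sorted)
        then show ?thesis by (simp add: lighter_def)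
      qed
      show "lighter KA L w 1 H (eval_atom \<tau> F)" if "F \<in> set (body C)" for F
        using lightC[OF that] wA lev fH by (auto simp: lighter_def A(1))
      show "unifier_at sg \<mu> A H'"
        if "renaming \<rho>" "valuation sg \<mu>" and H': "head (rename_clause \<rho> C) = Some H'"
          and disj: "clause_vars (rename_clause \<rho> C) \<inter> clause_vars D = {}"
          and ev: "eval_atom \<mu> A = eval_atom \<mu> H'" for \<rho> \<mu> H'
      proof -
        note wfH = wf_head_rename[OF C(1) \<open>renaming \<rho>\<close> H']
        have "set zs \<subseteq> clause_vars D"
          by (auto simp: eq clause_vars_def clause_atoms_def atom_vars_def)
        then have "set zs \<inter> atom_vars H' = {}" using wfH(2) disj by blast
        then show ?thesis
          using unifier_at_var_atom[OF p(2,3) wfH(1)] ev unfolding A(1) by blast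
      qed
    qed
  qed
  moreover have "wf_clause sg E' \<and> holds sg M E' \<and> (\<exists>H. head E' = Some H \<and> fst H = fst H0) \<and>
    (fst H0 \<in> L \<longrightarrow> (\<forall>F\<in>set (body E'). fst F \<in> L))" if "E' \<in> U" for E'
  proof (rule unf_clause[OF unf that wf[OF D(1)] _ H0 refl])
    show "holds sg M D" using model[OF D(1)] H0 by simp
    show "fst F \<in> L" if "fst H0 \<in> L" "F \<in> set (body D)" for F
      by (rule L_body[OF D(1) H0 that])
  qed
  ultimately show ?thesis unfolding unfolded_def by blast
qed

lemma R2_state:
  assumes "R2 sg K (S, Defs, Fld) (S', Defs', Fld')"
  shows "state sg K Ax P Q Spec (used \<union> preds S') S' Defs' Fld' M L w B \<and>
    (satisfiable sg S \<longleftrightarrow> satisfiable sg S')"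
proof -
  obtain D Cs A U1 U2 N where D: "D \<in> S \<inter> Defs" "body D = Cs @ [A]"
    and unf: "unf sg (definite S) D Cs A [] U1"
    and U2: "(cata_unfold_step sg K (definite S))\<^sup>*\<^sup>* U1 U2"
    and N: "(cata_merge_step K)\<^sup>*\<^sup>* U2 N"
    and S': "S' = (S - {D}) \<union> N" and Defs': "Defs' = Defs"
    and Fld': "Fld' = (Fld - {D}) \<union> (N - (S - {D}))"
    using assms unfolding R2_def by blast
  have "is_definition K Ax L D" using D defs by blast
  then obtain H0 where H0: "head D = Some H0" "fst H0 \<notin> KA"
    unfolding is_definition_def by fastforce
  let ?X = "{H. backed sg KA M L w (if D \<in> Fld then 1 else 0) D H}"
  have "unfolded (fst H0) ?X U1"
    using D by (intro unfolded_definition[OF _ _ D(2) H0(1) unf]) simp_all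
  with U2 have "unfolded (fst H0) ?X U2"
    by (induction rule: rtranclp_induct) (blast intro: unfolded_cata_step)+
  with N have un: "unfolded (fst H0) ?X N"
    by (induction rule: rtranclp_induct) (blast intro: unfolded_merge_step)+
  note UN = unfoldedD[OF un]
  have B: "B \<subseteq> S - {D}" using base(1,2) D(1) by blast
  show ?thesis unfolding Defs'
  proof (rule replace_clause[of D S' N])
    show "D \<in> S" using D(1) by simp
    show "B \<subseteq> S'" using B S' by auto
    show "\<exists>G. head D = Some G \<and> fst G = fst H" if "E \<in> N" "head E = Some H" for E H
      using UN(3)[OF that(1)] that(2) H0(1) by auto
    show "fst G \<notin> K \<union> Ax" if "head D = Some G" for G using that H0 by auto
    show "wf_clause sg E" if "E \<in> N" for E using UN(1) that by blast
    show "fst F \<in> L" if "E \<in> N" "head E = Some H" "fst H \<in> L" "F \<in> set (body E)" for E H F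
      using UN(3,4)[OF that(1)] that(2-4) by auto
    have "holds sg M D" using model H0(1) D(1) by simp
    then show "holds sg M D \<longleftrightarrow> (\<forall>E\<in>N. holds sg M E)"
      using UN(2) by blast
    show "E \<in> Fld" if "E \<in> Fld'" "E \<in> S - {D}" for E using that Fld' by auto
    show "Fld' \<subseteq> S'" using Fld_sub Fld' S' by auto
    show "Fld' \<inter> B = {}" using B base(3) Fld' by auto
    show "\<exists>H. head E = Some H \<and> fst H \<notin> K \<union> Ax" if "E \<in> Fld'" for E
    proof (cases "E \<in> N")
      case True
      then show ?thesis using UN(3)[OF True] H0(2) by auto
    next
      case False
      then show ?thesis using that Fld' Fld_head by blast
    qed
    show "\<exists>E\<in>N. backed sg (K \<union> Ax) M L w (if E \<in> Fld' then 1 else 0) E H"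
      if b: "backed sg (K \<union> Ax) M L w (if D \<in> Fld then 1 else 0) D H" for H
    proof -
      obtain E where "E \<in> N" "backed sg KA M L w 1 E H"
        using un b unfolding unfolded_def by blast
      then show ?thesis using backed_weaken[of sg KA M L w 1 E H "if E \<in> Fld' then 1 else 0"] by auto
    qed
  qed (fact S')
qed

end


section \<open>Catamorphism addition\<close>

lemma fresh_outputs_disjoint:
  "fresh_outputs V cs \<Longrightarrow> F \<in> set cs \<Longrightarrow> set (cata_outs F) \<inter> V = {}"
  by (induction V cs rule: fresh_outputs.induct) auto

text \<open>\<open>fresh_outputs\<close> depends on the order of the atoms; if no output serves as
  an input, every order will do.\<close>

lemma fresh_outputsI:
  assumes "distinct (concat (map cata_outs cs))"
    and "\<And>F. F \<in> set cs \<Longrightarrow> set (cata_outs F) \<inter> V = {}"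
    and "\<And>F G. F \<in> set cs \<Longrightarrow> G \<in> set cs \<Longrightarrow> set (cata_outs F) \<inter> set (cata_ins G) = {}"
  shows "fresh_outputs V cs"
  using assms
proof (induction cs arbitrary: V)
  case (Cons F cs)
  obtain q X T Y where F: "F = (q, X, T, Y)" by (cases F)
  have "fresh_outputs (V \<union> set X \<union> set Y) cs"
  proof (rule Cons.IH)
    fix G assume G: "G \<in> set cs"
    have "set (cata_outs G) \<inter> V = {}" "set (cata_outs G) \<inter> set X = {}"
      using Cons.prems(2)[of G] Cons.prems(3)[of G F] G by (auto simp: F)
    moreover have "set (cata_outs G) \<inter> set Y = {}"
      using Cons.prems(1) G by (auto simp: F)
    ultimately show "set (cata_outs G) \<inter> (V \<union> set X \<union> set Y) = {}" by blast
  next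
    fix G G' assume "G \<in> set cs" "G' \<in> set cs"
    then show "set (cata_outs G) \<inter> set (cata_ins G') = {}" using Cons.prems(3) by simp
  qed (use Cons.prems(1) in simp)
  moreover have "set Y \<inter> V = {}" "set Y \<inter> set X = {}"
    using Cons.prems(2)[of F] Cons.prems(3)[of F F] by (simp_all add: F)
  ultimately show ?case using Cons.prems(1) by (simp add: F Int_Un_distrib)
qed simp

lemma sorted_catom_rename:
  "sorted_catom K F \<Longrightarrow> (\<And>x. snd (\<theta> x) = snd x) \<Longrightarrow> sorted_catom K (rename_catom \<theta> F)"
  by (cases F) (simp add: comp_def ball_Un)

lemma cata_sel_rename [simp]:
  "cata_outs (rename_catom \<theta> F) = map \<theta> (cata_outs F)"
  "cata_ins (rename_catom \<theta> F) = map \<theta> (cata_ins F)"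
  "cata_adt (rename_catom \<theta> F) = \<theta> (cata_adt F)"
  by (cases F; simp)+

lemma mset_concat_map_cong:
  "mset xs = mset ys \<Longrightarrow> mset (concat (map f xs)) = mset (concat (map f ys))"
  by (simp add: mset_concat flip: sum_mset_sum_list)

context state
begin

text \<open>Output values are chosen atom by atom, and freshness keeps a later choice from altering
  an earlier atom. Inputs may be arbitrary, since totality provides outputs for all of them.\<close>

lemma extend_outputs:
  assumes "fresh_outputs V cs" "\<And>F. F \<in> set cs \<Longrightarrow> sorted_catom K F" "valuation sg \<sigma>"
  shows "\<exists>\<tau>. valuation sg \<tau> \<and> (\<forall>F\<in>set cs. eval_atom \<tau> (cata_atom F) \<in> M) \<and>
    (\<forall>x. x \<notin> (\<Union>F\<in>set cs. set (cata_outs F)) \<longrightarrow> \<tau> x = \<sigma> x)"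
  using assms
proof (induction cs arbitrary: V \<sigma>)
  case (Cons F cs)
  obtain q X T Y where F: "F = (q, X, T, Y)" by (cases F)
  have sorted: "sorted_catom K (q, X, T, Y)" using Cons.prems(2)[of F] by (simp add: F)
  have Y: "distinct Y" "set Y \<inter> (V \<union> set X) = {}" "fresh_outputs (V \<union> set X \<union> set Y) cs"
    using Cons.prems(1) by (simp_all add: F)
  obtain ys where ys: "map (val_sort sg) ys = map (\<lambda>y. Some (snd y)) Y" "(q, map \<sigma> X @ \<sigma> T # ys) \<in> M"
    by (rule cata_value[OF sorted Cons.prems(3)])
  obtain \<sigma>1 where \<sigma>1: "valuation sg \<sigma>1" "map \<sigma>1 Y = ys" "\<And>x. x \<notin> set Y \<Longrightarrow> \<sigma>1 x = \<sigma> x"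
    by (rule valuation_override[OF Cons.prems(3) Y(1) ys(1)]) blast
  have "\<exists>\<tau>. valuation sg \<tau> \<and> (\<forall>F\<in>set cs. eval_atom \<tau> (cata_atom F) \<in> M) \<and>
    (\<forall>x. x \<notin> (\<Union>F\<in>set cs. set (cata_outs F)) \<longrightarrow> \<tau> x = \<sigma>1 x)"
    using Cons.prems(2) by (intro Cons.IH[OF Y(3) _ \<sigma>1(1)]) simp
  then obtain \<tau> where \<tau>: "valuation sg \<tau>" "\<And>F. F \<in> set cs \<Longrightarrow> eval_atom \<tau> (cata_atom F) \<in> M"
    "\<And>x. x \<notin> (\<Union>F\<in>set cs. set (cata_outs F)) \<Longrightarrow> \<tau> x = \<sigma>1 x" by blast
  have XY: "\<tau> x = \<sigma>1 x" if "x \<in> set X \<union> set Y" for x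
    using fresh_outputs_disjoint[OF Y(3)] that by (intro \<tau>(3)) blast
  \<comment> \<open>\<open>fresh_outputs\<close> does not mention the ADT argument; its sort
    separates it from all outputs.\<close>
  have "T \<notin> set Y" using sorted by auto
  have "T \<notin> set (cata_outs G)" if "G \<in> set cs" for G
  proof
    assume "T \<in> set (cata_outs G)"
    moreover have "sorted_catom K G" using Cons.prems(2) that by simp
    ultimately have "basic (snd T)" by (cases G) auto
    then show False using sorted by simp
  qed
  then have "\<tau> T = \<sigma> T" using \<tau>(3)[of T] \<sigma>1(3)[OF \<open>T \<notin> set Y\<close>] by simp
  moreover have "map \<tau> X = map \<sigma> X"
  proof (intro map_cong refl)
    fix x assume "x \<in> set X"
    moreover from this have "x \<notin> set Y" using Y(2) by blast
    ultimately show "\<tau> x = \<sigma> x" using XY[of x] \<sigma>1(3)[of x] by simp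
  qed
  moreover have "map \<tau> Y = ys" using XY \<sigma>1(2) by auto
  ultimately have "eval_atom \<tau> (cata_atom F) \<in> M"
    using ys(2) by (simp add: F eval_atom_def comp_def del: map_eq_conv)
  then have "\<forall>G\<in>set (F # cs). eval_atom \<tau> (cata_atom G) \<in> M" using \<tau>(2) by simp
  moreover have "\<tau> x = \<sigma> x" if "x \<notin> (\<Union>F\<in>set (F # cs). set (cata_outs F))" for x
    using that \<tau>(3)[of x] \<sigma>1(3)[of x] by (simp add: F)
  ultimately show ?case using \<tau>(1) by blast
qed auto

text \<open>By totality the added atoms only name values that exist anyway. What needs care is that
  their outputs stay distinct and fresh although \<open>\<theta>\<close> identifies variables of the
  specification with variables of the clause: \<open>\<theta>\<close> moves only variables of the
  matched part \<open>B1\<close>, and no output of \<open>B2\<close> occurs there.\<close>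

lemma cata_add_extends:
  assumes "cata_add Spec Cs E As E'" "set Cs \<subseteq> set (body E)" "wf_clause sg E"
  shows "wf_clause sg E' \<and> head E' = head E \<and> cstr E' = cstr E \<and>
    (\<exists>N. body E' = body E @ N \<and> (\<forall>F\<in>set N. fst F \<in> K)) \<and>
    (\<forall>\<sigma>. fires sg M E \<sigma> \<longrightarrow> (\<exists>\<sigma>'. fires sg M E' \<sigma>' \<and> (\<forall>x\<in>clause_vars E. \<sigma>' x = \<sigma> x)))"
  using assms
proof (induction rule: cata_add.induct)
  case (Add p Z cs \<rho> A cs' E B1 B2 \<theta> N As E')
  have spec: "wf_spec K Ax (p, Z, cs)" using specs Add.hyps(1) by blast
  have inj: "inj_on \<rho> X" for X
    using Add.hyps(2) by (metis bij_is_inj inj_on_subset renaming_def subset_UNIV)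
  have B: "set cs' = set B1 \<union> set B2"
    using arg_cong[OF Add.hyps(6), of set_mset] by simp
  have sorted: "sorted_catom K F" if F: "F \<in> set cs'" for F
  proof -
    obtain G where G: "G \<in> set cs" "F = rename_catom \<rho> G" using F Add.hyps(4) by auto
    then have "wf_catom K G" using spec by simp
    then show ?thesis unfolding G(2) using Add.hyps(2)
      by (intro sorted_catom_rename wf_catom_sorted) (simp_all add: renaming_def)
  qed
  have outs_eq: "concat (map cata_outs cs') = map \<rho> (concat (map cata_outs cs))"
    unfolding Add.hyps(4) by (induction cs) simp_all
  have "distinct (concat (map cata_outs cs'))"
    unfolding outs_eq using spec inj by (simp add: distinct_map)
  moreover have "mset (concat (map cata_outs cs')) = mset (concat (map cata_outs (B1 @ B2)))"
    by (rule mset_concat_map_cong) (simp add: Add.hyps(6))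
  ultimately have dist: "distinct (concat (map cata_outs (B1 @ B2)))"
    using mset_eq_imp_distinct_iff by blast
  have outs_ins: "set (cata_outs F) \<inter> set (cata_ins G) = {}" if FG: "F \<in> set cs'" "G \<in> set cs'" for F G
  proof -
    obtain F' G' where F': "F' \<in> set cs" "F = rename_catom \<rho> F'" and G': "G' \<in> set cs" "G = rename_catom \<rho> G'"
      using FG Add.hyps(4) by auto
    have "set (cata_outs F') \<inter> set (cata_ins G') = {}" using spec F'(1) G'(1) by auto
    then have "\<rho> ` (set (cata_outs F') \<inter> set (cata_ins G')) = {}" by simp
    then show ?thesis unfolding F'(2) G'(2) using inj[of UNIV] by (simp add: image_Int)
  qed
  have fresh: "set (cata_outs F) \<inter> clause_vars E = {}" if "F \<in> set cs'" for F
    using Add.hyps(5) that by auto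
  \<comment> \<open>Matched atoms already occur in the body, so their variables are sent to
    variables of the clause.\<close>
  have \<theta>_B1: "\<theta> x \<in> clause_vars E" if x: "x \<in> catom_vars B1" for x
  proof -
    obtain F where F: "F \<in> set B1" "x \<in> insert (cata_adt F) (set (cata_ins F) \<union> set (cata_outs F))"
      using x by (auto simp: catom_vars_def)
    have "cata_atom (rename_catom \<theta> F) \<in> set (body E)"
      using Add.hyps(10) Add.prems(1) F(1) by (auto simp: catas_for_def)
    moreover have "\<theta> x \<in> atom_vars (cata_atom (rename_catom \<theta> F) :: ('a, 'k) atom)"
      using F(2) by (auto simp: atom_vars_cata_atom)
    ultimately show ?thesis by (auto simp: clause_vars_def clause_atoms_def)
  qed
  have outs_B1: "x \<notin> catom_vars B1" if F: "F \<in> set B2" "x \<in> set (cata_outs F)" for F x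
  proof
    assume "x \<in> catom_vars B1"
    then obtain G where G: "G \<in> set B1" "x \<in> insert (cata_adt G) (set (cata_ins G) \<union> set (cata_outs G))"
      by (auto simp: catom_vars_def)
    have "sorted_catom K F" "sorted_catom K G" using sorted F(1) G(1) B by auto
    then have "x \<noteq> cata_adt G" using F(2) by (cases F; cases G) auto
    moreover have "x \<notin> set (cata_ins G)" using outs_ins[of F G] F G(1) B by blast
    moreover have "x \<notin> set (cata_outs G)" using dist F G(1) by auto
    ultimately show False using G(2) by simp
  qed
  let ?ex = "map (rename_catom \<theta>) B2"
  have outs: "cata_outs (rename_catom \<theta> F) = cata_outs F" if "F \<in> set B2" for F
    using outs_B1[OF that] Add.hyps(9) by (simp add: map_idI)
  have fo: "fresh_outputs (clause_vars E) ?ex"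
  proof (rule fresh_outputsI)
    have "map cata_outs ?ex = map cata_outs B2" using outs by simp
    then show "distinct (concat (map cata_outs ?ex))" using dist by (simp only:) simp
    show "set (cata_outs F) \<inter> clause_vars E = {}" if "F \<in> set ?ex" for F
    proof -
      have "F \<in> rename_catom \<theta> ` set B2" using that by simp
      then obtain F' where F': "F = rename_catom \<theta> F'" "F' \<in> set B2" by (rule imageE)
      then show ?thesis using outs fresh[of F'] B by simp
    qed
    show "set (cata_outs F) \<inter> set (cata_ins G) = {}" if FG: "F \<in> set ?ex" "G \<in> set ?ex" for F G
    proof -
      obtain F' G' where F': "F' \<in> set B2" "F = rename_catom \<theta> F'" and G': "G' \<in> set B2" "G = rename_catom \<theta> G'"
        using FG by auto
      \<comment> \<open>An input is either sent to a variable of the clause or left unchanged; the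
        outputs avoid both.\<close>
      have "\<theta> x \<notin> set (cata_outs F')" if "x \<in> set (cata_ins G')" for x
      proof (cases "x \<in> catom_vars B1")
        case True
        then show ?thesis using \<theta>_B1 fresh[of F'] F'(1) B by blast
      next
        case False
        then have "\<theta> x = x" using Add.hyps(9) by blast
        then show ?thesis using outs_ins[of F' G'] F'(1) G'(1) B that by auto
      qed
      then show ?thesis unfolding F'(2) G'(2) outs[OF F'(1)] by auto
    qed
  qed
  have ex_sorted: "sorted_catom K F" if "F \<in> set ?ex" for F
  proof -
    have "F \<in> rename_catom \<theta> ` set B2" using that by simp
    then obtain F' where F': "F = rename_catom \<theta> F'" "F' \<in> set B2" by (rule imageE)
    then show ?thesis using sorted[of F'] B Add.hyps(8) by (simp add: sorted_catom_rename)
  qed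
  have ext: "\<exists>\<tau>. valuation sg \<tau> \<and> (\<forall>F\<in>set ?ex. eval_atom \<tau> (cata_atom F) \<in> M) \<and>
    (\<forall>x. x \<notin> (\<Union>F\<in>set ?ex. set (cata_outs F)) \<longrightarrow> \<tau> x = \<sigma> x)" if "valuation sg \<sigma>" for \<sigma>
    by (rule extend_outputs[OF fo ex_sorted that])
  have outs_E: "x \<notin> (\<Union>F\<in>set ?ex. set (cata_outs F))" if "x \<in> clause_vars E" for x
    using that fresh_outputs_disjoint[OF fo] by blast
  have N: "N = map cata_atom ?ex" using Add.hyps(11) by simp
  let ?E1 = "Clause (head E) (cstr E) (body E @ N)"
  have N_atom: "fst F \<in> K \<and> wf_atom sg F" if "F \<in> set N" for F
  proof -
    have "F \<in> cata_atom ` set ?ex" using that unfolding N by (simp only: set_map)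
    then obtain G where G: "F = cata_atom G" "G \<in> set ?ex" by (rule imageE)
    show ?thesis
      unfolding G(1) using cata_pred_sorted[OF ex_sorted[OF G(2)]] wf_cata_atom[OF ex_sorted[OF G(2)]] by blast
  qed
  have "wf_clause sg ?E1"
    using Add.prems(2) N_atom by (auto simp: wf_clause_def clause_atoms_def)
  then have IH: "wf_clause sg E'" "head E' = head E" "cstr E' = cstr E"
    "\<exists>N'. body E' = (body E @ N) @ N' \<and> (\<forall>F\<in>set N'. fst F \<in> K)"
    "\<And>\<sigma>. fires sg M ?E1 \<sigma> \<Longrightarrow> \<exists>\<sigma>'. fires sg M E' \<sigma>' \<and> (\<forall>x\<in>clause_vars ?E1. \<sigma>' x = \<sigma> x)"
    using Add.IH Add.prems(1) by auto
  have "\<exists>\<sigma>'. fires sg M E' \<sigma>' \<and> (\<forall>x\<in>clause_vars E. \<sigma>' x = \<sigma> x)" if \<sigma>: "fires sg M E \<sigma>" for \<sigma>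
  proof -
    have "valuation sg \<sigma>" using \<sigma> by (simp add: fires_def)
    then obtain \<tau> where \<tau>: "valuation sg \<tau>" "\<forall>F\<in>set ?ex. eval_atom \<tau> (cata_atom F) \<in> M"
      "\<forall>x. x \<notin> (\<Union>F\<in>set ?ex. set (cata_outs F)) \<longrightarrow> \<tau> x = \<sigma> x" using ext by blast
    have agree: "\<tau> x = \<sigma> x" if "x \<in> clause_vars E" for x using outs_E[OF that] \<tau>(3) by blast
    have "fires sg M E \<tau>" by (rule fires_cong[OF \<sigma> \<tau>(1) agree])
    then have "fires sg M ?E1 \<tau>" using \<tau>(2) unfolding fires_def N by auto
    then obtain \<sigma>' where \<sigma>': "fires sg M E' \<sigma>'" "\<forall>x\<in>clause_vars ?E1. \<sigma>' x = \<tau> x"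
      using IH(5) by blast
    have "clause_vars E \<subseteq> clause_vars ?E1" by (auto simp: clause_vars_def clause_atoms_def)
    then have "\<forall>x\<in>clause_vars E. \<sigma>' x = \<sigma> x" using \<sigma>'(2) agree by (metis subsetD)
    then show ?thesis using \<sigma>'(1) by blast
  qed
  moreover obtain N' where "body E' = (body E @ N) @ N'" "\<forall>F\<in>set N'. fst F \<in> K" using IH(4) by blast
  then have "\<exists>N. body E' = body E @ N \<and> (\<forall>F\<in>set N. fst F \<in> K)"
    using N_atom by (intro exI[of _ "N @ N'"]) auto
  ultimately show ?case using IH(1-3) by blast
qed auto

text \<open>Specifications exist only for predicates with an ADT argument, which those in
  \<open>L\<close> lack; so every atom is skipped.\<close>

lemma cata_add_low:
  "cata_add Spec Cs E As E' \<Longrightarrow> (\<And>A. A \<in> set As \<Longrightarrow> fst A \<in> L) \<Longrightarrow> E' = E"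
proof (induction rule: cata_add.induct)
  case (Add p Z cs \<rho> A cs' E B1 B2 \<theta> N As E')
  have "wf_spec K Ax (p, Z, cs)" using specs Add.hyps(1) by blast
  moreover have "p \<in> L" using Add.prems[of A] Add.hyps(3) by simp
  ultimately show ?case using L_basic by auto
qed auto

lemma R3_state:
  assumes "R3 K Ax Spec (S, Defs, Fld) (S', Defs', Fld')"
  shows "state sg K Ax P Q Spec (used \<union> preds S') S' Defs' Fld' M L w B \<and>
    (satisfiable sg S \<longleftrightarrow> satisfiable sg S')"
proof -
  obtain C E where C: "C \<in> S" "\<And>H. head C = Some H \<Longrightarrow> fst H \<notin> KA"
    and add: "cata_add Spec (catas K C) C (prog_atoms K Ax C) E"
    and S': "S' = insert E (S - {C})" and Defs': "Defs' = Defs"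
    and Fld': "Fld' = (if C \<in> Fld then (Fld - {C}) \<union> ({E} - (S - {C})) else Fld - {E})"
    using assms unfolding R3_def by blast
  have ext: "wf_clause sg E \<and> head E = head C \<and> cstr E = cstr C \<and>
    (\<exists>N. body E = body C @ N \<and> (\<forall>F\<in>set N. fst F \<in> K)) \<and>
    (\<forall>\<sigma>. fires sg M C \<sigma> \<longrightarrow> (\<exists>\<sigma>'. fires sg M E \<sigma>' \<and> (\<forall>x\<in>clause_vars C. \<sigma>' x = \<sigma> x)))"
    by (rule cata_add_extends[OF add _ wf[OF C(1)]]) (simp add: catas_def)
  then obtain N where N: "body E = body C @ N" "\<forall>F\<in>set N. fst F \<in> K" by blast
  have E: "wf_clause sg E" "head E = head C" "cstr E = cstr C"
    "\<And>\<sigma>. fires sg M C \<sigma> \<Longrightarrow> \<exists>\<sigma>'. fires sg M E \<sigma>' \<and> (\<forall>x\<in>clause_vars C. \<sigma>' x = \<sigma> x)"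
    using ext by blast+
  \<comment> \<open>This protects \<open>B\<close>: its clauses with a head in \<open>L\<close> are
    left unchanged, and the rule does not apply to heads in \<open>KA\<close>.\<close>
  have low: "E = C" if H: "head C = Some H" "fst H \<in> L" for H
    using L_body[OF C(1) H] by (intro cata_add_low[OF add]) (simp add: prog_atoms_def)
  have head_cong: "eval_atom \<sigma>' G = eval_atom \<sigma> G"
    if "head C = Some G" "\<forall>x\<in>clause_vars C. \<sigma>' x = \<sigma> x" for \<sigma>' \<sigma> G
    by (rule eval_atom_cong) (use that in \<open>auto simp: clause_vars_def clause_atoms_def\<close>)
  have "holds sg M C" if hE: "holds sg M E"
    unfolding holds_fires
  proof (intro allI impI)
    fix \<sigma> assume "fires sg M C \<sigma>"
    then obtain \<sigma>' where \<sigma>': "fires sg M E \<sigma>'" "\<forall>x\<in>clause_vars C. \<sigma>' x = \<sigma> x" using E(4) by blast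
    then obtain G where "head C = Some G" "eval_atom \<sigma>' G \<in> M"
      using hE E(2) by (auto simp: holds_fires)
    then show "\<exists>H. head C = Some H \<and> eval_atom \<sigma> H \<in> M" using head_cong[OF _ \<sigma>'(2)] by auto
  qed
  moreover have "holds sg M E" if "holds sg M C"
    using that E(2,3) N(1) unfolding holds_fires fires_def by auto
  ultimately have hold: "holds sg M C \<longleftrightarrow> (\<forall>E\<in>{E}. holds sg M E)" by blast
  show ?thesis unfolding Defs'
  proof (rule replace_clause[of C S' "{E}"])
    show "S' = (S - {C}) \<union> {E}" using S' by simp
    show "B \<subseteq> S'"
    proof
      fix G assume G: "G \<in> B"
      show "G \<in> S'"
      proof (cases "G = C")
        case True
        then obtain H where "head C = Some H" "fst H \<in> KA \<union> L" using base_head G by blast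
        then show ?thesis using low[of H] C(2)[of H] True S' by auto
      qed (use G base(1) S' in auto)
    qed
    show "\<exists>G. head C = Some G \<and> fst G = fst H" if "E' \<in> {E}" "head E' = Some H" for E' H
      using that E(2) by simp
    show "fst F \<in> L" if "E' \<in> {E}" "head E' = Some H" "fst H \<in> L" "F \<in> set (body E')" for E' H F
      using that low[of H] L_body[OF C(1), of H F] E(2) by simp
    show "E' \<in> Fld" if "E' \<in> Fld'" "E' \<in> S - {C}" for E' using that Fld' by (auto split: if_splits)
    show "Fld' \<subseteq> S'" using Fld_sub Fld' S' by (auto split: if_splits)
    show "Fld' \<inter> B = {}" using base Fld' by (auto split: if_splits)
    show "\<exists>H. head E' = Some H \<and> fst H \<notin> K \<union> Ax" if E': "E' \<in> Fld'" for E'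
    proof (cases "E' \<in> Fld")
      case False
      then have "E' = E" "C \<in> Fld" using E' Fld' by (auto split: if_splits)
      then show ?thesis using Fld_head[of C] E(2) by simp
    qed (rule Fld_head)
    show "\<exists>E'\<in>{E}. backed sg (K \<union> Ax) M L w (if E' \<in> Fld' then 1 else 0) E' H"
      if b: "backed sg (K \<union> Ax) M L w (if C \<in> Fld then 1 else 0) C H" for H
    proof -
      \<comment> \<open>\<open>E\<close> enters \<open>Fld'\<close> only if \<open>C\<close> was in
        \<open>Fld\<close>, so the slack asked for never grows.\<close>
      have d: "(if E \<in> Fld' then 1 else 0) \<le> (if C \<in> Fld then 1 else (0 :: nat))"
        using Fld' by simp
      obtain \<sigma> where \<sigma>: "derives sg M C \<sigma> H"
        and light: "\<And>F. F \<in> set (body C) \<Longrightarrow> lighter KA L w (if E \<in> Fld' then 1 else 0) H (eval_atom \<sigma> F)"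
        using backed_weaken[OF b d] unfolding backed_def by blast
      have "fires sg M C \<sigma>" using \<sigma> by (simp add: derives_def)
      then obtain \<sigma>' where \<sigma>': "fires sg M E \<sigma>'" "\<forall>x\<in>clause_vars C. \<sigma>' x = \<sigma> x"
        using E(4) by blast
      have "derives sg M E \<sigma>' H"
        using \<sigma>'(1) \<sigma> head_cong[OF _ \<sigma>'(2)] E(2) by (auto simp: derives_def)
      moreover have "lighter KA L w (if E \<in> Fld' then 1 else 0) H (eval_atom \<sigma>' F)"
        if F: "F \<in> set (body E)" for F
      proof (cases "F \<in> set (body C)")
        case True
        then have "eval_atom \<sigma>' F = eval_atom \<sigma> F"
          using \<sigma>'(2) by (intro eval_atom_cong) (auto simp: clause_vars_def clause_atoms_def)
        then show ?thesis using light[OF True] by simp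
      next
        case False
        then have "fst F \<in> K" using F N by auto
        then show ?thesis by (simp add: lighter_def)
      qed
      ultimately show ?thesis unfolding backed_def by blast
    qed
  qed (use C E(1) hold in simp_all)
qed

end


section \<open>Folding\<close>

text \<open>In folding, each definition chooses values for its local variables \<open>W i\<close>
  independently. As \<open>W i\<close> avoids all variables \<open>V j\<close> of any other
  definition, the choices fit into one valuation.\<close>

lemma glue_valuations:
  assumes "\<And>i. i < n \<Longrightarrow> valuation sg (\<tau> i)" "\<And>i x. i < n \<Longrightarrow> x \<notin> W i \<Longrightarrow> \<tau> i x = \<sigma> x"
    and "valuation sg \<sigma>" "\<And>i j. i < n \<Longrightarrow> j < n \<Longrightarrow> i \<noteq> j \<Longrightarrow> W i \<inter> V j = {}"
    and "\<And>i. i < n \<Longrightarrow> W i \<subseteq> V i"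
  shows "\<exists>\<sigma>'. valuation sg \<sigma>' \<and> (\<forall>i<n. \<forall>x\<in>V i. \<sigma>' x = \<tau> i x) \<and>
    (\<forall>x. (\<forall>i<n. x \<notin> W i) \<longrightarrow> \<sigma>' x = \<sigma> x)"
proof -
  let ?p = "\<lambda>x i. i < n \<and> x \<in> W i"
  let ?\<sigma>' = "\<lambda>x. if \<exists>i. ?p x i then \<tau> (SOME i. ?p x i) x else \<sigma> x"
  have "valuation sg ?\<sigma>'"
    unfolding valuation_def
  proof
    fix x
    show "val_sort sg (?\<sigma>' x) = Some (snd x)"
    proof (cases "\<exists>i. ?p x i")
      case True
      then have "?p x (SOME i. ?p x i)" by (rule someI_ex)
      then show ?thesis using True assms(1) by (simp add: valuation_def)
    next
      case False
      show ?thesis unfolding if_not_P[OF False] using assms(3) by (simp add: valuation_def)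
    qed
  qed
  moreover have "?\<sigma>' x = \<tau> i x" if i: "i < n" "x \<in> V i" for i x
  proof (cases "\<exists>j. ?p x j")
    case True
    then have "?p x (SOME j. ?p x j)" by (rule someI_ex)
    then have "(SOME j. ?p x j) = i" using assms(4)[of "SOME j. ?p x j" i] i by blast
    then show ?thesis using True by simp
  next
    case False
    then show ?thesis using i assms(2)[of i x] by auto
  qed
  moreover have "?\<sigma>' x = \<sigma> x" if "\<forall>i<n. x \<notin> W i" for x
    using that by auto
  ultimately show ?thesis by (intro exI[of _ ?\<sigma>']) blast
qed

context state
begin

text \<open>A renaming only reindexes valuations, so the equivalence and the weight bound of a
  definition pass to its variants.\<close>

lemma fold_defE:
  assumes "fold_def K Defs V G A D"
  obtains H CsD where "head D = Some H" "body D = CsD @ [A]" "set G \<subseteq> set CsD"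
    "\<And>\<sigma>. valuation sg \<sigma> \<Longrightarrow> eval_atom \<sigma> H \<in> M \<longleftrightarrow> (\<forall>F\<in>set (body D). eval_atom \<sigma> F \<in> M)"
    "\<And>\<sigma>. valuation sg \<sigma> \<Longrightarrow> w (eval_atom \<sigma> H) \<le> Suc (w (eval_atom \<sigma> A))"
    "fst A \<notin> KA" "fst H \<in> L \<longleftrightarrow> fst A \<in> L" "fst H \<notin> KA" "wf_atom sg H"
proof -
  obtain D0 \<rho> CsD where D0: "D0 \<in> Defs" "renaming \<rho>" "D = rename_clause \<rho> D0"
    and body: "body D = CsD @ [A]" "set G \<subseteq> set CsD"
    using assms unfolding fold_def_def by blast
  let ?\<rho> = "\<lambda>x. Var (\<rho> x) :: ('a, 'k) trm"
  obtain newp Xs cs p zs where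
    eq: "D0 = Clause (Some (newp, map Var Xs)) TrueC (map cata_atom cs @ [(p, map Var zs)])"
    and np: "newp \<notin> KA" "snd newp = map snd Xs" "p \<notin> KA" "newp \<in> L \<longleftrightarrow> p \<in> L"
    using defs[OF D0(1)] unfolding is_definition_def by blast
  have sub: "substitution sg ?\<rho>" by (rule renaming_substitution[OF D0(2)])
  have bodyD: "body D = map (subst_atom ?\<rho>) (body D0)" unfolding D0(3) by (rule body_rename)
  have A: "A = subst_atom ?\<rho> (last (body D0))"
    using arg_cong[OF bodyD, of last] body(1) by (simp add: eq)
  let ?H = "subst_atom ?\<rho> (newp, map Var Xs)"
  have head: "head D = Some ?H" unfolding D0(3) by (rule head_rename) (simp add: eq)
  have H0: "the (head D0) = (newp, map Var Xs)" by (simp add: eq)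
  show thesis
  proof (rule that[OF head body])
    fix \<sigma> :: "'a var \<Rightarrow> 'k val" assume \<sigma>: "valuation sg \<sigma>"
    have val: "valuation sg (\<lambda>x. eval \<sigma> (?\<rho> x))" by (rule valuation_subst[OF \<sigma> sub])
    show "eval_atom \<sigma> ?H \<in> M \<longleftrightarrow> (\<forall>F\<in>set (body D). eval_atom \<sigma> F \<in> M)"
      using defs_iff[OF D0(1) val] unfolding H0 bodyD eval_atom_subst by (simp add: eval_atom_subst)
    show "w (eval_atom \<sigma> ?H) \<le> Suc (w (eval_atom \<sigma> A))"
      using defs_weight[OF D0(1) val] unfolding H0 A eval_atom_subst .
  next
    show "wf_atom sg ?H" unfolding wf_atom_subst[OF sub] using np(2) by (simp add: wf_atom_def)
  qed (use A np in \<open>simp_all add: eq\<close>)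
qed

text \<open>A definition may have catamorphism atoms that the clause lacks. Totality makes them true
  by a choice of their outputs, which are local to the definition.\<close>

lemma fold_def_extend:
  assumes fold: "fold_def K Defs V G A D" and \<sigma>: "valuation sg \<sigma>"
    and true: "\<And>F. F \<in> set (A # G) \<Longrightarrow> eval_atom \<sigma> F \<in> M"
  shows "\<exists>\<tau>. valuation sg \<tau> \<and> (\<forall>F\<in>set (body D). eval_atom \<tau> F \<in> M) \<and>
    (\<forall>x. x \<notin> clause_vars D - \<Union> (atom_vars ` set (A # G)) \<longrightarrow> \<tau> x = \<sigma> x)"
proof -
  let ?V = "\<Union> (atom_vars ` set (A # G))"
  obtain CsD ex where body: "body D = CsD @ [A]"
    and ex: "set CsD - set G = set (map cata_atom ex)" "\<forall>F\<in>set ex. wf_catom K F"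
      "fresh_outputs ?V ex"
    using fold unfolding fold_def_def by blast
  have sorted: "sorted_catom K F" if "F \<in> set ex" for F
    using ex(2) that by (blast intro: wf_catom_sorted)
  obtain \<tau> where \<tau>: "valuation sg \<tau>" "\<And>F. F \<in> set ex \<Longrightarrow> eval_atom \<tau> (cata_atom F) \<in> M"
    "\<And>x. x \<notin> (\<Union>F\<in>set ex. set (cata_outs F)) \<Longrightarrow> \<tau> x = \<sigma> x"
    using extend_outputs[OF ex(3) sorted \<sigma>] by blast
  have outs: "(\<Union>F\<in>set ex. set (cata_outs F)) \<subseteq> clause_vars D - ?V"
  proof
    fix x assume "x \<in> (\<Union>F\<in>set ex. set (cata_outs F))"
    then obtain F where F: "F \<in> set ex" "x \<in> set (cata_outs F)" by (rule UN_E)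
    have "(cata_atom F :: ('a, 'k) atom) \<in> set (map cata_atom ex)" using F(1) by simp
    then have "cata_atom F \<in> set (body D)" using ex(1) body by auto
    moreover have "x \<in> atom_vars (cata_atom F :: ('a, 'k) atom)" using F(2) by (simp add: atom_vars_cata_atom)
    ultimately have "x \<in> clause_vars D" by (auto simp: clause_vars_def clause_atoms_def)
    then show "x \<in> clause_vars D - ?V" using fresh_outputs_disjoint[OF ex(3) F(1)] F(2) by blast
  qed
  have agree: "\<tau> x = \<sigma> x" if "x \<notin> clause_vars D - ?V" for x
    using that outs by (intro \<tau>(3)) blast
  have "eval_atom \<tau> F \<in> M" if "F \<in> set (body D)" for F
  proof (cases "F \<in> set (A # G)")
    case True
    have "eval_atom \<tau> F = eval_atom \<sigma> F"
      using True by (intro eval_atom_cong agree) blast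
    then show ?thesis using true[OF True] by simp
  next
    case False
    then have "F \<in> set CsD - set G" using that body by simp
    then have "F \<in> cata_atom ` set ex" unfolding ex(1) by simp
    then show ?thesis using \<tau>(2) by (elim imageE) simp
  qed
  then show ?thesis using \<tau>(1) agree by blast
qed

lemma R4_state:
  assumes "R4 K Ax (S, Defs, Fld) (S', Defs', Fld')"
  shows "state sg K Ax P Q Spec (used \<union> preds S') S' Defs' Fld' M L w B \<and>
    (satisfiable sg S \<longleftrightarrow> satisfiable sg S')"
proof -
  obtain C Ds E where C: "C \<in> S" "is_query C \<or> C \<in> Fld" "\<And>F. F \<in> set (body C) \<Longrightarrow> fst F \<notin> Ax"
    and covered: "\<forall>F\<in>set (catas K C). \<exists>A\<in>set (prog_atoms K Ax C). F \<in> set (catas_for (catas K C) A)"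
    and folds: "list_all2 (\<lambda>A D. fold_def K Defs (clause_vars C) (catas_for (catas K C) A) A D)
         (prog_atoms K Ax C) Ds"
    and apart: "\<forall>i<length Ds. \<forall>j<length Ds. i \<noteq> j \<longrightarrow>
          clause_vars (Ds ! i) \<inter> clause_vars (Ds ! j) \<subseteq> clause_vars C"
    and E: "E = Clause (head C) (cstr C) (map (\<lambda>D. the (head D)) Ds)"
    and S': "S' = insert E (S - {C})" and Defs': "Defs' = Defs" and Fld': "Fld' = Fld - {C, E}"
    using assms unfolding R4_def by (auto simp del: split_paired_All split_paired_Ex)
  let ?As = "prog_atoms K Ax C" and ?n = "length Ds"
  let ?G = "\<lambda>i. catas_for (catas K C) (?As ! i)"
  have n: "length ?As = ?n" using folds by (rule list_all2_lengthD)
  have fold: "fold_def K Defs (clause_vars C) (?G i) (?As ! i) (Ds ! i)" if "i < ?n" for i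
    using list_all2_nthD[OF folds, of i] that n by simp
  have As: "?As ! i \<in> set (body C)" if "i < ?n" for i
    using nth_mem[of i ?As] that n by (simp add: prog_atoms_def)
  have Gs: "set (?G i) \<subseteq> set (body C)" for i by (auto simp: catas_for_def catas_def)
  have headC: "fst G \<notin> KA" if "head C = Some G" for G
    using C(2) Fld_head[of C] that by (auto simp: is_query_def)
  have nth_E: "\<exists>i<?n. F = the (head (Ds ! i))" if "F \<in> set (body E)" for F
    using that by (auto simp: E in_set_conv_nth)
  have head_Ds: "\<exists>H. head (Ds ! i) = Some H \<and> wf_atom sg H \<and> (fst H \<in> L \<longleftrightarrow> fst (?As ! i) \<in> L)"
    if "i < ?n" for i
    by (rule fold_defE[OF fold[OF that]]) blast
  \<comment> \<open>In this direction the valuation is kept, since every body atom of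
    \<open>C\<close> occurs in the body of some definition; for catamorphism atoms this is
    \<open>covered\<close>.\<close>
  have unfold: "fires sg M C \<sigma>" if "fires sg M E \<sigma>" for \<sigma>
  proof -
    have val: "valuation sg \<sigma>" using that by (simp add: fires_def)
    have true: "eval_atom \<sigma> F \<in> M" if i: "i < ?n" "F \<in> set (?As ! i # ?G i)" for i F
    proof -
      obtain H CsD where H: "head (Ds ! i) = Some H" "body (Ds ! i) = CsD @ [?As ! i]" "set (?G i) \<subseteq> set CsD"
        "eval_atom \<sigma> H \<in> M \<longleftrightarrow> (\<forall>F\<in>set (body (Ds ! i)). eval_atom \<sigma> F \<in> M)"
        by (rule fold_defE[OF fold[OF i(1)]]) (use val in blast)
      have "the (head (Ds ! i)) \<in> set (body E)" using nth_mem[OF i(1)] by (simp add: E)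
      then have "H \<in> set (body E)" using H(1) by simp
      then have "eval_atom \<sigma> H \<in> M" using \<open>fires sg M E \<sigma>\<close> by (simp add: fires_def)
      moreover have "F \<in> set (body (Ds ! i))" using i(2) H(2,3) by auto
      ultimately show ?thesis using H(4) by blast
    qed
    have "eval_atom \<sigma> F \<in> M" if F: "F \<in> set (body C)" for F
    proof (cases "fst F \<in> K")
      case True
      then have "F \<in> set (catas K C)" using F by (simp add: catas_def)
      then obtain A where "A \<in> set ?As" "F \<in> set (catas_for (catas K C) A)" using covered by blast
      then obtain i where "i < ?n" "F \<in> set (?G i)" using n by (metis in_set_conv_nth)
      then show ?thesis using true[of i F] by simp
    next
      case False
      then have "F \<in> set ?As" using F C(3)[OF F] by (simp add: prog_atoms_def)
      then obtain i where "i < ?n" "F = ?As ! i" using n by (metis in_set_conv_nth)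
      then show ?thesis using true[of i F] by simp
    qed
    then show ?thesis using that by (simp add: fires_def E)
  qed
  \<comment> \<open>In this direction the valuation changes, but only on local variables of the
    definitions, which do not occur in \<open>C\<close>.\<close>
  have refold: "\<exists>\<sigma>'. fires sg M E \<sigma>' \<and> (\<forall>x\<in>clause_vars C. \<sigma>' x = \<sigma> x)" if \<sigma>: "fires sg M C \<sigma>" for \<sigma>
  proof -
    define W where "W i = clause_vars (Ds ! i) - \<Union> (atom_vars ` set (?As ! i # ?G i))" for i
    have val: "valuation sg \<sigma>" using \<sigma> by (simp add: fires_def)
    have "\<exists>\<tau>. valuation sg \<tau> \<and> (\<forall>F\<in>set (body (Ds ! i)). eval_atom \<tau> F \<in> M) \<and>
      (\<forall>x. x \<notin> W i \<longrightarrow> \<tau> x = \<sigma> x)" if i: "i < ?n" for i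
      unfolding W_def
    proof (rule fold_def_extend[OF fold[OF i] val])
      fix F assume "F \<in> set (?As ! i # ?G i)"
      then have "F \<in> set (body C)" using As[OF i] Gs[of i] by auto
      then show "eval_atom \<sigma> F \<in> M" using \<sigma> by (simp add: fires_def)
    qed
    then obtain \<tau> where \<tau>: "\<And>i. i < ?n \<Longrightarrow> valuation sg (\<tau> i)"
      "\<And>i F. i < ?n \<Longrightarrow> F \<in> set (body (Ds ! i)) \<Longrightarrow> eval_atom (\<tau> i) F \<in> M"
      "\<And>i x. i < ?n \<Longrightarrow> x \<notin> W i \<Longrightarrow> \<tau> i x = \<sigma> x"
      by metis
    have W_C: "W i \<inter> clause_vars C = {}" if "i < ?n" for i
      using fold[OF that] unfolding fold_def_def W_def by blast
    have W_V: "W i \<inter> clause_vars (Ds ! j) = {}" if "i < ?n" "j < ?n" "i \<noteq> j" for i j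
    proof -
      have "W i \<inter> clause_vars (Ds ! j) \<subseteq> clause_vars C"
        using apart that unfolding W_def by blast
      then show ?thesis using W_C[OF that(1)] by blast
    qed
    have W_sub: "W i \<subseteq> clause_vars (Ds ! i)" for i by (auto simp: W_def)
    have "\<exists>\<sigma>'. valuation sg \<sigma>' \<and> (\<forall>i<?n. \<forall>x\<in>clause_vars (Ds ! i). \<sigma>' x = \<tau> i x) \<and>
      (\<forall>x. (\<forall>i<?n. x \<notin> W i) \<longrightarrow> \<sigma>' x = \<sigma> x)"
      by (rule glue_valuations) (simp_all add: \<tau> val W_V W_sub)
    then obtain \<sigma>' where val': "valuation sg \<sigma>'"
      and glued: "\<forall>i<?n. \<forall>x\<in>clause_vars (Ds ! i). \<sigma>' x = \<tau> i x"
      and outside: "\<forall>x. (\<forall>i<?n. x \<notin> W i) \<longrightarrow> \<sigma>' x = \<sigma> x"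
      by (elim exE conjE) (rule that)
    have agree: "\<sigma>' x = \<sigma> x" if "x \<in> clause_vars C" for x
    proof -
      have "\<forall>i<?n. x \<notin> W i" using W_C that by blast
      then show ?thesis using outside by simp
    qed
    have "eval_atom \<sigma>' F \<in> M" if "F \<in> set (body E)" for F
    proof -
      obtain i where i: "i < ?n" "F = the (head (Ds ! i))" using nth_E \<open>F \<in> set (body E)\<close> by blast
      obtain H where H: "head (Ds ! i) = Some H"
        "eval_atom \<sigma>' H \<in> M \<longleftrightarrow> (\<forall>F\<in>set (body (Ds ! i)). eval_atom \<sigma>' F \<in> M)"
        by (rule fold_defE[OF fold[OF i(1)]]) (use val' in blast)
      have "eval_atom \<sigma>' G = eval_atom (\<tau> i) G" if "G \<in> set (body (Ds ! i))" for G
      proof (rule eval_atom_cong)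
        fix x assume "x \<in> atom_vars G"
        then have "x \<in> clause_vars (Ds ! i)"
          using that by (auto simp: clause_vars_def clause_atoms_def)
        then show "\<sigma>' x = \<tau> i x" using glued i(1) by simp
      qed
      then show ?thesis using H i \<tau>(2)[OF i(1)] by simp
    qed
    moreover have "fires sg M C \<sigma>'" by (rule fires_cong[OF \<sigma> val' agree])
    ultimately have "fires sg M E \<sigma>'" by (simp add: fires_def E)
    then show ?thesis using agree by blast
  qed
  have head_cong: "eval_atom \<sigma>' G = eval_atom \<sigma> G"
    if "head C = Some G" "\<forall>x\<in>clause_vars C. \<sigma>' x = \<sigma> x" for \<sigma>' \<sigma> G
    by (rule eval_atom_cong) (use that in \<open>auto simp: clause_vars_def clause_atoms_def\<close>)
  have headE: "head E = head C" by (simp add: E)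
  have "holds sg M C" if hE: "holds sg M E"
    unfolding holds_fires
  proof (intro allI impI)
    fix \<sigma> assume "fires sg M C \<sigma>"
    then obtain \<sigma>' where \<sigma>': "fires sg M E \<sigma>'" "\<forall>x\<in>clause_vars C. \<sigma>' x = \<sigma> x" using refold by blast
    then obtain G where "head C = Some G" "eval_atom \<sigma>' G \<in> M"
      using hE headE by (auto simp: holds_fires)
    then show "\<exists>H. head C = Some H \<and> eval_atom \<sigma> H \<in> M" using head_cong[OF _ \<sigma>'(2)] by auto
  qed
  moreover have "holds sg M E" if "holds sg M C"
    using that unfold unfolding holds_fires headE by blast
  ultimately have hold: "holds sg M C \<longleftrightarrow> (\<forall>E\<in>{E}. holds sg M E)" by blast
  show ?thesis unfolding Defs'
  proof (rule replace_clause[of C S' "{E}"])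
    show "S' = (S - {C}) \<union> {E}" using S' by simp
    \<comment> \<open>\<open>C\<close> is a query or in \<open>Fld\<close>, whereas \<open>B\<close>
      consists of definite clauses outside \<open>Fld\<close>.\<close>
    have "C \<notin> B" using C(2) base(3) base_head[of C] by (auto simp: is_query_def)
    then show "B \<subseteq> S'" using base(1) S' by auto
    show "\<exists>G. head C = Some G \<and> fst G = fst H" if "E' \<in> {E}" "head E' = Some H" for E' H
      using that headE by simp
    show "wf_clause sg E'" if "E' \<in> {E}" for E'
    proof -
      have "wf_atom sg F" if "F \<in> set (body E)" for F
      proof -
        obtain i where i: "i < ?n" "F = the (head (Ds ! i))" using nth_E \<open>F \<in> set (body E)\<close> by blast
        then show ?thesis using head_Ds[OF i(1)] by auto
      qed
      then show ?thesis using wf[OF C(1)] that by (auto simp: wf_clause_def clause_atoms_def E)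
    qed
    show "fst F \<in> L" if E': "E' \<in> {E}" "head E' = Some H" "fst H \<in> L" "F \<in> set (body E')" for E' H F
    proof -
      obtain i where i: "i < ?n" "F = the (head (Ds ! i))" using nth_E E'(1,4) by blast
      have "fst (?As ! i) \<in> L"
        using L_body[OF C(1), of H] E'(1-3) headE As[OF i(1)] by simp
      then show ?thesis using i(2) head_Ds[OF i(1)] by auto
    qed
    show "E' \<in> Fld" if "E' \<in> Fld'" for E' using that Fld' by simp
    show "Fld' \<subseteq> S'" using Fld_sub Fld' S' by auto
    show "Fld' \<inter> B = {}" using base(3) Fld' by auto
    show "\<exists>H. head E' = Some H \<and> fst H \<notin> K \<union> Ax" if "E' \<in> Fld'" for E'
      using that Fld' Fld_head by blast
    show "\<exists>E'\<in>{E}. backed sg (K \<union> Ax) M L w (if E' \<in> Fld' then 1 else 0) E' H"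
      if b: "backed sg (K \<union> Ax) M L w (if C \<in> Fld then 1 else 0) C H" for H
    proof -
      obtain \<sigma> where \<sigma>: "derives sg M C \<sigma> H"
        and light: "\<And>F. F \<in> set (body C) \<Longrightarrow> lighter KA L w (if C \<in> Fld then 1 else 0) H (eval_atom \<sigma> F)"
        using b unfolding backed_def by blast
      have "C \<in> Fld" using \<sigma> C(2) by (auto simp: derives_def is_query_def)
      have "fires sg M C \<sigma>" using \<sigma> by (simp add: derives_def)
      then obtain \<sigma>' where \<sigma>': "fires sg M E \<sigma>'" "\<forall>x\<in>clause_vars C. \<sigma>' x = \<sigma> x"
        using refold by blast
      have "derives sg M E \<sigma>' H"
        using \<sigma>'(1) \<sigma> head_cong[OF _ \<sigma>'(2)] headE by (auto simp: derives_def)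
      moreover have "lighter KA L w 0 H (eval_atom \<sigma>' F)" if F: "F \<in> set (body E)" for F
      proof -
        obtain i where i: "i < ?n" "F = the (head (Ds ! i))" using nth_E F by blast
        have "eval_atom \<sigma>' (?As ! i) = eval_atom \<sigma> (?As ! i)"
          using \<sigma>'(2) As[OF i(1)] by (intro eval_atom_cong) (auto simp: clause_vars_def clause_atoms_def)
        \<comment> \<open>The slack of \<open>C\<close> pays for the head of the definition, which
          is at most one heavier than its program atom. Nothing is left over, and accordingly
          \<open>E\<close> is not in \<open>Fld'\<close>.\<close>
        then have A: "lighter KA L w 1 H (eval_atom \<sigma>' (?As ! i))"
          using light[OF As[OF i(1)]] \<open>C \<in> Fld\<close> by simp
        have val: "valuation sg \<sigma>'" using \<sigma>'(1) by (simp add: fires_def)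
        obtain G where G: "head (Ds ! i) = Some G"
          "w (eval_atom \<sigma>' G) \<le> Suc (w (eval_atom \<sigma>' (?As ! i)))"
          "fst (?As ! i) \<notin> KA" "fst G \<in> L \<longleftrightarrow> fst (?As ! i) \<in> L"
          by (rule fold_defE[OF fold[OF i(1)]]) (use val in blast)
        then have "F = G" using i(2) by simp
        then show ?thesis using A G(2-4) by (auto simp: lighter_def)
      qed
      moreover have "E \<notin> Fld'" using Fld' by simp
      ultimately show ?thesis unfolding backed_def by auto
    qed
  qed (use C headC hold in simp_all)
qed

end


section \<open>Definition\<close>

lemma wf_catom_adt: "wf_catom K F \<Longrightarrow> \<not> basic (snd (cata_adt F))"
  by (cases F) simp

lemma fires_cong_interp:
  assumes "\<And>F. fst F \<in> clause_preds C \<Longrightarrow> F \<in> I \<longleftrightarrow> F \<in> J"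
  shows "fires sg I C \<sigma> \<longleftrightarrow> fires sg J C \<sigma>"
proof -
  have "eval_atom \<sigma> F \<in> I \<longleftrightarrow> eval_atom \<sigma> F \<in> J" if "F \<in> set (body C)" for F
    using that by (intro assms) (simp add: clause_preds_def clause_atoms_def)
  then show ?thesis unfolding fires_def by blast
qed

lemma holds_cong_interp:
  assumes "\<And>F. fst F \<in> clause_preds C \<Longrightarrow> F \<in> I \<longleftrightarrow> F \<in> J"
  shows "holds sg I C \<longleftrightarrow> holds sg J C"
proof -
  have "eval_atom \<sigma> H \<in> I \<longleftrightarrow> eval_atom \<sigma> H \<in> J" if "head C = Some H" for \<sigma> H
    using that by (intro assms) (simp add: clause_preds_def clause_atoms_def)
  then have "(\<exists>H. head C = Some H \<and> eval_atom \<sigma> H \<in> I) \<longleftrightarrow>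
    (\<exists>H. head C = Some H \<and> eval_atom \<sigma> H \<in> J)" for \<sigma>
    by (cases "head C") simp_all
  moreover have "fires sg I C \<sigma> \<longleftrightarrow> fires sg J C \<sigma>" for \<sigma>
    using assms by (rule fires_cong_interp)
  ultimately show ?thesis unfolding holds_fires by simp
qed

text \<open>For rules that extend \<open>L\<close> by new symbols, which the older definitions do
  not mention.\<close>

lemma is_definition_level:
  assumes "is_definition K Ax L D" "\<And>p. p \<in> clause_preds D \<Longrightarrow> p \<in> L' \<longleftrightarrow> p \<in> L"
  shows "is_definition K Ax L' D"
proof -
  obtain newp Xs cs p zs where D: "D = Clause (Some (newp, map Var Xs)) TrueC (map cata_atom cs @ [(p, map Var zs)])"
    and rest: "newp \<notin> K \<union> Ax" "snd newp = map snd Xs" "p \<notin> K \<union> Ax" "distinct zs" "snd p = map snd zs"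
      "\<forall>F\<in>set cs. wf_catom K F" "newp \<in> L \<longleftrightarrow> p \<in> L" "p \<in> L \<longrightarrow> cs = []"
    using assms(1) unfolding is_definition_def by blast
  have "newp \<in> L' \<longleftrightarrow> newp \<in> L" "p \<in> L' \<longleftrightarrow> p \<in> L"
    by (intro assms(2); simp add: D clause_preds_def clause_atoms_def)+
  then show ?thesis unfolding is_definition_def using D rest
    by (intro exI[of _ newp] exI[of _ Xs] exI[of _ cs] exI[of _ p] exI[of _ zs]) simp
qed

lemma is_definition_preds:
  assumes "is_definition K Ax L D"
  shows "fst (the (head D)) \<in> clause_preds D" "fst (last (body D)) \<in> clause_preds D"
  using assms unfolding is_definition_def clause_preds_def clause_atoms_def by auto

context state
begin

lemma S_preds: "C \<in> S \<Longrightarrow> p \<in> clause_preds C \<Longrightarrow> p \<in> used"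
  using used(3) by (auto simp: preds_def)

lemma Defs_preds: "D \<in> Defs \<Longrightarrow> p \<in> clause_preds D \<Longrightarrow> p \<in> used"
  using used(4) by (auto simp: preds_def)

lemma clause_predsI: "F \<in> clause_atoms C \<Longrightarrow> fst F \<in> clause_preds C"
  by (simp add: clause_preds_def)

text \<open>The head variables \<open>Xs\<close> include all variables of the body, so a ground head
  determines its ground body. Hence adding the derivable heads makes the definition an equivalence,
  and each head can be placed exactly one above its program atom.\<close>

lemma R1_state:
  assumes "R1 K Ax used (S, Defs, Fld) (S', Defs', Fld')"
  shows "\<exists>M L w B. state sg K Ax P Q Spec (used \<union> preds S') S' Defs' Fld' M L w B \<and>
    (satisfiable sg S \<longleftrightarrow> satisfiable sg S')"
proof -
  obtain newp Xs cs p zs D where newp: "newp \<notin> used" "snd newp = map snd Xs"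
    and p: "p \<in> used" "p \<notin> KA" "snd p = map snd zs" "distinct zs"
    and cs: "\<And>F. F \<in> set cs \<Longrightarrow> wf_catom K F \<and> cata_adt F \<in> set zs"
    and Xs: "set Xs = catom_vars cs \<union> set zs"
    and D: "D = Clause (Some (newp, map Var Xs)) TrueC (map cata_atom cs @ [(p, map Var zs)])"
    and S': "S' = insert D S" and Defs': "Defs' = insert D Defs" and Fld': "Fld' = Fld"
    using assms unfolding R1_def Let_def by blast
  let ?A = "(p, map Var zs) :: ('a, 'k) atom"
  define N where "N = {(newp, map \<sigma> Xs) | \<sigma>. valuation sg \<sigma> \<and> (\<forall>F\<in>set (body D). eval_atom \<sigma> F \<in> M)}"
  define M' where "M' = M \<union> N"
  \<comment> \<open>The choice is harmless: any valuation with these values of \<open>Xs\<close>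
    yields the same program atom.\<close>
  define w' where "w' F = (if fst F = newp
    then Suc (w (eval_atom (SOME \<sigma>. map \<sigma> Xs = snd F) ?A)) else w F)" for F
  \<comment> \<open>\<open>newp\<close> joins the level of its program atom, as
    \<open>is_definition\<close> requires.\<close>
  define L' where "L' = (if p \<in> L then insert newp L else L)"
  have np: "newp \<notin> KA" "newp \<notin> L" "newp \<noteq> p" using newp(1) used(1,2) p(1) by auto
  have M'_used: "F \<in> M' \<longleftrightarrow> F \<in> M" if "fst F \<in> used" for F
    using that newp(1) by (auto simp: M'_def N_def)
  have M_used: "fst F \<in> used" if "F \<in> M" for F using M_preds[OF that] used(3) by blast
  have w'_used: "w' F = w F" if "fst F \<in> used" for F using that newp(1) by (auto simp: w'_def)
  have L'_used: "q \<in> L' \<longleftrightarrow> q \<in> L" if "q \<in> used" for q using that newp(1) by (auto simp: L'_def)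
  have cs_K: "fst (F :: ('a, 'k) atom) \<in> K \<and> wf_atom sg F" if "F \<in> cata_atom ` set cs" for F
    using that
  proof (rule imageE)
    fix G assume "F = cata_atom G" "G \<in> set cs"
    then show ?thesis
      using cs[of G] cata_pred_sorted[of K G] wf_cata_atom[of K G sg] wf_catom_sorted by blast
  qed
  have bodyD: "set (body D) = insert ?A (cata_atom ` set cs)" by (simp add: D)
  have body_vars: "atom_vars F \<subseteq> set Xs" if "F \<in> set (body D)" for F
  proof -
    have "atom_vars (cata_atom G :: ('a, 'k) atom) \<subseteq> catom_vars cs" if "G \<in> set cs" for G
      using that unfolding atom_vars_cata_atom catom_vars_def by blast
    moreover have "atom_vars ?A = set zs" by (auto simp: atom_vars_def)
    ultimately show ?thesis using that unfolding bodyD Xs by blast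
  qed
  have body_cong: "eval_atom \<sigma> F = eval_atom \<tau> F"
    if "map \<sigma> Xs = map \<tau> Xs" "F \<in> set (body D)" for \<sigma> \<tau> :: "'a var \<Rightarrow> 'k val" and F
  proof (rule eval_atom_cong)
    fix x assume "x \<in> atom_vars F"
    then have "x \<in> set Xs" using body_vars[OF that(2)] by blast
    then show "\<sigma> x = \<tau> x" using that(1) by simp
  qed
  have body_used: "fst F \<in> used" if "F \<in> set (body D)" for F
  proof (cases "F = ?A")
    case False
    then have "fst F \<in> K" using that cs_K unfolding bodyD by blast
    then show ?thesis using used(1) by blast
  qed (use p(1) in simp)
  \<comment> \<open>A catamorphism atom needs an ADT variable among \<open>zs\<close>, but
    predicates of \<open>L\<close> take arguments of basic sort only.\<close>
  have low: "cs = []" if "p \<in> L"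
  proof (rule ccontr)
    assume "cs \<noteq> []"
    then obtain F where F: "F \<in> set cs" by (meson last_in_set)
    then have "\<not> basic (snd (cata_adt F))" using cs[OF F] wf_catom_adt by blast
    moreover have "snd (cata_adt F) \<in> set (snd p)" using cs[OF F] p(3) by simp
    ultimately show False using L_basic[OF that] by blast
  qed
  have w_D: "w' (newp, map \<sigma> Xs) = Suc (w (eval_atom \<sigma> ?A))" for \<sigma>
  proof -
    have "map (SOME \<tau>. map \<tau> Xs = map \<sigma> Xs) Xs = map \<sigma> Xs" by (rule someI[of "\<lambda>\<tau>. map \<tau> Xs = map \<sigma> Xs" \<sigma>]) (rule refl)
    then have "eval_atom (SOME \<tau>. map \<tau> Xs = map \<sigma> Xs) ?A = eval_atom \<sigma> ?A"
      by (rule body_cong) (simp add: bodyD)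
    then show ?thesis by (simp add: w'_def)
  qed
  have head_D: "eval_atom \<sigma> (newp, map Var Xs) = (newp, map \<sigma> Xs)" for \<sigma> :: "'a var \<Rightarrow> 'k val"
    by (simp add: eval_atom_def comp_def)
  have iff_D: "(newp, map \<sigma> Xs) \<in> M' \<longleftrightarrow> (\<forall>F\<in>set (body D). eval_atom \<sigma> F \<in> M')"
    if \<sigma>: "valuation sg \<sigma>" for \<sigma>
  proof
    assume "(newp, map \<sigma> Xs) \<in> M'"
    moreover have "(newp, map \<sigma> Xs) \<notin> M" using M_used newp(1) by fastforce
    ultimately obtain \<tau> where \<tau>: "map \<sigma> Xs = map \<tau> Xs" "\<forall>F\<in>set (body D). eval_atom \<tau> F \<in> M"
      by (auto simp: M'_def N_def simp del: map_eq_conv)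
    show "\<forall>F\<in>set (body D). eval_atom \<sigma> F \<in> M'"
    proof
      fix F assume F: "F \<in> set (body D)"
      then show "eval_atom \<sigma> F \<in> M'" using \<tau>(2) body_cong[OF \<tau>(1) F] by (simp add: M'_def)
    qed
  next
    assume body: "\<forall>F\<in>set (body D). eval_atom \<sigma> F \<in> M'"
    have "eval_atom \<sigma> F \<in> M" if "F \<in> set (body D)" for F
      using body that M'_used[of "eval_atom \<sigma> F"] body_used[OF that] by simp
    then show "(newp, map \<sigma> Xs) \<in> M'" using \<sigma> by (auto simp: M'_def N_def)
  qed
  have fires_S: "fires sg M' C \<sigma> \<longleftrightarrow> fires sg M C \<sigma>" if "C \<in> S" for C \<sigma>
    using S_preds[OF that] M'_used by (intro fires_cong_interp) blast
  have holds_S: "holds sg M' C \<longleftrightarrow> holds sg M C" if "C \<in> S" for C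
    using S_preds[OF that] M'_used by (intro holds_cong_interp) blast
  have holds_D: "holds sg M' D"
    unfolding holds_fires
  proof (intro allI impI)
    fix \<sigma> assume f: "fires sg M' D \<sigma>"
    have "eval_atom \<sigma> (newp, map Var Xs) \<in> M'"
      unfolding head_D using iff_D f by (simp add: fires_def)
    then show "\<exists>H. head D = Some H \<and> eval_atom \<sigma> H \<in> M'" by (simp add: D)
  qed
  have D_S: "D \<notin> S"
    using S_preds[of D newp] newp(1) by (auto simp: D clause_preds_def clause_atoms_def)
  have st: "state sg K Ax P Q Spec (used \<union> preds S') S' Defs' Fld' M' L' w' B"
  proof unfold_locales
    have preds_S': "preds S' = clause_preds D \<union> preds S" by (simp add: S' preds_def)
    show "K \<union> Ax \<subseteq> used \<union> preds S'" using used(1) by blast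
    show "L' \<subseteq> used \<union> preds S'"
      using used(2) by (auto simp: L'_def preds_S' clause_preds_def clause_atoms_def D)
    show "preds S' \<subseteq> used \<union> preds S'" by blast
    show "preds Defs' \<subseteq> used \<union> preds S'"
    proof -
      have "preds Defs' = clause_preds D \<union> preds Defs" by (simp add: Defs' preds_def)
      then show ?thesis using used(4) preds_S' by blast
    qed
    show "L' \<inter> (K \<union> Ax) = {}" using L_KA np by (auto simp: L'_def)
    show "basic s" if q: "q \<in> L'" "s \<in> set (snd q)" for q s
    proof (cases "q = newp")
      case True
      then have "p \<in> L" using q(1) np(2) by (auto simp: L'_def split: if_splits)
      then have "set Xs = set zs" using low Xs by (simp add: catom_vars_def)
      then have "s \<in> set (snd p)" using q(2) True newp(2) p(3) by simp
      then show ?thesis using L_basic[OF \<open>p \<in> L\<close>] by blast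
    next
      case False
      then show ?thesis using q L_basic by (auto simp: L'_def split: if_splits)
    qed
    show "wf_clause sg C" if "C \<in> S'" for C
    proof (cases "C = D")
      case True
      have "wf_atom sg (newp, map Var Xs)" "wf_atom sg ?A"
        using newp(2) p(3) by (simp_all add: wf_atom_def)
      then show ?thesis using cs_K True by (simp add: wf_clause_def clause_atoms_def D)
    qed (use that wf S' in blast)
    show "cata_head q ts" if "C \<in> S'" "head C = Some (q, ts)" "q \<in> K" for C q ts
    proof (cases "C = D")
      case True
      then show ?thesis using that np(1) by (simp add: D)
    qed (use that cata_heads S' in blast)
    show "fst F \<in> K \<union> Ax \<union> L'"
      if C: "C \<in> S'" "head C = Some H" "fst H \<in> K \<union> Ax" "F \<in> set (body C)" for C H F
    proof (cases "C = D")
      case True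
      then show ?thesis using C(2,3) np(1) by (auto simp: D)
    next
      case False
      then have "fst F \<in> K \<union> Ax \<union> L" using KA_body[OF _ C(2-4)] C(1) S' by blast
      then show ?thesis by (auto simp: L'_def)
    qed
    show "fst F \<in> L'" if C: "C \<in> S'" "head C = Some H" "fst H \<in> L'" "F \<in> set (body C)" for C H F
    proof (cases "C = D")
      case True
      then have "p \<in> L" using C(2,3) np(2) by (auto simp: D L'_def split: if_splits)
      then show ?thesis using True C(4) low by (simp add: bodyD L'_def)
    next
      case False
      then have "C \<in> S" using C(1) S' by blast
      moreover have "fst H \<in> used"
        using S_preds[OF \<open>C \<in> S\<close> clause_predsI, of H] C(2) by (simp add: clause_atoms_def)
      then have "fst H \<in> L" using L'_used C(3) by blast
      ultimately have "fst F \<in> L" using L_body C(2,4) by blast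
      then show ?thesis by (simp add: L'_def)
    qed
    show "holds sg M' C" if "C \<in> S'" "head C \<noteq> None" for C
    proof (cases "C = D")
      case False
      then have "C \<in> S" using that S' by blast
      then show ?thesis using holds_S model that(2) by blast
    qed (use holds_D in simp)
    show "F \<in> M' \<longleftrightarrow> F \<in> least_model sg P" if "fst F \<in> K \<union> Ax" for F
      using M'_used[of F] KA_least[OF that] that used(1) by blast
    show "B \<subseteq> S'" using base(1) S' by blast
    show "B \<inter> Defs' = {}" using base(1,2) D_S Defs' by blast
    show "B \<inter> Fld' = {}" using base(3) Fld' by blast
    show "\<exists>H. head C = Some H \<and> fst H \<in> K \<union> Ax \<union> L'" if "C \<in> B" for C
      using base_head[OF that] by (auto simp: L'_def)
    show "F \<in> J" if "\<And>C. C \<in> B \<Longrightarrow> holds sg J C" "F \<in> M'" "fst F \<in> K \<union> Ax" for J F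
      using base_least[OF that(1) _ that(3)] M'_used[of F] that used(1) by blast
    show "Fld' \<subseteq> S'" using Fld_sub Fld' S' by blast
    show "\<exists>H. head C = Some H \<and> fst H \<notin> K \<union> Ax" if "C \<in> Fld'" for C
      using that Fld' Fld_head by blast
    show "\<exists>C\<in>S'. backed sg (K \<union> Ax) M' L' w' (if C \<in> Fld' then 1 else 0) C H"
      if H: "H \<in> M'" "fst H \<notin> K \<union> Ax" for H
    proof (cases "H \<in> M")
      case True
      obtain C \<sigma> where C: "C \<in> S" "derives sg M C \<sigma> H"
        and light: "\<And>F. F \<in> set (body C) \<Longrightarrow> lighter KA L w (if C \<in> Fld then 1 else 0) H (eval_atom \<sigma> F)"
        using support[OF True H(2)] unfolding backed_def by blast
      have "derives sg M' C \<sigma> H" using C fires_S unfolding derives_def by blast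
      moreover have "lighter KA L' w' (if C \<in> Fld' then 1 else 0) H (eval_atom \<sigma> F)"
        if F: "F \<in> set (body C)" for F
      proof -
        have "fst F \<in> used"
          using S_preds[OF C(1) clause_predsI, of F] F by (simp add: clause_atoms_def)
        then show ?thesis
          using light[OF F] w'_used L'_used M_used[OF True] by (simp add: lighter_def Fld')
      qed
      ultimately show ?thesis using C(1) S' unfolding backed_def by blast
    next
      case False
      then obtain \<sigma> where \<sigma>: "valuation sg \<sigma>" "H = (newp, map \<sigma> Xs)" "\<forall>F\<in>set (body D). eval_atom \<sigma> F \<in> M"
        using H(1) by (auto simp: M'_def N_def)
      have "derives sg M' D \<sigma> H"
        using \<sigma> head_D unfolding derives_def fires_def M'_def by (simp add: D)
      moreover have "lighter KA L' w' 0 H (eval_atom \<sigma> F)" if F: "F \<in> set (body D)" for F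
      proof (cases "F = ?A")
        case True
        then show ?thesis using w_D[of \<sigma>] w'_used[of "eval_atom \<sigma> F"] p(1) \<sigma>(2) by (simp add: lighter_def)
      next
        case False
        then show ?thesis using F cs_K unfolding bodyD by (auto simp: lighter_def)
      qed
      moreover have "D \<notin> Fld'" using D_S Fld_sub Fld' by blast
      ultimately show ?thesis using S' unfolding backed_def by auto
    qed
    show "is_definition K Ax L' D'" if "D' \<in> Defs'" for D'
    proof (cases "D' = D")
      case True
      have "newp \<in> L' \<longleftrightarrow> p \<in> L'" "p \<in> L' \<longrightarrow> cs = []" using np low by (auto simp: L'_def)
      then show ?thesis unfolding True is_definition_def
        using D np(1) newp(2) p cs by (intro exI[of _ newp] exI[of _ Xs] exI[of _ cs] exI[of _ p] exI[of _ zs]) simp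
    next
      case False
      then have "D' \<in> Defs" using that Defs' by blast
      then show ?thesis using defs L'_used Defs_preds by (blast intro: is_definition_level)
    qed
    fix D' and \<sigma> :: "'a var \<Rightarrow> 'k val" assume D': "D' \<in> Defs'" and \<sigma>: "valuation sg \<sigma>"
    have old: "fst (the (head D')) \<in> used" "fst (last (body D')) \<in> used"
      "\<And>F. F \<in> set (body D') \<Longrightarrow> fst F \<in> used" if "D' \<in> Defs"
      using is_definition_preds[OF defs[OF that]] Defs_preds[OF that] Defs_preds[OF that clause_predsI]
      by (simp_all add: clause_atoms_def)
    show "eval_atom \<sigma> (the (head D')) \<in> M' \<longleftrightarrow> (\<forall>F\<in>set (body D'). eval_atom \<sigma> F \<in> M')"
    proof (cases "D' = D")
      case True
      then show ?thesis using iff_D[OF \<sigma>] head_D by (simp add: D)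
    next
      case False
      then have d: "D' \<in> Defs" using D' Defs' by blast
      have "eval_atom \<sigma> (the (head D')) \<in> M' \<longleftrightarrow> eval_atom \<sigma> (the (head D')) \<in> M"
        using old(1)[OF d] by (intro M'_used) simp
      moreover have "eval_atom \<sigma> F \<in> M' \<longleftrightarrow> eval_atom \<sigma> F \<in> M" if "F \<in> set (body D')" for F
        using old(3)[OF d that] by (intro M'_used) simp
      ultimately show ?thesis using defs_iff[OF d \<sigma>] by simp
    qed
    show "w' (eval_atom \<sigma> (the (head D'))) \<le> Suc (w' (eval_atom \<sigma> (last (body D'))))"
    proof (cases "D' = D")
      case True
      then show ?thesis using w_D[of \<sigma>] head_D[of \<sigma>] w'_used[of "eval_atom \<sigma> ?A"] p(1) by (simp add: D)
    next
      case False
      then have d: "D' \<in> Defs" using D' Defs' by blast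
      then show ?thesis using defs_weight[OF d \<sigma>] old(1,2)[OF d] w'_used by simp
    qed
  qed
  have "(\<forall>C\<in>S. holds sg M C) \<longleftrightarrow> (\<forall>C\<in>S'. holds sg M' C)"
    using holds_S holds_D S' by blast
  then have "satisfiable sg S \<longleftrightarrow> satisfiable sg S'"
    unfolding satisfiable_iff state.satisfiable_iff[OF st] .
  then show ?thesis using st by blast
qed

end


section \<open>Erasure addition\<close>

definition erase_ground :: "('a pred \<Rightarrow> 'a pred) \<Rightarrow> 'a pred \<times> 'k val list \<Rightarrow> 'a pred \<times> 'k val list" where
  "erase_ground wo F =
     (wo (fst F), map fst (filter (\<lambda>(v, s). basic s) (zip (snd F) (snd (fst F)))))"

lemma fst_erase_ground [simp]: "fst (erase_ground wo F) = wo (fst F)"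
  by (simp add: erase_ground_def)

lemma fst_erase_atom [simp]: "fst (erase_atom wo F) = wo (fst F)"
  by (simp add: erase_atom_def)

lemma map_fst_filter_zip:
  "map f (map fst (filter (\<lambda>(t, s). R s) (zip ts ss))) =
    map fst (filter (\<lambda>(v, s). R s) (zip (map f ts) ss))"
  by (induction ts ss rule: list_induct2') auto

lemma eval_erase_atom: "eval_atom \<sigma> (erase_atom wo F) = erase_ground wo (eval_atom \<sigma> F)"
  unfolding eval_atom_def erase_atom_def erase_ground_def fst_conv snd_conv map_fst_filter_zip ..

lemma wf_erase_atom:
  assumes "wf_atom sg F" "snd (wo (fst F)) = filter basic (snd (fst F))"
  shows "wf_atom sg (erase_atom wo F)"
proof -
  have "map (trm_sort sg) ts = map Some ss \<Longrightarrow>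
    map (trm_sort sg) (map fst (filter (\<lambda>(t, s). basic s) (zip ts ss))) = map Some (filter basic ss)" for ts ss
    by (induction ts ss rule: list_induct2') auto
  then show ?thesis using assms by (simp add: wf_atom_def erase_atom_def)
qed

lemma erase_clause_sel [simp]:
  "head (erase_clause wo C) = map_option (erase_atom wo) (head C)"
  "cstr (erase_clause wo C) = cstr C"
  "body (erase_clause wo C) = map (erase_atom wo) (body C)"
  by (simp_all add: erase_clause_def)

lemma with_erasure_sel [simp]:
  "head (with_erasure wo C) = head C"
  "cstr (with_erasure wo C) = cstr C"
  "set (body (with_erasure wo C)) = set (body C) \<union> erase_atom wo ` set (body C)"
  by (auto simp: with_erasure_def)

lemma fires_erase_clause:
  "fires sg I (erase_clause wo C) \<sigma> \<longleftrightarrow> fires sg {F. erase_ground wo F \<in> I} C \<sigma>"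
  by (simp add: fires_def eval_erase_atom)

text \<open>Erasure commutes with evaluation, so an erased clause over \<open>I\<close> behaves as
  the original one over the preimage of \<open>I\<close>. Facts about erased clauses thus reduce to
  facts about models of the original clauses.\<close>

lemma holds_erase_clause:
  "holds sg I (erase_clause wo C) \<longleftrightarrow> holds sg {F. erase_ground wo F \<in> I} C"
  unfolding holds_fires fires_erase_clause by (cases "head C") (simp_all add: eval_erase_atom)

lemma fires_with_erasure:
  "fires sg I (with_erasure wo C) \<sigma> \<longleftrightarrow> fires sg {F \<in> I. erase_ground wo F \<in> I} C \<sigma>"
  unfolding fires_def with_erasure_sel ball_Un by (auto simp: eval_erase_atom)

context state
begin

text \<open>The erased clauses have a least model \<open>W\<close>, which can exceed the erasure of
  \<open>M\<close> because forgetting arguments makes more bodies true. Its preimage under erasure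
  is a model of the definite clauses and therefore includes \<open>M\<close>, so erased atoms added
  to a body never restrict it.\<close>

lemma R5_state:
  assumes "R5 used (S, Defs, Fld) (S', Defs', Fld')"
  shows "\<exists>M L w B. state sg K Ax P Q Spec (used \<union> preds S') S' Defs' Fld' M L w B \<and>
    (satisfiable sg S \<longleftrightarrow> satisfiable sg S')"
proof -
  obtain wo where inj: "inj_on wo (preds S)" and new: "wo ` preds S \<inter> used = {}"
    and sorts: "\<And>p. p \<in> preds S \<Longrightarrow> snd (wo p) = filter basic (snd p)"
    and S': "S' = with_erasure wo ` S \<union> erase_clause wo ` {C \<in> S. \<not> is_query C}"
    and Defs': "Defs' = Defs" and Fld': "Fld' = {}"
    using assms unfolding R5_def by (auto simp del: split_paired_All split_paired_Ex)
  define \<Pi> where "\<Pi> = erase_clause wo ` definite S"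
  have S'2: "S' = with_erasure wo ` S \<union> \<Pi>"
    unfolding S' \<Pi>_def definite_def is_query_def by simp
  define W where "W = least_model sg \<Pi>"
  \<comment> \<open>The erased copies of \<open>KA\<close> and \<open>L\<close> are what the clauses
    of \<open>KA\<close> and \<open>L\<close> now newly depend on.\<close>
  define L' where "L' = L \<union> wo ` (preds S \<inter> (KA \<union> L))"
  \<comment> \<open>Counting inside a level only, as \<open>lighter\<close> does, keeps ranks
    comparable with the old weights, which ignore catamorphism atoms.\<close>
  define same where "same p q \<longleftrightarrow> (p \<in> L' \<longleftrightarrow> q \<in> L')" for p q
  define rk where "rk F = (LEAST n. rank sg \<Pi> W same F n)" for F
  define w' where "w' F = (if fst F \<in> used then w F else rk F)" for F
  define M' where "M' = M \<union> W"
  define B' where "B' = with_erasure wo ` B \<union> erase_clause wo ` B"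
  let ?er = "erase_ground wo :: 'a pred \<times> 'k val list \<Rightarrow> _"
  have new': "wo p \<notin> used" if "p \<in> preds S" for p using new that by blast
  have atom_preds: "fst F \<in> preds S" if "C \<in> S" "F \<in> clause_atoms C" for C F
    using that clause_predsI[of F C] by (auto simp: preds_def)
  have head_preds: "fst H \<in> preds S" if "C \<in> S" "head C = Some H" for C H
    using atom_preds[OF that(1)] that(2) by (simp add: clause_atoms_def)
  have body_preds: "fst F \<in> preds S" if "C \<in> S" "F \<in> set (body C)" for C F
    using atom_preds[OF that(1)] that(2) by (simp add: clause_atoms_def)
  have definite_head: "head E \<noteq> None" if "E \<in> \<Pi>" for E
    using that by (auto simp: \<Pi>_def definite_def)
  have W_preds: "fst F \<in> wo ` preds S" if "F \<in> W" for F
  proof -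
    have "W \<subseteq> {F. fst F \<in> wo ` preds S}" unfolding W_def
    proof (rule least_model_subset)
      fix E assume "E \<in> \<Pi>"
      then obtain C where "C \<in> S" "head C \<noteq> None" "E = erase_clause wo C"
        by (auto simp: \<Pi>_def definite_def)
      then show "holds sg {F. fst F \<in> wo ` preds S} E"
        using head_preds[of C] by (auto simp: holds_fires)
    qed
    then show ?thesis using that by blast
  qed
  have W_used: "fst F \<notin> used" if "F \<in> W" for F using W_preds[OF that] new by blast
  have M_used: "fst F \<in> used" if "F \<in> M" for F using M_preds[OF that] used(3) by blast
  have M'_used: "F \<in> M' \<longleftrightarrow> F \<in> M" if "fst F \<in> used" for F
    using W_used[of F] that by (auto simp: M'_def)
  have M'_new: "F \<in> M' \<longleftrightarrow> F \<in> W" if "fst F \<notin> used" for F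
    using M_used[of F] that by (auto simp: M'_def)
  have L'_used: "p \<in> L' \<longleftrightarrow> p \<in> L" if "p \<in> used" for p using that new by (auto simp: L'_def)
  have L'_new: "wo p \<in> L' \<longleftrightarrow> p \<in> KA \<union> L" if "p \<in> preds S" for p
  proof
    assume "wo p \<in> L'"
    moreover have "wo p \<notin> L" using new'[OF that] used(2) by blast
    ultimately obtain q where "q \<in> preds S" "q \<in> KA \<union> L" "wo p = wo q" by (auto simp: L'_def)
    then show "p \<in> KA \<union> L" using inj that by (auto dest: inj_onD)
  qed (use that in \<open>auto simp: L'_def\<close>)
  have holds_W: "holds sg W E" if "E \<in> \<Pi>" for E
    unfolding W_def using that definite_head[OF that] by (rule holds_least_model)
  have erase_M: "?er F \<in> W" if "F \<in> M" for F
  proof -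
    have "M \<subseteq> {F. ?er F \<in> W}"
    proof (rule least)
      fix C assume "C \<in> definite S"
      then have "holds sg W (erase_clause wo C)" by (intro holds_W) (simp add: \<Pi>_def)
      then show "holds sg {F. ?er F \<in> W} C" unfolding holds_erase_clause .
    qed
    then show ?thesis using that by blast
  qed
  \<comment> \<open>On the predicates of \<open>S\<close>, demanding the erased atom as well changes
    nothing; so a clause and its extension fire together.\<close>
  have both: "F \<in> {F \<in> M'. ?er F \<in> M'} \<longleftrightarrow> F \<in> M" if "fst F \<in> preds S" for F
    using M'_used[of F] M'_new[of "?er F"] new'[OF that] that used(3) erase_M[of F] by auto
  have clause_in: "p \<in> preds S" if "C \<in> S" "p \<in> clause_preds C" for C p
    using that by (auto simp: preds_def)
  have fires_w: "fires sg M' (with_erasure wo C) \<sigma> \<longleftrightarrow> fires sg M C \<sigma>" if "C \<in> S" for C \<sigma>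
    unfolding fires_with_erasure by (rule fires_cong_interp, rule both) (rule clause_in[OF that])
  have holds_w: "holds sg M' (with_erasure wo C) \<longleftrightarrow> holds sg M C" if C: "C \<in> S" for C
  proof -
    have "eval_atom \<sigma> H \<in> M' \<longleftrightarrow> eval_atom \<sigma> H \<in> M" if "head C = Some H" for \<sigma> H
      using head_preds[OF C that] used(3) by (intro M'_used) auto
    then have "(\<exists>H. head C = Some H \<and> eval_atom \<sigma> H \<in> M') \<longleftrightarrow>
      (\<exists>H. head C = Some H \<and> eval_atom \<sigma> H \<in> M)" for \<sigma>
      by (cases "head C") simp_all
    then show ?thesis unfolding holds_fires fires_w[OF C] by simp
  qed
  have \<Pi>_preds: "p \<in> wo ` preds S" if E: "E \<in> \<Pi>" "p \<in> clause_preds E" for E p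
  proof -
    obtain C where C: "C \<in> S" "E = erase_clause wo C" using E(1) by (auto simp: \<Pi>_def definite_def)
    have "clause_atoms E = erase_atom wo ` clause_atoms C"
      by (simp add: clause_atoms_def C(2) option.set_map image_Un)
    then have "clause_preds E = wo ` clause_preds C"
      by (simp add: clause_preds_def image_image)
    then show ?thesis using E(2) clause_in[OF C(1)] by auto
  qed
  have holds_e: "holds sg M' E" if "E \<in> \<Pi>" for E
  proof -
    have "holds sg M' E \<longleftrightarrow> holds sg W E"
    proof (rule holds_cong_interp)
      fix F :: "'a pred \<times> 'k val list" assume "fst F \<in> clause_preds E"
      then have "fst F \<notin> used" using \<Pi>_preds[OF that] new by blast
      then show "F \<in> M' \<longleftrightarrow> F \<in> W" by (rule M'_new)
    qed
    then show ?thesis using holds_W[OF that] by simp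
  qed
  \<comment> \<open>Induction along the support of \<open>A\<close>: the erased instance derives the
    erased atom, and its body atoms of the same level are bounded by the old weights. This bound
    keeps a clause supported when erased atoms join its body.\<close>
  have rk_le: "rk (?er A) \<le> w A" if "A \<in> M" "fst A \<notin> KA" for A
  proof -
    have "rank sg \<Pi> W same (?er A) (w A)" using that
    proof (induction "w A" arbitrary: A rule: less_induct)
      case less
      obtain C \<sigma> where C: "C \<in> S" "derives sg M C \<sigma> A"
        and light: "\<And>F. F \<in> set (body C) \<Longrightarrow> lighter KA L w 0 A (eval_atom \<sigma> F)"
        by (rule supportE[OF less.prems]) blast
      obtain G where G: "head C = Some G" "A = eval_atom \<sigma> G" using C(2) by (auto simp: derives_def)
      have Cd: "C \<in> definite S" using C(1) G(1) by (simp add: definite_def)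
      have "fires sg {F. ?er F \<in> W} C \<sigma>"
        using C(2) erase_M by (auto simp: derives_def intro!: fires_mono[of sg M])
      then have d: "derives sg W (erase_clause wo C) \<sigma> (?er A)"
        unfolding derives_def fires_erase_clause using G by (simp add: eval_erase_atom)
      show ?case
      proof (rule rankI[OF _ d])
        show "erase_clause wo C \<in> \<Pi>" using Cd by (simp add: \<Pi>_def)
        fix E assume "E \<in> set (body (erase_clause wo C))" and s: "same (fst E) (fst (?er A))"
        then obtain F where F: "F \<in> set (body C)" "E = erase_atom wo F" by auto
        \<comment> \<open>Erasure merges \<open>KA\<close> and \<open>L\<close> into one level.
          Since \<open>A\<close> is not in \<open>KA\<close>, and a head in \<open>L\<close> has
          only atoms of \<open>L\<close> in its body, equal levels after erasure mean that
          \<open>F\<close> and \<open>A\<close> were compared before.\<close>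
        have "fst F \<in> KA \<union> L \<longleftrightarrow> fst A \<in> KA \<union> L"
          using s L'_new[OF body_preds[OF C(1) F(1)]] L'_new[OF head_preds[OF C(1) G(1)]]
          by (simp add: same_def F(2) G(2))
        moreover have "fst F \<in> L" if "fst A \<in> L" using L_body[OF C(1) G(1) _ F(1)] that G(2) by simp
        ultimately have FL: "fst F \<in> L \<longleftrightarrow> fst A \<in> L" "fst F \<notin> KA"
          using less.prems(2) L_KA by blast+
        then have "w (eval_atom \<sigma> F) < w A" using light[OF F(1)] by (simp add: lighter_def)
        moreover have "eval_atom \<sigma> F \<in> M" using C(2) F(1) by (simp add: derives_def fires_def)
        ultimately have "rank sg \<Pi> W same (?er (eval_atom \<sigma> F)) (w (eval_atom \<sigma> F))"
          using FL(2) by (intro less.hyps) simp_all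
        then show "\<exists>m<w A. rank sg \<Pi> W same (eval_atom \<sigma> E) m"
          using \<open>w (eval_atom \<sigma> F) < w A\<close> by (auto simp: F(2) eval_erase_atom)
      qed
    qed
    then show ?thesis unfolding rk_def by (rule Least_le)
  qed
  have wo_preds: "wo p \<in> preds S'" if p: "p \<in> preds S" for p
  proof -
    obtain C F where C: "C \<in> S" "F \<in> clause_atoms C" "p = fst F"
      using p by (auto simp: preds_def clause_preds_def)
    have "\<exists>E\<in>S'. erase_atom wo F \<in> clause_atoms E"
    proof (cases "F \<in> set (body C)")
      case True
      then have "erase_atom wo F \<in> clause_atoms (with_erasure wo C)" by (simp add: clause_atoms_def)
      then show ?thesis using C(1) S' by blast
    next
      case False
      then have "head C = Some F" using C(2) by (simp add: clause_atoms_def)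
      then have "erase_atom wo F \<in> clause_atoms (erase_clause wo C)" "\<not> is_query C"
        by (simp_all add: clause_atoms_def is_query_def)
      then show ?thesis using C(1) S' by blast
    qed
    then obtain E where "E \<in> S'" "erase_atom wo F \<in> clause_atoms E" by blast
    then have "E \<in> S'" "wo p \<in> clause_preds E"
      using clause_predsI[of "erase_atom wo F" E] by (simp_all add: C(3))
    then show ?thesis by (auto simp: preds_def)
  qed
  have B_S: "C \<in> S \<and> (\<exists>H. head C = Some H \<and> fst H \<in> KA \<union> L \<and> fst H \<in> preds S)" if "C \<in> B" for C
    using base_head[OF that] base(1) that head_preds by blast
  have B'_cases: thesis if "E \<in> B'" "\<And>C. C \<in> B \<Longrightarrow> E = with_erasure wo C \<Longrightarrow> thesis"
    "\<And>C. C \<in> B \<Longrightarrow> E = erase_clause wo C \<Longrightarrow> thesis" for E thesis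
    using that unfolding B'_def by blast
  have S'_cases: thesis if "E \<in> S'" "\<And>C. C \<in> S \<Longrightarrow> E = with_erasure wo C \<Longrightarrow> thesis"
    "\<And>C H. C \<in> S \<Longrightarrow> head C = Some H \<Longrightarrow> E = erase_clause wo C \<Longrightarrow> thesis" for E thesis
    using that unfolding S'2 \<Pi>_def definite_def by blast
  have st: "state sg K Ax P Q Spec (used \<union> preds S') S' Defs' Fld' M' L' w' B'"
  proof unfold_locales
    show "K \<union> Ax \<subseteq> used \<union> preds S'" using used(1) by blast
    show "L' \<subseteq> used \<union> preds S'" using used(2) wo_preds by (auto simp: L'_def)
    show "preds S' \<subseteq> used \<union> preds S'" by blast
    show "preds Defs' \<subseteq> used \<union> preds S'" using used(4) Defs' by blast
    show "L' \<inter> (K \<union> Ax) = {}" using L_KA new used(1) unfolding L'_def by blast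
    show "basic s" if "p \<in> L'" "s \<in> set (snd p)" for p s
    proof (cases "p \<in> L")
      case False
      then have "p \<in> wo ` preds S" using that(1) by (auto simp: L'_def)
      then obtain q where "q \<in> preds S" "p = wo q" by blast
      then show ?thesis using sorts[of q] that(2) by simp
    qed (use that L_basic in blast)
    show "wf_clause sg E" if "E \<in> S'" for E
      using that
    proof (rule S'_cases)
      have er: "wf_atom sg (erase_atom wo F)" if "C \<in> S" "F \<in> clause_atoms C" for C F
        using wf[OF that(1)] that sorts[OF atom_preds[OF that]]
        by (intro wf_erase_atom) (simp_all add: wf_clause_def)
      show ?thesis if "C \<in> S" "E = with_erasure wo C" for C
        using wf[OF that(1)] er[OF that(1)] by (auto simp: that(2) wf_clause_def clause_atoms_def)
      show ?thesis if "C \<in> S" "E = erase_clause wo C" for C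
        using wf[OF that(1)] er[OF that(1)]
        by (auto simp: that(2) wf_clause_def clause_atoms_def option.set_map)
    qed
    show "cata_head q ts" if E: "E \<in> S'" "head E = Some (q, ts)" "q \<in> K" for E q ts
      using E(1)
    proof (rule S'_cases)
      show ?thesis if "C \<in> S" "E = with_erasure wo C" for C
        using cata_heads[OF that(1)] that(2) E(2,3) by simp
      show ?thesis if "C \<in> S" "head C = Some H" "E = erase_clause wo C" for C H
      proof -
        have "q = wo (fst H)" using that(2,3) E(2) by (auto simp: erase_atom_def)
        then show ?thesis using new'[OF head_preds[OF that(1,2)]] E(3) used(1) by blast
      qed
    qed
    show "fst F \<in> K \<union> Ax \<union> L'"
      if E: "E \<in> S'" "head E = Some H" "fst H \<in> K \<union> Ax" "F \<in> set (body E)" for E H F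
      using E(1)
    proof (rule S'_cases)
      show ?thesis if C: "C \<in> S" "E = with_erasure wo C" for C
      proof -
        have "F \<in> set (body C) \<union> erase_atom wo ` set (body C)" using E(4) C(2) by simp
        then obtain G where G: "G \<in> set (body C)" "F = G \<or> F = erase_atom wo G" by blast
        have "fst G \<in> KA \<union> L" using KA_body[OF C(1) _ E(3) G(1)] E(2) C(2) by simp
        then show ?thesis using G(2) L'_new[OF body_preds[OF C(1) G(1)]] by (auto simp: L'_def)
      qed
      show ?thesis if C: "C \<in> S" "head C = Some G" "E = erase_clause wo C" for C G
      proof -
        have "fst H = wo (fst G)" using C(2,3) E(2) by auto
        then show ?thesis using new'[OF head_preds[OF C(1,2)]] E(3) used(1) by auto
      qed
    qed
    show "fst F \<in> L'"
      if E: "E \<in> S'" "head E = Some H" "fst H \<in> L'" "F \<in> set (body E)" for E H F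
      using E(1)
    proof (rule S'_cases)
      show ?thesis if C: "C \<in> S" "E = with_erasure wo C" for C
      proof -
        have "F \<in> set (body C) \<union> erase_atom wo ` set (body C)" using E(4) C(2) by simp
        then obtain G where G: "G \<in> set (body C)" "F = G \<or> F = erase_atom wo G" by blast
        have h: "head C = Some H" using E(2) C(2) by simp
        then have "fst H \<in> L" using L'_used head_preds[OF C(1)] E(3) used(3) by blast
        then have "fst G \<in> L" using L_body[OF C(1) h _ G(1)] by blast
        then show ?thesis using G(2) L'_new[OF body_preds[OF C(1) G(1)]] by (auto simp: L'_def)
      qed
      show ?thesis if C: "C \<in> S" "head C = Some G" "E = erase_clause wo C" for C G
      proof -
        have "F \<in> erase_atom wo ` set (body C)" using E(4) C(3) by simp
        then obtain F' where F': "F' \<in> set (body C)" "F = erase_atom wo F'" by blast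
        have "fst H = wo (fst G)" using C(2,3) E(2) by auto
        then have "fst G \<in> KA \<union> L" using L'_new[OF head_preds[OF C(1,2)]] E(3) by simp
        then have "fst F' \<in> KA \<union> L" using KA_body[OF C(1,2) _ F'(1)] L_body[OF C(1,2) _ F'(1)] by blast
        then show ?thesis using L'_new[OF body_preds[OF C(1) F'(1)]] F'(2) by simp
      qed
    qed
    show "holds sg M' E" if E: "E \<in> S'" "head E \<noteq> None" for E
    proof (cases "E \<in> \<Pi>")
      case False
      then obtain C where "C \<in> S" "E = with_erasure wo C" using E(1) S'2 by blast
      then show ?thesis using holds_w model E(2) by simp
    qed (rule holds_e)
    show "F \<in> M' \<longleftrightarrow> F \<in> least_model sg P" if "fst F \<in> K \<union> Ax" for F
      using M'_used[of F] KA_least[OF that] that used(1) by blast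
    show "B' \<subseteq> S'"
    proof
      fix E assume "E \<in> B'"
      then show "E \<in> S'"
      proof (rule B'_cases)
        show ?thesis if "C \<in> B" "E = with_erasure wo C" for C
          using B_S[OF that(1)] that(2) S' by blast
        show ?thesis if "C \<in> B" "E = erase_clause wo C" for C
        proof -
          have "C \<in> definite S" using B_S[OF that(1)] by (auto simp: definite_def)
          then show ?thesis using that(2) S'2 by (simp add: \<Pi>_def)
        qed
      qed
    qed
    \<comment> \<open>Definitions have nonempty bodies and mention only old symbols, whereas a new
      symbol occurs in every erased clause and in every extended clause with a nonempty
      body.\<close>
    show "B' \<inter> Defs' = {}"
    proof (rule ccontr)
      assume "B' \<inter> Defs' \<noteq> {}"
      then obtain E where E: "E \<in> B'" "E \<in> Defs" using Defs' by blast
      have "F \<in> clause_atoms E \<Longrightarrow> fst F \<in> used" for F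
        using Defs_preds[OF E(2) clause_predsI] .
      from E(1) show False
      proof (rule B'_cases)
        fix C assume C: "C \<in> B" "E = with_erasure wo C"
        have "last (body E) \<in> set (body E)"
          using defs[OF E(2)] by (auto simp: is_definition_def)
        then have "set (body C) \<noteq> {}" using C(2) by auto
        then obtain G where G: "G \<in> set (body C)" unfolding ex_in_conv[symmetric] by (rule exE)
        then have "erase_atom wo G \<in> clause_atoms E" by (simp add: C(2) clause_atoms_def)
        then have "wo (fst G) \<in> used" using \<open>\<And>F. F \<in> clause_atoms E \<Longrightarrow> fst F \<in> used\<close> by fastforce
        then show False using new'[OF body_preds[OF _ G]] B_S[OF C(1)] by blast
      next
        fix C assume C: "C \<in> B" "E = erase_clause wo C"
        obtain H where H: "head C = Some H" "fst H \<in> preds S" using B_S[OF C(1)] by blast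
        then have "erase_atom wo H \<in> clause_atoms E" by (simp add: C(2) clause_atoms_def)
        then have "wo (fst H) \<in> used" using \<open>\<And>F. F \<in> clause_atoms E \<Longrightarrow> fst F \<in> used\<close> by fastforce
        then show False using new'[OF H(2)] by blast
      qed
    qed
    show "B' \<inter> Fld' = {}" "Fld' \<subseteq> S'" using Fld' by simp_all
    show "\<exists>H. head E = Some H \<and> fst H \<in> K \<union> Ax \<union> L'" if "E \<in> B'" for E
      using that
    proof (rule B'_cases)
      show ?thesis if C: "C \<in> B" "E = with_erasure wo C" for C
        using B_S[OF C(1)] C(2) by (auto simp: L'_def)
      show ?thesis if C: "C \<in> B" "E = erase_clause wo C" for C
      proof -
        obtain H where "head C = Some H" "fst H \<in> KA \<union> L" "fst H \<in> preds S" using B_S[OF C(1)] by blast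
        then show ?thesis using L'_new[of "fst H"] C(2) by simp
      qed
    qed
    show "F \<in> J" if J: "\<And>E. E \<in> B' \<Longrightarrow> holds sg J E" and F: "F \<in> M'" "fst F \<in> K \<union> Ax" for J F
    proof -
      \<comment> \<open>The atoms of \<open>J\<close> whose erasure is in \<open>J\<close> too
        satisfy the old \<open>B\<close>: the extended clause yields the head and the erased clause
        its erasure. This is why \<open>B'\<close> contains both versions.\<close>
      have "F \<in> {F \<in> J. ?er F \<in> J}"
      proof (rule base_least)
        show "F \<in> M" "fst F \<in> K \<union> Ax" using F M'_used[of F] used(1) by blast+
        fix C assume C: "C \<in> B"
        have 1: "holds sg J (with_erasure wo C)" and 2: "holds sg J (erase_clause wo C)"
          using J C by (auto simp: B'_def)
        obtain H where H: "head C = Some H" using B_S[OF C] by blast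
        show "holds sg {F \<in> J. ?er F \<in> J} C"
          unfolding holds_fires
        proof (intro allI impI)
          fix \<sigma> assume f: "fires sg {F \<in> J. ?er F \<in> J} C \<sigma>"
          then have "eval_atom \<sigma> H \<in> J"
            using 1 H by (simp add: holds_fires fires_with_erasure)
          moreover have "fires sg {F. ?er F \<in> J} C \<sigma>" using f by (rule fires_mono) blast
          then have "?er (eval_atom \<sigma> H) \<in> J"
            using 2 H by (simp add: holds_fires fires_erase_clause eval_erase_atom)
          ultimately show "\<exists>H. head C = Some H \<and> eval_atom \<sigma> H \<in> {F \<in> J. ?er F \<in> J}" using H by simp
        qed
      qed
      then show ?thesis by blast
    qed
    show "\<exists>H. head E = Some H \<and> fst H \<notin> K \<union> Ax" if "E \<in> Fld'" for E using that Fld' by simp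
    show "\<exists>E\<in>S'. backed sg (K \<union> Ax) M' L' w' (if E \<in> Fld' then 1 else 0) E H"
      if H: "H \<in> M'" "fst H \<notin> K \<union> Ax" for H
    proof (cases "H \<in> M")
      case True
      obtain C \<sigma> where C: "C \<in> S" "derives sg M C \<sigma> H"
        and light: "\<And>F. F \<in> set (body C) \<Longrightarrow> lighter KA L w 0 H (eval_atom \<sigma> F)"
        by (rule supportE[OF True H(2)]) blast
      obtain G where G: "head C = Some G" "H = eval_atom \<sigma> G" using C(2) by (auto simp: derives_def)
      have "derives sg M' (with_erasure wo C) \<sigma> H"
        using C fires_w unfolding derives_def by simp
      moreover have "lighter KA L' w' 0 H (eval_atom \<sigma> E)" if E: "E \<in> set (body (with_erasure wo C))" for E
      proof -
        have "E \<in> set (body C) \<union> erase_atom wo ` set (body C)" using E by simp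
        then obtain F where F: "F \<in> set (body C)" "E = F \<or> E = erase_atom wo F" by blast
        have pF: "fst F \<in> preds S" by (rule body_preds[OF C(1) F(1)])
        have FM: "eval_atom \<sigma> F \<in> M" using C(2) F(1) by (simp add: derives_def fires_def)
        have HL: "fst H \<in> L' \<longleftrightarrow> fst H \<in> L" and wH: "w' H = w H"
          using L'_used M_used[OF True] by (simp_all add: w'_def)
        from F(2) show ?thesis
        proof
          assume "E = F"
          then show ?thesis
            using light[OF F(1)] HL wH L'_used[of "fst F"] pF used(3) by (auto simp: lighter_def w'_def)
        next
          assume E: "E = erase_atom wo F"
          show ?thesis
            unfolding lighter_def
          proof
            \<comment> \<open>The case distinction of \<open>rk_le\<close> again shows that
              \<open>F\<close> itself was lighter than \<open>H\<close>, and the rank of its erasure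
              does not exceed the weight of \<open>F\<close>.\<close>
            assume "fst (eval_atom \<sigma> E) \<notin> KA \<and> (fst (eval_atom \<sigma> E) \<in> L' \<longleftrightarrow> fst H \<in> L')"
            then have "fst F \<in> KA \<union> L \<longleftrightarrow> fst H \<in> L" using L'_new[OF pF] HL by (simp add: E)
            moreover have "fst F \<in> L" if "fst H \<in> L" using L_body[OF C(1) G(1) _ F(1)] that G(2) by simp
            ultimately have FL: "fst F \<notin> KA" "fst F \<in> L \<longleftrightarrow> fst H \<in> L" using L_KA by blast+
            then have "w (eval_atom \<sigma> F) < w H" using light[OF F(1)] by (simp add: lighter_def)
            moreover have "rk (?er (eval_atom \<sigma> F)) \<le> w (eval_atom \<sigma> F)"
              using FM FL(1) by (intro rk_le) simp_all
            moreover have "w' (eval_atom \<sigma> E) = rk (?er (eval_atom \<sigma> F))"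
              using new'[OF pF] by (simp add: E w'_def eval_erase_atom)
            ultimately show "w' (eval_atom \<sigma> E) + 0 < w' H" using wH by simp
          qed
        qed
      qed
      ultimately have "backed sg KA M' L' w' 0 (with_erasure wo C) H" unfolding backed_def by blast
      moreover have "with_erasure wo C \<in> S'" using C(1) S' by blast
      ultimately show ?thesis using Fld' by auto
    next
      case False
      then have HW: "H \<in> W" using H(1) by (simp add: M'_def)
      then obtain n where "rank sg \<Pi> W same H n"
        unfolding W_def using least_model_ranked[OF definite_head] by blast
      then obtain E \<sigma> where E: "E \<in> \<Pi>" "derives sg W E \<sigma> H"
        and light: "\<And>F. F \<in> set (body E) \<Longrightarrow> same (fst F) (fst H) \<Longrightarrow> rk (eval_atom \<sigma> F) < rk H"
        unfolding rk_def by (rule rank_Least) blast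
      have "derives sg M' E \<sigma> H"
        using E(2) unfolding derives_def by (auto simp: M'_def intro: fires_mono)
      moreover have "lighter KA L' w' 0 H (eval_atom \<sigma> F)" if F: "F \<in> set (body E)" for F
      proof -
        have "fst F \<in> wo ` preds S" using \<Pi>_preds[OF E(1) clause_predsI] F by (simp add: clause_atoms_def)
        then have "fst F \<notin> used" using new by blast
        then show ?thesis using light[OF F] W_used[OF HW] by (simp add: lighter_def w'_def same_def)
      qed
      ultimately have "backed sg KA M' L' w' 0 E H" unfolding backed_def by blast
      moreover have "E \<in> S'" using E(1) S'2 by blast
      ultimately show ?thesis using Fld' by auto
    qed
    show "is_definition K Ax L' D" if "D \<in> Defs'" for D
      using that defs L'_used Defs_preds unfolding Defs' by (blast intro: is_definition_level)
    fix D and \<sigma> :: "'a var \<Rightarrow> 'k val" assume "D \<in> Defs'" and \<sigma>: "valuation sg \<sigma>"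
    then have D: "D \<in> Defs" using Defs' by blast
    have old: "fst (the (head D)) \<in> used" "fst (last (body D)) \<in> used"
      "\<And>F. F \<in> set (body D) \<Longrightarrow> fst F \<in> used"
      using is_definition_preds[OF defs[OF D]] Defs_preds[OF D] Defs_preds[OF D clause_predsI]
      by (simp_all add: clause_atoms_def)
    have "eval_atom \<sigma> (the (head D)) \<in> M' \<longleftrightarrow> eval_atom \<sigma> (the (head D)) \<in> M"
      using old(1) by (intro M'_used) simp
    moreover have "eval_atom \<sigma> F \<in> M' \<longleftrightarrow> eval_atom \<sigma> F \<in> M" if "F \<in> set (body D)" for F
      using old(3)[OF that] by (intro M'_used) simp
    ultimately show "eval_atom \<sigma> (the (head D)) \<in> M' \<longleftrightarrow> (\<forall>F\<in>set (body D). eval_atom \<sigma> F \<in> M')"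
      using defs_iff[OF D \<sigma>] by simp
    show "w' (eval_atom \<sigma> (the (head D))) \<le> Suc (w' (eval_atom \<sigma> (last (body D))))"
      using defs_weight[OF D \<sigma>] old(1,2) by (simp add: w'_def)
  qed
  have "(\<forall>C\<in>S. holds sg M C) \<longleftrightarrow> (\<forall>E\<in>S'. holds sg M' E)"
    unfolding S'2 using holds_w holds_e by auto
  then have "satisfiable sg S \<longleftrightarrow> satisfiable sg S'"
    unfolding satisfiable_iff state.satisfiable_iff[OF st] .
  then show ?thesis using st by blast
qed

lemma step_state:
  assumes "step sg K Ax Spec used (S, Defs, Fld) (S', Defs', Fld')"
  shows "\<exists>M L w B. state sg K Ax P Q Spec (used \<union> preds S') S' Defs' Fld' M L w B \<and>
    (satisfiable sg S \<longleftrightarrow> satisfiable sg S')"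
proof -
  consider "R1 K Ax used (S, Defs, Fld) (S', Defs', Fld')" | "R2 sg K (S, Defs, Fld) (S', Defs', Fld')"
    | "R3 K Ax Spec (S, Defs, Fld) (S', Defs', Fld')" | "R4 K Ax (S, Defs, Fld) (S', Defs', Fld')"
    | "R5 used (S, Defs, Fld) (S', Defs', Fld')"
    using assms unfolding step_def by (elim disjE) simp_all
  then show ?thesis
  proof cases
    case 1
    then show ?thesis by (rule R1_state)
  next
    case 2
    show ?thesis by (intro exI) (rule R2_state[OF 2])
  next
    case 3
    show ?thesis by (intro exI) (rule R3_state[OF 3])
  next
    case 4
    show ?thesis by (intro exI) (rule R4_state[OF 4])
  next
    case 5
    then show ?thesis by (rule R5_state)
  qed
qed

end


section \<open>Transformation sequences\<close>

context initial_clauses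
begin

text \<open>Initially \<open>L\<close> is empty, the weights are least ranks that count program
  atoms only, and \<open>B\<close> is the set of clauses for \<open>KA\<close>, which depend on
  nothing else because no clause of \<open>P\<close> mixes the two kinds of predicates.\<close>

lemma initial_state:
  "\<exists>M w B. state sg K Ax P Q Spec (preds (P \<union> Q)) (P \<union> Q) {} {} M {} w B"
proof -
  let ?M = "least_model sg P"
  let ?B = "{C \<in> P. \<exists>H. head C = Some H \<and> fst H \<in> KA}"
  define same where "same p q \<longleftrightarrow> p \<notin> KA" for p q :: "'a pred"
  define w where "w F = (LEAST n. rank sg P ?M same F n)" for F
  have P: "head C \<noteq> None" if "C \<in> P" for C
    using initial that by (auto simp: initial_set_def is_query_def)
  have Q: "head C = None" if "C \<in> Q" for C
    using initial that by (auto simp: initial_set_def is_query_def)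
  have KA_P: "clause_preds C \<subseteq> KA" if "C \<in> P" "head C = Some H" "fst H \<in> KA" for C H
  proof -
    have "fst H \<in> clause_preds C" using that(2) by (simp add: clause_preds_def clause_atoms_def)
    moreover have "clause_preds C \<subseteq> KA \<or> clause_preds C \<inter> KA = {}"
      using initial that(1) by (simp add: initial_set_def)
    ultimately show ?thesis using that(3) by blast
  qed
  have KA_preds: "K \<union> Ax \<subseteq> preds P" using initial by (simp add: initial_set_def)
  have wf_PQ: "wf_clause sg C" if "C \<in> P \<union> Q" for C
    using initial that by (simp add: initial_set_def)
  have in_P: "C \<in> P" if "C \<in> P \<union> Q" "head C \<noteq> None" for C
    using that Q[of C] by auto
  have "state sg K Ax P Q Spec (preds (P \<union> Q)) (P \<union> Q) {} {} ?M {} w ?B"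
  proof unfold_locales
    show "K \<union> Ax \<subseteq> preds (P \<union> Q)" using KA_preds by (simp add: preds_def le_supI1)
    show "wf_clause sg C" if "C \<in> P \<union> Q" for C by (rule wf_PQ[OF that])
    show "cata_head q ts" if "C \<in> P \<union> Q" "head C = Some (q, ts)" "q \<in> K" for C q ts
    proof -
      have "C \<in> P" using in_P[OF that(1)] that(2) by simp
      then show ?thesis by (rule initial_cata_head[OF that(3) _ that(2)])
    qed
    show "fst F \<in> K \<union> Ax \<union> {}"
      if C: "C \<in> P \<union> Q" "head C = Some H" "fst H \<in> K \<union> Ax" "F \<in> set (body C)" for C H F
    proof -
      have "C \<in> P" using in_P[OF C(1)] C(2) by simp
      moreover have "fst F \<in> clause_preds C" using C(4) by (simp add: clause_preds_def clause_atoms_def)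
      ultimately show ?thesis using KA_P C(2,3) by blast
    qed
    show "holds sg ?M C" if "C \<in> P \<union> Q" "head C \<noteq> None" for C
      by (rule holds_least_model[OF in_P[OF that] that(2)])
    show "F \<in> J" if J: "\<And>C. C \<in> ?B \<Longrightarrow> holds sg J C" and F: "F \<in> ?M" "fst F \<in> K \<union> Ax" for J F
    proof -
      \<comment> \<open>With all program atoms made true, program clauses hold for free, and the
        clauses for \<open>KA\<close> do not notice the difference; so \<open>B\<close> alone
        determines \<open>KA\<close>.\<close>
      have "?M \<subseteq> J \<union> {F. fst F \<notin> KA}"
      proof (rule least_model_subset)
        fix C assume C: "C \<in> P"
        obtain H where H: "head C = Some H" using P[OF C] by blast
        show "holds sg (J \<union> {F. fst F \<notin> KA}) C"
        proof (cases "fst H \<in> KA")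
          case True
          have "holds sg (J \<union> {F. fst F \<notin> KA}) C \<longleftrightarrow> holds sg J C"
            using KA_P[OF C H True] by (intro holds_cong_interp) auto
          moreover have "holds sg J C" using C H True by (intro J) blast
          ultimately show ?thesis by simp
        next
          case False
          then show ?thesis using H by (simp add: holds_fires)
        qed
      qed
      then show ?thesis using F by blast
    qed
    show "\<exists>C\<in>P \<union> Q. backed sg (K \<union> Ax) ?M {} w (if C \<in> {} then 1 else 0) C H"
      if H: "H \<in> ?M" "fst H \<notin> K \<union> Ax" for H
    proof -
      obtain n where "rank sg P ?M same H n" using least_model_ranked[OF P H(1)] by blast
      then obtain C \<sigma> where C: "C \<in> P" "derives sg ?M C \<sigma> H"
        and light: "\<And>F. F \<in> set (body C) \<Longrightarrow> same (fst F) (fst H) \<Longrightarrow> w (eval_atom \<sigma> F) < w H"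
        unfolding w_def by (rule rank_Least) blast
      have "lighter KA {} w 0 H (eval_atom \<sigma> F)" if "F \<in> set (body C)" for F
        using light[OF that] by (simp add: lighter_def same_def)
      then have "backed sg KA ?M {} w 0 C H" using C(2) unfolding backed_def by blast
      then show ?thesis using C(1) by auto
    qed
  qed (auto simp: preds_def)
  then show ?thesis by blast
qed

text \<open>Model, weights, level and base may be different after each step, so only their existence
  is carried through the induction.\<close>

lemma sequence_state:
  assumes "S 0 = P \<union> Q" "Defs 0 = {}" "Fld 0 = {}"
    and "\<And>i. i < n \<Longrightarrow> step sg K Ax Spec (\<Union>j\<le>i. preds (S j))
      (S i, Defs i, Fld i) (S (Suc i), Defs (Suc i), Fld (Suc i))"
  shows "(\<exists>M L w B. state sg K Ax P Q Spec (\<Union>j\<le>n. preds (S j)) (S n) (Defs n) (Fld n) M L w B) \<and>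
    (satisfiable sg (S 0) \<longleftrightarrow> satisfiable sg (S n))"
  using assms(4)
proof (induction n)
  case 0
  then show ?case using initial_state assms(1-3) by auto
next
  case (Suc n)
  then obtain M L w B where
    st: "state sg K Ax P Q Spec (\<Union>j\<le>n. preds (S j)) (S n) (Defs n) (Fld n) M L w B"
    and sat: "satisfiable sg (S 0) \<longleftrightarrow> satisfiable sg (S n)"
    using less_SucI by blast
  have "(\<Union>j\<le>Suc n. preds (S j)) = (\<Union>j\<le>n. preds (S j)) \<union> preds (S (Suc n))"
    by (simp add: atMost_Suc Un_commute)
  then show ?case using state.step_state[OF st Suc.prems[of n]] sat by auto
qed

end

theorem theorem1:
  fixes sg :: "('a, 'k) adt_sig"
    and K Ax :: "'a pred set"
    and P Q :: "('a, 'k) clause set"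
    and Spec :: "'a cata_spec set"
    and S :: "nat \<Rightarrow> ('a, 'k) clause set"
    and n :: nat
  assumes "wf_sig sg"
    and "initial_set sg K Ax P Q"
    and "\<forall>sp\<in>Spec. wf_spec K Ax sp"
    and "S 0 = P \<union> Q"
    and "transformation_sequence sg K Ax Spec n S"
  shows "satisfiable sg (S 0) \<longleftrightarrow> satisfiable sg (S n)"
proof -
  interpret initial_clauses sg K Ax P Q Spec
    using assms(2,3) by unfold_locales blast+
  obtain Defs Fld where 0: "Defs 0 = {}" "Fld 0 = {}" and steps:
    "\<And>i. i < n \<Longrightarrow> step sg K Ax Spec (\<Union>j\<le>i. preds (S j))
      (S i, Defs i, Fld i) (S (Suc i), Defs (Suc i), Fld (Suc i))"
    using assms(5) unfolding transformation_sequence_def by blast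
  show ?thesis
    using sequence_state[of S Defs Fld n, OF assms(4) 0 steps] by simp
qed

end
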